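(* Let $H$ be an infinite-dimensional separable Hilbert space with orthonormal basis $B=\{e_\alpha:\alpha\in I\}$, let $0<s\le1$, and let $A:C^\infty(\mathbb{T}^n,H)\to C^\infty(\mathbb{T}^n,H)$ be a vector-valued periodic pseudo-differential operator with operator-valued symbol $\sigma:\mathbb{T}^n\times\mathbb{Z}^n\to\mathcal{L}(H)$. Let $1\le p_1,p_2<\infty$ and suppose that $$\sum_{\xi\in\mathbb{Z}^n}\sum_{\alpha\in I}\|\sigma(\cdot,\xi)e_\alpha\|^s_{L^{p_2}(\mathbb{T}^n,H)}<\infty .$$ Then $A$ extends to an $s$-nuclear operator $A:L^{p_1}(\mathbb{T}^n,H)\to L^{p_2}(\mathbb{T}^n,H)$. If moreover $p_1=p_2=p$ with $1\le p<\infty$, then the nuclear trace of $A$ is $$\textbf{n-Tr}(A)=\sum_{\xi\in\mathbb{Z}^n}\sum_{\alpha\in I}\int_{\mathbb{T}^n}\langle\sigma(x,\xi)e_\alpha,e_\alpha\rangle_H\,dx .$$ In particular, if $A$ is a Fourier multiplier with symbol $\sigma(\xi)$ (i.e. $\sigma$ does not depend on $x$), then $\sigma(\xi)$ belongs to the Schatten–von Neumann class $\mathfrak{S}_s(H)$ of order $s$ for every $\xi\in\mathbb{Z}^n$, and $$\textbf{n-Tr}(A)=\sum_{\xi\in\mathbb{Z}^n}\textbf{n-Tr}(\sigma(\xi)).$$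
   Context: $\mathbb{T}^n=\mathbb{R}^n/\mathbb{Z}^n$ with its normalized Lebesgue measure; $L^p(\mathbb{T}^n,H)$ is the Bochner space; $\mathcal{L}(H)$ is the algebra of bounded linear operators on $H$. For $f\in C^\infty(\mathbb{T}^n,H)$, $\widehat f(\xi)=\int_{\mathbb{T}^n}e^{-2\pi i x\cdot\xi}f(x)\,dx\in H$, and the pseudo-differential operator with symbol $\sigma$ is $Af(x)=\sum_{\xi\in\mathbb{Z}^n}e^{2\pi i x\cdot\xi}\sigma(x,\xi)\widehat f(\xi)$. A linear operator $T:E\to F$ between Banach spaces is $s$-nuclear ($0<s\le1$) if there are $\{\phi_k\}\subset E'$, $\{\psi_k\}\subset F$ with $\sum_k\|\phi_k\|_{E'}^s\|\psi_k\|_F^s<\infty$ and $Tf=\sum_k\langle\phi_k,f\rangle\psi_k$ for all $f\in E$. If $E=F$ has the approximation property (as do $H$ and $L^p(\mathbb{T}^n,H)$), the nuclear trace is $\textbf{n-Tr}(T)=\sum_k\langle\phi_k,\psi_k\rangle$, independent of the chosen decomposition. $\mathfrak{S}_s(H)$ is the class of compact operators on $H$ whose singular values form an $\ell^s$ sequence. *)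

theory Defs
  imports "HOL-Analysis.Analysis"
begin

section \<open>Complex vector spaces and separable complex Hilbert spaces\<close>

class scaleC =
  fixes scaleC :: "complex \<Rightarrow> 'a \<Rightarrow> 'a"  (infixr \<open>*\<^sub>C\<close> 75)

class complex_vector = scaleC + ab_group_add +
  assumes scaleC_add_right: "a *\<^sub>C (x + y) = a *\<^sub>C x + a *\<^sub>C y"
    and scaleC_add_left: "(a + b) *\<^sub>C x = a *\<^sub>C x + b *\<^sub>C x"
    and scaleC_scaleC: "a *\<^sub>C b *\<^sub>C x = (a * b) *\<^sub>C x"
    and scaleC_one: "1 *\<^sub>C x = x"

global_interpretation complex_vector:
  vector_space "scaleC :: complex \<Rightarrow> 'a \<Rightarrow> 'a::complex_vector"
  defines cspan = complex_vector.span
    and cdim = complex_vector.dim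
  by unfold_locales
    (rule scaleC_add_right scaleC_add_left scaleC_scaleC scaleC_one)+

text \<open>Completeness comes from \<^class>\<open>banach\<close> and separability from
  \<^class>\<open>second_countable_topology\<close>. The inner product is linear in the first argument.\<close>

class complex_hilbert = complex_vector + banach + second_countable_topology +
  fixes cinner :: "'a \<Rightarrow> 'a \<Rightarrow> complex"
  assumes scaleR_scaleC: "r *\<^sub>R x = complex_of_real r *\<^sub>C x"
    and cinner_add_left: "cinner (x + y) z = cinner x z + cinner y z"
    and cinner_scaleC_left: "cinner (c *\<^sub>C x) y = c * cinner x y"
    and cinner_commute: "cinner x y = cnj (cinner y x)"
    and cinner_self: "cinner x x = complex_of_real ((norm x)\<^sup>2)"

lemma norm_scaleC: "norm (c *\<^sub>C x) = cmod c * norm (x :: 'h::complex_hilbert)"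
proof -
  have "complex_of_real ((norm (c *\<^sub>C x))\<^sup>2) = cinner (c *\<^sub>C x) (c *\<^sub>C x)"
    by (simp add: cinner_self)
  also have "\<dots> = c * cnj (cinner (c *\<^sub>C x) x)"
    by (metis cinner_commute cinner_scaleC_left)
  also have "\<dots> = c * cnj c * complex_of_real ((norm x)\<^sup>2)"
    by (simp add: cinner_scaleC_left cinner_self)
  also have "\<dots> = complex_of_real ((cmod c * norm x)\<^sup>2)"
    by (simp only: complex_norm_square [symmetric] power_mult_distrib of_real_mult)
  finally have "(norm (c *\<^sub>C x))\<^sup>2 = (cmod c * norm x)\<^sup>2"
    by (simp only: of_real_eq_iff)
  then show ?thesis
    by (simp add: power2_eq_iff_nonneg)
qed

lemma bounded_linear_scaleC: "bounded_linear ((*\<^sub>C) c :: 'h::complex_hilbert \<Rightarrow> 'h)"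
  by (rule bounded_linear_intro [where K = "cmod c"])
    (simp_all add: scaleC_add_right scaleR_scaleC scaleC_scaleC mult.commute norm_scaleC)

lemma borel_measurable_scaleC:
  "f \<in> borel_measurable M \<Longrightarrow> (\<lambda>x. c *\<^sub>C f x :: 'h::complex_hilbert) \<in> borel_measurable M"
  by (rule borel_measurable_continuous_on
      [OF linear_continuous_on [OF bounded_linear_scaleC]])

definition infinite_dimensional :: "'h::complex_hilbert itself \<Rightarrow> bool" where
  "infinite_dimensional _ \<longleftrightarrow> \<not> (\<exists>B. finite B \<and> cspan B = (UNIV :: 'h set))"

definition orthonormal_basis :: "'i set \<Rightarrow> ('i \<Rightarrow> 'h::complex_hilbert) \<Rightarrow> bool" where
  "orthonormal_basis I e \<longleftrightarrow>
     (\<forall>\<alpha>\<in>I. \<forall>\<beta>\<in>I. cinner (e \<alpha>) (e \<beta>) = (if \<alpha> = \<beta> then 1 else 0)) \<and>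
     closure (cspan (e ` I)) = UNIV"

definition bounded_clinear :: "('h::complex_hilbert \<Rightarrow> 'h) \<Rightarrow> bool" where
  "bounded_clinear T \<longleftrightarrow> bounded_linear T \<and> (\<forall>c x. T (c *\<^sub>C x) = c *\<^sub>C T x)"


section \<open>Schatten--von Neumann classes\<close>

definition cadjoint :: "('h::complex_hilbert \<Rightarrow> 'h) \<Rightarrow> 'h \<Rightarrow> 'h" where
  "cadjoint T = (THE S. \<forall>x y. cinner (T x) y = cinner x (S y))"

definition compact_operator :: "('h::complex_hilbert \<Rightarrow> 'h) \<Rightarrow> bool" where
  "compact_operator T \<longleftrightarrow> bounded_clinear T \<and> compact (closure (T ` cball 0 1))"

text \<open>The nonzero singular values of \<open>T\<close> are the positive square roots of the eigenvalues of
  \<open>T\<^sup>* T\<close>; the multiplicity of \<open>\<mu>\<close> is the dimension of the eigenspace, which is finite when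
  \<open>T\<close> is compact. Membership in \<open>\<ell>\<^sup>s\<close> of the sequence of singular values repeated by
  multiplicity is summability over the distinct values weighted by multiplicity; zeros do not
  contribute.\<close>

definition sv_eigenspace :: "('h::complex_hilbert \<Rightarrow> 'h) \<Rightarrow> real \<Rightarrow> 'h set" where
  "sv_eigenspace T \<mu> = {x. cadjoint T (T x) = complex_of_real (\<mu>\<^sup>2) *\<^sub>C x}"

definition singular_values :: "('h::complex_hilbert \<Rightarrow> 'h) \<Rightarrow> real set" where
  "singular_values T = {\<mu>. 0 < \<mu> \<and> (\<exists>x\<in>sv_eigenspace T \<mu>. x \<noteq> 0)}"

definition schatten :: "real \<Rightarrow> ('h::complex_hilbert \<Rightarrow> 'h) set" where
  "schatten s = {T. compact_operator T \<and>
     (\<lambda>\<mu>. real (cdim (sv_eigenspace T \<mu>)) * \<mu> powr s) summable_on singular_values T}"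


section \<open>Nuclear operators and the nuclear trace\<close>

text \<open>A complex normed space is a linear subspace \<open>vecs E\<close> of an ambient complex vector space
  with a norm \<open>nrm E\<close> on it. (The exponent \<open>p\<close> is a term, so the spaces \<open>L\<^sup>p\<close> cannot be
  types.)\<close>

record 'v normed_space =
  vecs :: "'v set"
  nrm :: "'v \<Rightarrow> real"

definition linear_operator ::
    "'v::complex_vector normed_space \<Rightarrow> 'w::complex_vector normed_space \<Rightarrow> ('v \<Rightarrow> 'w) \<Rightarrow> bool" where
  "linear_operator E F T \<longleftrightarrow>
     (\<forall>x\<in>vecs E. T x \<in> vecs F) \<and>
     (\<forall>x\<in>vecs E. \<forall>y\<in>vecs E. T (x + y) = T x + T y) \<and>
     (\<forall>c. \<forall>x\<in>vecs E. T (c *\<^sub>C x) = c *\<^sub>C T x)"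

definition dual :: "'v::complex_vector normed_space \<Rightarrow> ('v \<Rightarrow> complex) set" where
  "dual E = {\<phi>.
     (\<forall>x\<in>vecs E. \<forall>y\<in>vecs E. \<phi> (x + y) = \<phi> x + \<phi> y) \<and>
     (\<forall>c. \<forall>x\<in>vecs E. \<phi> (c *\<^sub>C x) = c * \<phi> x) \<and>
     (\<exists>B. \<forall>x\<in>vecs E. cmod (\<phi> x) \<le> B * nrm E x)}"

definition dual_norm :: "'v::complex_vector normed_space \<Rightarrow> ('v \<Rightarrow> complex) \<Rightarrow> real" where
  "dual_norm E \<phi> = (SUP x\<in>{x \<in> vecs E. nrm E x \<le> 1}. cmod (\<phi> x))"

definition nuclear_decomposition ::
    "real \<Rightarrow> 'v::complex_vector normed_space \<Rightarrow> 'w::complex_vector normed_space \<Rightarrow> ('v \<Rightarrow> 'w) \<Rightarrow>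
     (nat \<Rightarrow> 'v \<Rightarrow> complex) \<Rightarrow> (nat \<Rightarrow> 'w) \<Rightarrow> bool" where
  "nuclear_decomposition s E F T \<phi> \<psi> \<longleftrightarrow>
     (\<forall>k. \<phi> k \<in> dual E) \<and> (\<forall>k. \<psi> k \<in> vecs F) \<and>
     summable (\<lambda>k. dual_norm E (\<phi> k) powr s * nrm F (\<psi> k) powr s) \<and>
     (\<forall>f\<in>vecs E. (\<lambda>m. nrm F (T f - (\<Sum>k<m. \<phi> k f *\<^sub>C \<psi> k))) \<longlonglongrightarrow> 0)"

definition s_nuclear ::
    "real \<Rightarrow> 'v::complex_vector normed_space \<Rightarrow> 'w::complex_vector normed_space \<Rightarrow> ('v \<Rightarrow> 'w) \<Rightarrow> bool"
  where
  "s_nuclear s E F T \<longleftrightarrow>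
     linear_operator E F T \<and> (\<exists>\<phi> \<psi>. nuclear_decomposition s E F T \<phi> \<psi>)"

text \<open>All decompositions with \<open>s = 1\<close> are admitted: for \<open>s \<le> 1\<close> every \<open>s\<close>-nuclear
  decomposition is also a \<open>1\<close>-nuclear one, so the trace does not depend on \<open>s\<close>. The definite
  description is only meaningful if all decompositions of \<open>T\<close> give the same value.\<close>

definition nuclear_trace :: "'v::complex_vector normed_space \<Rightarrow> ('v \<Rightarrow> 'v) \<Rightarrow> complex" where
  "nuclear_trace E T =
     (THE t. \<exists>\<phi> \<psi>. nuclear_decomposition 1 E E T \<phi> \<psi> \<and> (\<lambda>k. \<phi> k (\<psi> k)) sums t)"

definition H_space :: "'h::complex_hilbert normed_space" where
  "H_space = \<lparr>vecs = UNIV, nrm = norm\<rparr>"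


section \<open>The Bochner spaces of the torus\<close>

text \<open>Up to a null set the closed unit cube is a fundamental domain of \<open>\<real>\<^sup>n / \<int>\<^sup>n\<close>, and Lebesgue
  measure on it is the normalized measure of the torus.\<close>

definition torus :: "(real^'n) measure" where
  "torus = lebesgue_on (cbox 0 1)"

text \<open>Almost-everywhere classes of measurable functions from the torus to \<open>H\<close>. As \<open>H\<close> is
  separable, Borel measurability is strong measurability.\<close>

definition ae_rel :: "(real^'n \<Rightarrow> 'h::complex_hilbert) \<Rightarrow> (real^'n \<Rightarrow> 'h) \<Rightarrow> bool" where
  "ae_rel f g \<longleftrightarrow>
     f \<in> borel_measurable torus \<and> g \<in> borel_measurable torus \<and> (AE x in torus. f x = g x)"

quotient_type (overloaded) ('n, 'h) torus_L0 =
    "real^'n::finite \<Rightarrow> 'h::complex_hilbert" / partial: ae_rel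
  morphisms rep_L0 ae_class
proof (rule part_equivpI)
  show "\<exists>f :: real^'n \<Rightarrow> 'h. ae_rel f f"
    by (rule exI [where x = "\<lambda>_. 0"]) (simp add: ae_rel_def)
  show "symp (ae_rel :: (real^'n \<Rightarrow> 'h) \<Rightarrow> _)"
    by (rule sympI) (auto simp: ae_rel_def eq_commute)
  show "transp (ae_rel :: (real^'n \<Rightarrow> 'h) \<Rightarrow> _)"
    by (rule transpI) (auto simp: ae_rel_def)
qed

instantiation torus_L0 :: (finite, complex_hilbert) complex_vector
begin

lift_definition zero_torus_L0 :: "('a, 'b) torus_L0" is "\<lambda>_. 0"
  by (simp add: ae_rel_def)

lift_definition plus_torus_L0 :: "('a, 'b) torus_L0 \<Rightarrow> ('a, 'b) torus_L0 \<Rightarrow> ('a, 'b) torus_L0"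
  is "\<lambda>f g x. f x + g x"
  by (auto simp: ae_rel_def elim: AE_mp)

lift_definition uminus_torus_L0 :: "('a, 'b) torus_L0 \<Rightarrow> ('a, 'b) torus_L0" is "\<lambda>f x. - f x"
  by (auto simp: ae_rel_def elim: AE_mp)

lift_definition minus_torus_L0 :: "('a, 'b) torus_L0 \<Rightarrow> ('a, 'b) torus_L0 \<Rightarrow> ('a, 'b) torus_L0"
  is "\<lambda>f g x. f x - g x"
  by (auto simp: ae_rel_def elim: AE_mp)

lift_definition scaleC_torus_L0 :: "complex \<Rightarrow> ('a, 'b) torus_L0 \<Rightarrow> ('a, 'b) torus_L0"
  is "\<lambda>c f x. c *\<^sub>C f x"
  by (auto simp: ae_rel_def borel_measurable_scaleC elim: AE_mp)

instance
proof
  fix a b :: complex and x y z :: "('a, 'b) torus_L0"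
  show "x + y + z = x + (y + z)" by transfer (auto simp: ae_rel_def add.assoc)
  show "x + y = y + x" by transfer (auto simp: ae_rel_def add.commute)
  show "0 + x = x" by transfer (auto simp: ae_rel_def)
  show "- x + x = 0" by transfer (auto simp: ae_rel_def)
  show "x - y = x + - y" by transfer (auto simp: ae_rel_def)
  show "a *\<^sub>C (x + y) = a *\<^sub>C x + a *\<^sub>C y"
    by transfer (auto simp: ae_rel_def scaleC_add_right
        intro!: borel_measurable_add borel_measurable_scaleC)
  show "(a + b) *\<^sub>C x = a *\<^sub>C x + b *\<^sub>C x"
    by transfer (auto simp: ae_rel_def scaleC_add_left
        intro!: borel_measurable_add borel_measurable_scaleC)
  show "a *\<^sub>C b *\<^sub>C x = (a * b) *\<^sub>C x"
    by transfer (auto simp: ae_rel_def borel_measurable_scaleC scaleC_scaleC)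
  show "1 *\<^sub>C x = x"
    by transfer (auto simp: ae_rel_def scaleC_one)
qed

end

definition Lp_fun :: "real \<Rightarrow> (real^'n \<Rightarrow> 'h::complex_hilbert) set" where
  "Lp_fun p = {f \<in> borel_measurable torus. integrable torus (\<lambda>x. norm (f x) powr p)}"

lift_definition in_Lp :: "real \<Rightarrow> ('n::finite, 'h::complex_hilbert) torus_L0 \<Rightarrow> bool"
  is "\<lambda>p f. f \<in> Lp_fun p"
proof -
  fix p and f g :: "real^'n \<Rightarrow> 'h"
  assume fg: "ae_rel f g"
  then have [measurable]: "f \<in> borel_measurable torus" "g \<in> borel_measurable torus"
    and eq: "AE x in torus. norm (f x) powr p = norm (g x) powr p"
    by (auto simp: ae_rel_def)
  have "integrable torus (\<lambda>x. norm (f x) powr p) = integrable torus (\<lambda>x. norm (g x) powr p)"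
    by (rule integrable_cong_AE) (use eq in measurable)
  then show "(f \<in> Lp_fun p) = (g \<in> Lp_fun p)"
    by (simp add: Lp_fun_def)
qed

lift_definition Lp_norm :: "real \<Rightarrow> ('n::finite, 'h::complex_hilbert) torus_L0 \<Rightarrow> real"
  is "\<lambda>p f. (LINT x|torus. norm (f x) powr p) powr (1 / p)"
proof -
  fix p and f g :: "real^'n \<Rightarrow> 'h"
  assume fg: "ae_rel f g"
  then have [measurable]: "f \<in> borel_measurable torus" "g \<in> borel_measurable torus"
    and eq: "AE x in torus. norm (f x) powr p = norm (g x) powr p"
    by (auto simp: ae_rel_def)
  have "(LINT x|torus. norm (f x) powr p) = (LINT x|torus. norm (g x) powr p)"
    by (rule integral_cong_AE) (use eq in measurable)
  then show "(LINT x|torus. norm (f x) powr p) powr (1 / p) =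
      (LINT x|torus. norm (g x) powr p) powr (1 / p)"
    by simp
qed

definition Lp_space :: "real \<Rightarrow> ('n::finite, 'h::complex_hilbert) torus_L0 normed_space" where
  "Lp_space p = \<lparr>vecs = {f. in_Lp p f}, nrm = Lp_norm p\<rparr>"


section \<open>Pseudo-differential operators on the torus\<close>

text \<open>Functions on the torus are \<open>\<int>\<^sup>n\<close>-periodic functions on \<open>\<real>\<^sup>n\<close>.\<close>

definition int_vec :: "int^'n \<Rightarrow> real^'n" where
  "int_vec \<xi> = (\<chi> i. real_of_int (\<xi> $ i))"

definition periodic :: "(real^'n \<Rightarrow> 'b) \<Rightarrow> bool" where
  "periodic f \<longleftrightarrow> (\<forall>x m. f (x + int_vec m) = f x)"

fun Ck :: "nat \<Rightarrow> ('a::real_normed_vector \<Rightarrow> 'b::real_normed_vector) \<Rightarrow> bool" where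
  "Ck 0 f \<longleftrightarrow> continuous_on UNIV f"
| "Ck (Suc k) f \<longleftrightarrow>
     (\<forall>x. f differentiable (at x)) \<and> (\<forall>v. Ck k (\<lambda>x. frechet_derivative f (at x) v))"

definition smooth_torus :: "(real^'n \<Rightarrow> 'h::complex_hilbert) set" where
  "smooth_torus = {f. periodic f \<and> (\<forall>k. Ck k f)}"

definition fourier_coeff :: "(real^'n \<Rightarrow> 'h::complex_hilbert) \<Rightarrow> int^'n \<Rightarrow> 'h" where
  "fourier_coeff f \<xi> = (LINT x|torus. cis (- 2 * pi * (x \<bullet> int_vec \<xi>)) *\<^sub>C f x)"

definition operator_symbol :: "(real^'n \<Rightarrow> int^'n \<Rightarrow> 'h::complex_hilbert \<Rightarrow> 'h) \<Rightarrow> bool" where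
  "operator_symbol \<sigma> \<longleftrightarrow> (\<forall>x \<xi>. bounded_clinear (\<sigma> x \<xi>)) \<and> (\<forall>\<xi>. periodic (\<lambda>x. \<sigma> x \<xi>))"

text \<open>No growth or smoothness condition is put on \<open>\<sigma>\<close>; that \<open>A\<close> maps smooth functions to smooth
  functions makes each \<open>x \<mapsto> \<sigma>(x, \<xi>) v\<close> smooth, by applying \<open>A\<close> to
  \<open>x \<mapsto> e\<^bsup>2 \<pi> i x \<cdot> \<xi>\<^esup> v\<close>.\<close>

definition pseudo_differential ::
    "(real^'n \<Rightarrow> int^'n \<Rightarrow> 'h::complex_hilbert \<Rightarrow> 'h) \<Rightarrow>
     ((real^'n \<Rightarrow> 'h) \<Rightarrow> real^'n \<Rightarrow> 'h) \<Rightarrow> bool" where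
  "pseudo_differential \<sigma> A \<longleftrightarrow> operator_symbol \<sigma> \<and>
     (\<forall>f\<in>smooth_torus. A f \<in> smooth_torus \<and>
       (\<forall>x. ((\<lambda>\<xi>. cis (2 * pi * (x \<bullet> int_vec \<xi>)) *\<^sub>C \<sigma> x \<xi> (fourier_coeff f \<xi>))
          has_sum A f x) UNIV))"

definition extends_psdo ::
    "((real^'n \<Rightarrow> 'h) \<Rightarrow> real^'n \<Rightarrow> 'h::complex_hilbert) \<Rightarrow>
     (('n::finite, 'h) torus_L0 \<Rightarrow> ('n, 'h) torus_L0) \<Rightarrow> bool" where
  "extends_psdo A T \<longleftrightarrow> (\<forall>f\<in>smooth_torus. T (ae_class f) = ae_class (A f))"

end

theory Submission
  imports Defs
begin

text \<open>Expanding \<open>(\<F> f)(\<xi>)\<close> in the basis writes the operator as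
  \<open>\<Sum>\<^bsub>\<xi>,\<alpha>\<^esub> \<langle>(\<F> f)(\<xi>), e\<^sub>\<alpha>\<rangle> \<psi>\<^bsub>\<xi>,\<alpha>\<^esub>\<close> with
  \<open>\<psi>\<^bsub>\<xi>,\<alpha>\<^esub>(x) = e\<^bsup>2 \<pi> i x \<cdot> \<xi>\<^esup> \<sigma>(x, \<xi>) e\<^sub>\<alpha>\<close>, which the hypothesis turns into an
  \<open>s\<close>-nuclear decomposition. The trace does not depend on the decomposition, because \<open>L\<^sup>p\<close>
  is the strong limit of contractions of finite rank \<open>P\<close> (averages over finite partitions), and
  \<open>\<Sum>\<^sub>k \<phi>\<^sub>k(P \<psi>\<^sub>k)\<close> depends only on \<open>T\<close>. Any nuclear extension agrees with the series on trigonometric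
  polynomials, which are dense, so the trace may be read off the series. For a multiplier \<open>\<tau>\<close>, Jensen's
  and Bessel's inequalities bound \<open>\<Sum>\<^sub>j \<mu>\<^sub>j\<^sup>s\<close> by \<open>\<Sum>\<^sub>\<alpha> \<parallel>\<tau> e\<^sub>\<alpha>\<parallel>\<^sup>s\<close>.\<close>

section \<open>Complex Hilbert spaces\<close>

text \<open>The trace is a definite description over all decompositions, so its independence of the
  decomposition is part of the claim. Contractions are used because
  \<open>\<phi> k (P (\<psi> k))\<close> is then dominated by the product of the norms of
  \<open>\<phi> k\<close> and \<open>\<psi> k\<close> whatever \<open>P\<close> is, and Tannery's
  theorem lets \<open>P\<close> tend to the identity inside the series. An extension
  \<open>T\<close> is prescribed only on classes of smooth functions; its values on the rest of L^p
  are pinned down by boundedness, which its own nuclear decomposition supplies. The condition s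
  \<le> 1 acts through l^s \<subseteq> l^1: it turns the hypothesis into absolute convergence, which
  permits both the enumeration of the pairs (\<xi>, \<alpha>) by natural numbers and the return to
  iterated sums. The operator series is summed pointwise almost everywhere, with Fatou's lemma
  bounding its tails in L^p; at almost every point the double family is absolutely summable and can
  be compared with the series defining A.\<close>

lemma scaleC_zero_left [simp]: "0 *\<^sub>C x = (0::'a::complex_vector)"
  and scaleC_zero_right [simp]: "c *\<^sub>C 0 = (0::'a::complex_vector)"
  and scaleC_minus_left: "(- c) *\<^sub>C x = - (c *\<^sub>C (x::'a::complex_vector))"
  and scaleC_diff_left: "(a - b) *\<^sub>C x = a *\<^sub>C x - b *\<^sub>C (x::'a::complex_vector)"
  by (rule complex_vector.scale_zero_left complex_vector.scale_zero_right
      complex_vector.scale_minus_left complex_vector.scale_left_diff_distrib)+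

declare scaleC_one [simp]

section \<open>Sesquilinearity and the Cauchy-Schwarz inequality\<close>

lemma cnj_cinner: "cnj (cinner x y) = cinner y (x::'h::complex_hilbert)"
  using cinner_commute[of y x] by simp

lemma cinner_add_right: "cinner x (y + z) = cinner x y + cinner x (z::'h::complex_hilbert)"
  using cinner_add_left[of y z x, THEN arg_cong[where f = cnj]] by (simp add: cnj_cinner)

lemma cinner_scaleC_right: "cinner x (c *\<^sub>C y) = cnj c * cinner x (y::'h::complex_hilbert)"
  using cinner_scaleC_left[of c y x, THEN arg_cong[where f = cnj]] by (simp add: cnj_cinner)

lemma cinner_zero_left [simp]: "cinner 0 (y::'h::complex_hilbert) = 0"
  using cinner_scaleC_left[of 0 0 y] by simp

lemma cinner_zero_right [simp]: "cinner (y::'h::complex_hilbert) 0 = 0"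
  using cinner_scaleC_right[of y 0 0] by simp

lemma cinner_minus_left: "cinner (- x) y = - cinner x (y::'h::complex_hilbert)"
  using cinner_scaleC_left[of "-1" x y] by (simp add: scaleC_minus_left)

lemma cinner_minus_right: "cinner x (- y) = - cinner x (y::'h::complex_hilbert)"
  using cinner_scaleC_right[of x "-1" y] by (simp add: scaleC_minus_left)

lemma cinner_diff_left: "cinner (x - y) z = cinner x z - cinner y (z::'h::complex_hilbert)"
  using cinner_add_left[of x "- y" z] by (simp add: cinner_minus_left)

lemma cinner_diff_right: "cinner z (x - y) = cinner z x - cinner z (y::'h::complex_hilbert)"
  using cinner_add_right[of z x "- y"] by (simp add: cinner_minus_right)

lemma cinner_sum_left: "cinner (\<Sum>i\<in>A. f i) y = (\<Sum>i\<in>A. cinner (f i) (y::'h::complex_hilbert))"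
  by (induction A rule: infinite_finite_induct) (simp_all add: cinner_add_left)

lemma cinner_sum_right: "cinner y (\<Sum>i\<in>A. f i) = (\<Sum>i\<in>A. cinner (y::'h::complex_hilbert) (f i))"
  by (induction A rule: infinite_finite_induct) (simp_all add: cinner_add_right)

lemma cinner_eqI:
  assumes "\<And>z. cinner x z = cinner y (z::'h::complex_hilbert)"
  shows "x = y"
proof -
  have "cinner (x - y) (x - y) = 0"
    using assms by (simp add: cinner_diff_left)
  then show ?thesis by (simp add: cinner_self)
qed

lemma cinner_mult_commute_norm: "cinner x y * cinner y x = complex_of_real ((cmod (cinner x (y::'h::complex_hilbert)))\<^sup>2)"
  by (simp only: cnj_cinner[of x y, symmetric] complex_norm_square)

text \<open>The right-hand side is the defect in Cauchy-Schwarz for a unit vector \<open>y\<close>;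
  that the left-hand side is a square gives the inequality.\<close>

lemma norm_diff_projection:
  fixes x y :: "'h::complex_hilbert"
  assumes "norm y = 1"
  shows "(norm (x - cinner x y *\<^sub>C y))\<^sup>2 = (norm x)\<^sup>2 - (cmod (cinner x y))\<^sup>2"
proof -
  have "complex_of_real ((norm (x - cinner x y *\<^sub>C y))\<^sup>2)
      = cinner x x - cinner x y * cinner y x"
  proof -
    have "cnj (cinner x y) = cinner y x" and "cinner y y = 1"
      using assms cinner_commute[of y x] by (simp_all add: cinner_self)
    then show ?thesis
      unfolding cinner_self[symmetric]
      by (simp add: cinner_diff_left cinner_diff_right cinner_scaleC_left cinner_scaleC_right)
  qed
  also have "\<dots> = complex_of_real ((norm x)\<^sup>2 - (cmod (cinner x y))\<^sup>2)"
    by (simp only: cinner_self cinner_mult_commute_norm of_real_diff)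
  finally show ?thesis by (simp only: of_real_eq_iff)
qed

lemma cinner_Cauchy_Schwarz: "cmod (cinner x y) \<le> norm x * norm (y::'h::complex_hilbert)"
proof (cases "y = 0")
  case False
  define u where "u = complex_of_real (1 / norm y) *\<^sub>C y"
  have u: "norm u = 1" and y: "y = complex_of_real (norm y) *\<^sub>C u"
    using False by (simp_all add: u_def norm_scaleC scaleC_scaleC norm_divide)
  have "(cmod (cinner x u))\<^sup>2 \<le> (norm x)\<^sup>2"
    using zero_le_power2[of "norm (x - cinner x u *\<^sub>C u)"]
    unfolding norm_diff_projection[OF u] by simp
  then have "cmod (cinner x u) \<le> norm x"
    by (rule power2_le_imp_le) simp
  then have "cmod (cinner x u) * norm y \<le> norm x * norm y"
    by (rule mult_right_mono) simp
  moreover have "cinner x y = complex_of_real (norm y) * cinner x u"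
    using cinner_scaleC_right[of x "complex_of_real (norm y)" u] y by simp
  ultimately show ?thesis
    by (simp add: norm_mult mult.commute)
qed simp

lemma bounded_linear_cinner_left: "bounded_linear (\<lambda>x. cinner x (y::'h::complex_hilbert))"
  by (rule bounded_linear_intro[where K = "norm y"])
    (simp_all add: cinner_add_left scaleR_scaleC cinner_scaleC_left scaleR_conv_of_real cinner_Cauchy_Schwarz)

lemma bounded_linear_cinner_right: "bounded_linear (\<lambda>y. cinner (x::'h::complex_hilbert) y)"
proof (rule bounded_linear_intro[where K = "norm x"])
  show "cmod (cinner x y) \<le> norm y * norm x" for y
    using cinner_Cauchy_Schwarz[of x y] by (simp only: mult.commute)
qed (simp_all add: cinner_add_right scaleR_scaleC cinner_scaleC_right scaleR_conv_of_real)

lemma bounded_linear_scaleC_left: "bounded_linear (\<lambda>c. c *\<^sub>C (x::'h::complex_hilbert))"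
  by (rule bounded_linear_intro[where K = "norm x"])
    (simp_all add: scaleC_add_left scaleR_scaleC scaleC_scaleC scaleR_conv_of_real norm_scaleC)

section \<open>Orthonormal families and bases\<close>

lemma Pythagoras_sum:
  fixes v :: "'i \<Rightarrow> 'h::complex_hilbert"
  assumes "finite F" and "\<And>i j. i \<in> F \<Longrightarrow> j \<in> F \<Longrightarrow> i \<noteq> j \<Longrightarrow> cinner (v i) (v j) = 0"
  shows "(norm (\<Sum>i\<in>F. v i))\<^sup>2 = (\<Sum>i\<in>F. (norm (v i))\<^sup>2)"
proof -
  have "complex_of_real ((norm (\<Sum>i\<in>F. v i))\<^sup>2) = (\<Sum>i\<in>F. \<Sum>j\<in>F. cinner (v i) (v j))"
    by (simp only: cinner_self[symmetric] cinner_sum_left cinner_sum_right) (rule sum.swap)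
  also have "\<dots> = (\<Sum>i\<in>F. \<Sum>j\<in>F. if j = i then cinner (v i) (v i) else 0)"
    using assms(2) by (intro sum.cong) auto
  also have "\<dots> = complex_of_real (\<Sum>i\<in>F. (norm (v i))\<^sup>2)"
    using assms(1) by (simp add: cinner_self)
  finally show ?thesis by (simp only: of_real_eq_iff)
qed

definition orthonormal_on :: "'i set \<Rightarrow> ('i \<Rightarrow> 'h::complex_hilbert) \<Rightarrow> bool" where
  "orthonormal_on I e \<longleftrightarrow> (\<forall>\<alpha>\<in>I. \<forall>\<beta>\<in>I. cinner (e \<alpha>) (e \<beta>) = (if \<alpha> = \<beta> then 1 else 0))"

lemma orthonormal_on_subset: "orthonormal_on I e \<Longrightarrow> J \<subseteq> I \<Longrightarrow> orthonormal_on J e"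
  unfolding orthonormal_on_def by blast

lemma orthonormal_on_norm:
  assumes "orthonormal_on I e" "\<alpha> \<in> I"
  shows "norm (e \<alpha>) = 1"
proof -
  have "complex_of_real ((norm (e \<alpha>))\<^sup>2) = 1"
    using assms by (simp add: orthonormal_on_def cinner_self[symmetric] del: of_real_power)
  then have "(norm (e \<alpha>))\<^sup>2 = 1"
    by (simp only: of_real_eq_1_iff)
  then show ?thesis
    using norm_ge_zero[of "e \<alpha>"] by (auto simp: power2_eq_1_iff)
qed

lemma orthonormal_projection_cinner:
  assumes "orthonormal_on F e" "finite F" "\<beta> \<in> F"
  shows "cinner (\<Sum>\<alpha>\<in>F. c \<alpha> *\<^sub>C e \<alpha>) (e \<beta>) = c \<beta>"
proof -
  have "cinner (\<Sum>\<alpha>\<in>F. c \<alpha> *\<^sub>C e \<alpha>) (e \<beta>) = (\<Sum>\<alpha>\<in>F. if \<alpha> = \<beta> then c \<alpha> else 0)"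
    using assms(1,3) unfolding cinner_sum_left cinner_scaleC_left
    by (intro sum.cong) (auto simp: orthonormal_on_def)
  then show ?thesis using assms(2,3) by simp
qed

lemma orthonormal_norm_sum:
  assumes "orthonormal_on F e" "finite F"
  shows "(norm (\<Sum>\<alpha>\<in>F. c \<alpha> *\<^sub>C e \<alpha>))\<^sup>2 = (\<Sum>\<alpha>\<in>F. (cmod (c \<alpha>))\<^sup>2)"
  using assms
  by (subst Pythagoras_sum)
    (auto simp: cinner_scaleC_left cinner_scaleC_right orthonormal_on_def norm_scaleC
      power_mult_distrib orthonormal_on_norm[OF assms(1)])

text \<open>The residual after projection is orthogonal to every combination of the
  \<open>e \<alpha>\<close>, so Pythagoras splits the error. Taking \<open>c = 0\<close> gives
  Bessel's inequality; arbitrary \<open>c\<close> shows that the projection is the nearest point,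
  which drives the convergence of expansions.\<close>

lemma orthonormal_best_approximation:
  fixes x :: "'h::complex_hilbert"
  assumes on: "orthonormal_on F e" and fin: "finite F"
  shows "(norm (x - (\<Sum>\<alpha>\<in>F. c \<alpha> *\<^sub>C e \<alpha>)))\<^sup>2 =
    (norm (x - (\<Sum>\<alpha>\<in>F. cinner x (e \<alpha>) *\<^sub>C e \<alpha>)))\<^sup>2 + (\<Sum>\<alpha>\<in>F. (cmod (cinner x (e \<alpha>) - c \<alpha>))\<^sup>2)"
proof -
  define y z where "y = x - (\<Sum>\<alpha>\<in>F. cinner x (e \<alpha>) *\<^sub>C e \<alpha>)"
    and "z = (\<Sum>\<alpha>\<in>F. (cinner x (e \<alpha>) - c \<alpha>) *\<^sub>C e \<alpha>)"
  have "cinner y (e \<beta>) = 0" if "\<beta> \<in> F" for \<beta>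
    using orthonormal_projection_cinner[OF on fin that] by (simp add: y_def cinner_diff_left)
  then have 0: "cinner y z = 0" "cinner z y = 0"
    using cinner_commute[of z y] by (simp_all add: z_def cinner_sum_right cinner_scaleC_right)
  have "x - (\<Sum>\<alpha>\<in>F. c \<alpha> *\<^sub>C e \<alpha>) = y + z"
    by (simp add: y_def z_def scaleC_diff_left sum_subtractf)
  moreover have "complex_of_real ((norm (y + z))\<^sup>2) = complex_of_real ((norm y)\<^sup>2 + (norm z)\<^sup>2)"
    by (simp only: cinner_self[symmetric] of_real_add cinner_add_left cinner_add_right 0 add_0_left add_0_right)
  ultimately have "(norm (x - (\<Sum>\<alpha>\<in>F. c \<alpha> *\<^sub>C e \<alpha>)))\<^sup>2 = (norm y)\<^sup>2 + (norm z)\<^sup>2"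
    by (simp only: of_real_eq_iff)
  then show ?thesis
    by (simp add: y_def z_def orthonormal_norm_sum[OF on fin])
qed

lemma Bessel:
  fixes x :: "'h::complex_hilbert"
  assumes on: "orthonormal_on F e" and fin: "finite F"
  shows "(\<Sum>\<alpha>\<in>F. (cmod (cinner x (e \<alpha>)))\<^sup>2) \<le> (norm x)\<^sup>2"
  using orthonormal_best_approximation[OF on fin, of x "\<lambda>_. 0"] by simp

lemma orthonormal_projection_norm_le:
  fixes x :: "'h::complex_hilbert"
  assumes on: "orthonormal_on F e" and fin: "finite F"
  shows "norm (\<Sum>\<alpha>\<in>F. cinner x (e \<alpha>) *\<^sub>C e \<alpha>) \<le> norm x"
  by (rule power2_le_imp_le) (simp_all add: orthonormal_norm_sum[OF on fin] Bessel[OF on fin])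

lemma orthonormal_basis_orthonormal: "orthonormal_basis I e \<Longrightarrow> orthonormal_on I e"
  by (simp add: orthonormal_basis_def orthonormal_on_def)

lemma orthonormal_on_inj: "orthonormal_on I e \<Longrightarrow> inj_on e I"
  unfolding orthonormal_on_def by (rule inj_onI) (metis zero_neq_one)

lemma cspan_image_finite_sum:
  assumes "y \<in> cspan (e ` I)" and inj: "inj_on e I"
  obtains F c where "finite F" "F \<subseteq> I" "y = (\<Sum>\<alpha>\<in>F. c \<alpha> *\<^sub>C e \<alpha>)"
proof -
  obtain t r where t: "finite t" "t \<subseteq> e ` I" and y: "y = (\<Sum>a\<in>t. r a *\<^sub>C a)"
    using assms(1) by (auto simp: complex_vector.span_explicit)
  obtain F where F: "finite F" "F \<subseteq> I" "t = e ` F"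
    using t by (meson finite_subset_image)
  have "y = (\<Sum>\<alpha>\<in>F. r (e \<alpha>) *\<^sub>C e \<alpha>)"
    unfolding y F(3) using inj_on_subset[OF inj F(2)] by (simp add: sum.reindex)
  with F show thesis by (intro that)
qed

text \<open>Density supplies one finite combination near \<open>x\<close>, and on every larger
  finite index set the projection of \<open>x\<close> is at least as close. Control over all larger
  sets is exactly unconditional convergence.\<close>

lemma orthonormal_basis_expansion:
  fixes x :: "'h::complex_hilbert"
  assumes B: "orthonormal_basis I e"
  shows "((\<lambda>\<alpha>. cinner x (e \<alpha>) *\<^sub>C e \<alpha>) has_sum x) I"
  unfolding has_sum_def
proof (rule tendstoI)
  fix d :: real assume "0 < d"
  note on = orthonormal_basis_orthonormal[OF B]
  have "x \<in> closure (cspan (e ` I))"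
    using B by (simp add: orthonormal_basis_def)
  then obtain y where y_in: "y \<in> cspan (e ` I)" and yd: "dist y x < d"
    using \<open>0 < d\<close> by (auto simp: closure_approachable)
  obtain F c where F: "finite F" "F \<subseteq> I" and y: "y = (\<Sum>\<alpha>\<in>F. c \<alpha> *\<^sub>C e \<alpha>)"
    using y_in by (rule cspan_image_finite_sum[OF _ orthonormal_on_inj[OF on]])
  have "dist (\<Sum>\<alpha>\<in>G. cinner x (e \<alpha>) *\<^sub>C e \<alpha>) x < d" if G: "finite G" "F \<subseteq> G" "G \<subseteq> I" for G
  proof -
    \<comment> \<open>Padding the coefficients with zeros makes \<open>y\<close> a competitor for
      the best approximation over \<open>G\<close>.\<close>
    have y': "y = (\<Sum>\<alpha>\<in>G. (if \<alpha> \<in> F then c \<alpha> else 0) *\<^sub>C e \<alpha>)"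
      unfolding y using G by (intro sum.mono_neutral_cong_left) auto
    have "norm (x - (\<Sum>\<alpha>\<in>G. cinner x (e \<alpha>) *\<^sub>C e \<alpha>)) \<le> norm (x - y)"
      unfolding y' by (rule power2_le_imp_le)
        (simp_all add: orthonormal_best_approximation[OF orthonormal_on_subset[OF on G(3)] G(1),
            of x "\<lambda>\<alpha>. if \<alpha> \<in> F then c \<alpha> else 0"] sum_nonneg)
    also have "\<dots> < d" using yd by (metis dist_commute dist_norm)
    finally show ?thesis by (metis dist_commute dist_norm)
  qed
  then show "\<forall>\<^sub>F G in finite_subsets_at_top I. dist (\<Sum>\<alpha>\<in>G. cinner x (e \<alpha>) *\<^sub>C e \<alpha>) x < d"
    unfolding eventually_finite_subsets_at_top by (intro exI[of _ F] conjI F allI impI) simp_all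
qed

lemma orthonormal_basis_Parseval:
  fixes x :: "'h::complex_hilbert"
  assumes B: "orthonormal_basis I e"
  shows "((\<lambda>\<alpha>. (cmod (cinner x (e \<alpha>)))\<^sup>2) has_sum (norm x)\<^sup>2) I"
proof -
  have "((\<lambda>\<alpha>. cinner (cinner x (e \<alpha>) *\<^sub>C e \<alpha>) x) has_sum cinner x x) I"
    using has_sum_bounded_linear[OF bounded_linear_cinner_left orthonormal_basis_expansion[OF B]] .
  then have "((\<lambda>\<alpha>. Re (cinner (cinner x (e \<alpha>) *\<^sub>C e \<alpha>) x)) has_sum Re (cinner x x)) I"
    using has_sum_bounded_linear[OF bounded_linear_Re] by blast
  then show ?thesis
    by (simp add: cinner_scaleC_left cinner_mult_commute_norm cinner_self del: of_real_power)
qed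

text \<open>Cauchy-Schwarz puts distinct orthonormal vectors at distance at least 1, so no point of
  a countable dense set can be within 1/2 of two of them.\<close>

lemma orthonormal_on_countable:
  assumes on: "orthonormal_on I (e :: 'i \<Rightarrow> 'h::complex_hilbert)"
  shows "countable I"
proof -
  obtain D :: "'h set" where D: "countable D" "\<And>X. open X \<Longrightarrow> X \<noteq> {} \<Longrightarrow> \<exists>d\<in>D. d \<in> X"
    using countable_dense_exists by blast
  have "\<exists>d\<in>D. dist (e \<alpha>) d < 1/2" for \<alpha>
    using D(2)[of "ball (e \<alpha>) (1/2)"] by auto
  then obtain g where g: "\<And>\<alpha>. g \<alpha> \<in> D" "\<And>\<alpha>. dist (e \<alpha>) (g \<alpha>) < 1/2"
    by metis
  have "inj_on g I"
  proof (rule inj_onI, rule ccontr)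
    fix \<alpha> \<beta> assume ab: "\<alpha> \<in> I" "\<beta> \<in> I" "g \<alpha> = g \<beta>" "\<alpha> \<noteq> \<beta>"
    have "dist (e \<alpha>) (e \<beta>) < 1"
      using g(2)[of \<alpha>] g(2)[of \<beta>] ab(3) dist_triangle_half_r[of "g \<alpha>" "e \<alpha>" 1 "e \<beta>"]
      by (simp add: dist_commute)
    moreover have "cinner (e \<alpha> - e \<beta>) (e \<alpha>) = 1"
      using on ab by (simp add: cinner_diff_left orthonormal_on_def)
    ultimately show False
      using cinner_Cauchy_Schwarz[of "e \<alpha> - e \<beta>" "e \<alpha>"] orthonormal_on_norm[OF on ab(1)]
      by (simp add: dist_norm)
  qed
  moreover have "countable (g ` I)"
    by (rule countable_subset[OF _ D(1)]) (use g(1) in auto)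
  ultimately show ?thesis
    by (rule countable_image_inj_on[rotated])
qed

text \<open>Makes it possible to enumerate \<open>I\<close> bijectively by the natural
  numbers.\<close>

lemma orthonormal_basis_infinite:
  assumes B: "orthonormal_basis I (e :: 'i \<Rightarrow> 'h::complex_hilbert)"
    and inf: "infinite_dimensional TYPE('h)"
  shows "infinite I"
proof
  assume fin: "finite I"
  have "x \<in> cspan (e ` I)" for x
  proof -
    have "x = (\<Sum>\<alpha>\<in>I. cinner x (e \<alpha>) *\<^sub>C e \<alpha>)"
      by (rule has_sum_unique[OF orthonormal_basis_expansion[OF B, of x] has_sum_finite[OF fin]])
    also have "\<dots> \<in> cspan (e ` I)"
      by (intro complex_vector.span_sum complex_vector.span_scale complex_vector.span_base) auto
    finally show ?thesis .
  qed
  then have "\<exists>B. finite B \<and> cspan B = (UNIV :: 'h set)"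
    using fin by (intro exI[of _ "e ` I"]) auto
  with inf show False
    by (simp add: infinite_dimensional_def)
qed

section \<open>Nuclear decompositions and the trace\<close>

text \<open>\<open>normed_space\<close> is a bare record, so the vector space and norm laws have to
  be imposed. The instances are \<open>H_space\<close> and \<open>Lp_space p\<close> with 1 \<le>
  p.\<close>

locale seminormed =
  fixes E :: "'v::complex_vector normed_space"
  assumes zero_mem [simp]: "0 \<in> vecs E"
    and add_mem: "x \<in> vecs E \<Longrightarrow> y \<in> vecs E \<Longrightarrow> x + y \<in> vecs E"
    and scaleC_mem: "x \<in> vecs E \<Longrightarrow> c *\<^sub>C x \<in> vecs E"
    and nrm_nonneg: "x \<in> vecs E \<Longrightarrow> 0 \<le> nrm E x"
    and nrm_triangle: "x \<in> vecs E \<Longrightarrow> y \<in> vecs E \<Longrightarrow> nrm E (x + y) \<le> nrm E x + nrm E y"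
    and nrm_scaleC: "x \<in> vecs E \<Longrightarrow> nrm E (c *\<^sub>C x) = cmod c * nrm E x"
begin

lemma minus_mem: "x \<in> vecs E \<Longrightarrow> - x \<in> vecs E"
  using scaleC_mem[of x "-1"] by (simp add: scaleC_minus_left)

lemma diff_mem: "x \<in> vecs E \<Longrightarrow> y \<in> vecs E \<Longrightarrow> x - y \<in> vecs E"
  using add_mem[of x "- y"] minus_mem by simp

lemma sum_mem: "(\<And>i. i \<in> A \<Longrightarrow> f i \<in> vecs E) \<Longrightarrow> sum f A \<in> vecs E"
  by (induction A rule: infinite_finite_induct) (auto intro: add_mem)

lemma nrm_zero [simp]: "nrm E 0 = 0"
  using nrm_scaleC[of 0 0] by simp

lemma nrm_minus: "x \<in> vecs E \<Longrightarrow> nrm E (- x) = nrm E x"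
  using nrm_scaleC[of x "-1"] by (simp add: scaleC_minus_left)

lemma nrm_diff_triangle: "x \<in> vecs E \<Longrightarrow> y \<in> vecs E \<Longrightarrow> nrm E (x - y) \<le> nrm E x + nrm E y"
  using nrm_triangle[of x "- y"] nrm_minus[of y] minus_mem[of y] by simp

lemma nrm_triangle_via:
  assumes "x \<in> vecs E" "y \<in> vecs E" "z \<in> vecs E"
  shows "nrm E (x - z) \<le> nrm E (x - y) + nrm E (y - z)"
  using nrm_triangle[of "x - y" "y - z"] assms diff_mem by simp

lemma nrm_sum_le:
  "(\<And>i. i \<in> A \<Longrightarrow> f i \<in> vecs E) \<Longrightarrow> nrm E (sum f A) \<le> (\<Sum>i\<in>A. nrm E (f i))"
proof (induction A rule: infinite_finite_induct)
  case (insert a A)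
  then show ?case
    using nrm_triangle[of "f a" "sum f A"] sum_mem[of A f] by auto
qed auto

lemma dual_add: "\<phi> \<in> dual E \<Longrightarrow> x \<in> vecs E \<Longrightarrow> y \<in> vecs E \<Longrightarrow> \<phi> (x + y) = \<phi> x + \<phi> y"
  and dual_scaleC: "\<phi> \<in> dual E \<Longrightarrow> x \<in> vecs E \<Longrightarrow> \<phi> (c *\<^sub>C x) = c * \<phi> x"
  by (auto simp: dual_def)

lemma dual_zero: "\<phi> \<in> dual E \<Longrightarrow> \<phi> 0 = 0"
  using dual_scaleC[of \<phi> 0 0] by simp

lemma dual_diff: "\<phi> \<in> dual E \<Longrightarrow> x \<in> vecs E \<Longrightarrow> y \<in> vecs E \<Longrightarrow> \<phi> (x - y) = \<phi> x - \<phi> y"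
  using dual_add[of \<phi> x "-1 *\<^sub>C y"] dual_scaleC[of \<phi> y "-1"] scaleC_mem[of y "-1"]
  by (simp add: scaleC_minus_left)

lemma dual_sum:
  "\<phi> \<in> dual E \<Longrightarrow> (\<And>i. i \<in> A \<Longrightarrow> f i \<in> vecs E) \<Longrightarrow> \<phi> (sum f A) = (\<Sum>i\<in>A. \<phi> (f i))"
proof (induction A rule: infinite_finite_induct)
  case (insert a A)
  then show ?case
    using dual_add[of \<phi> "f a" "sum f A"] sum_mem[of A f] by auto
qed (auto simp: dual_zero)

lemma dual_bdd_above:
  assumes "\<phi> \<in> dual E"
  shows "bdd_above ((\<lambda>x. cmod (\<phi> x)) ` {x \<in> vecs E. nrm E x \<le> 1})"
proof -
  obtain B where B: "\<And>x. x \<in> vecs E \<Longrightarrow> cmod (\<phi> x) \<le> B * nrm E x"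
    using assms unfolding dual_def by blast
  have "cmod (\<phi> x) \<le> \<bar>B\<bar>" if "x \<in> vecs E" "nrm E x \<le> 1" for x
  proof -
    have "B * nrm E x \<le> \<bar>B\<bar> * 1"
      using that nrm_nonneg[OF that(1)] by (intro mult_mono) auto
    with B[OF that(1)] show ?thesis by simp
  qed
  then show ?thesis by (intro bdd_aboveI2[of _ _ "\<bar>B\<bar>"]) auto
qed

lemma dual_norm_nonneg:
  assumes "\<phi> \<in> dual E"
  shows "0 \<le> dual_norm E \<phi>"
  using cSUP_upper[OF _ dual_bdd_above[OF assms], of 0] assms
  by (simp add: dual_norm_def dual_zero)

lemma dual_norm_bound:
  assumes \<phi>: "\<phi> \<in> dual E" and x: "x \<in> vecs E"
  shows "cmod (\<phi> x) \<le> dual_norm E \<phi> * nrm E x"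
proof (cases "nrm E x = 0")
  \<comment> \<open>A vector of seminorm zero cannot be normalised; boundedness forces
    \<open>\<phi> x = 0\<close>.\<close>
  case True
  obtain B where "cmod (\<phi> x) \<le> B * nrm E x"
    using \<phi> x by (auto simp: dual_def)
  with True show ?thesis by simp
next
  case False
  then have pos: "nrm E x > 0"
    using nrm_nonneg[OF x] by simp
  define y where "y = complex_of_real (1 / nrm E x) *\<^sub>C x"
  have y: "y \<in> vecs E" "nrm E y = 1"
    using x pos by (simp_all add: y_def scaleC_mem nrm_scaleC norm_divide)
  have "cmod (\<phi> y) \<le> dual_norm E \<phi>"
    unfolding dual_norm_def using y by (intro cSUP_upper dual_bdd_above \<phi>) auto
  moreover have "cmod (\<phi> y) = cmod (\<phi> x) / nrm E x"
    using pos by (simp add: y_def dual_scaleC[OF \<phi> x] norm_mult norm_divide)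
  ultimately show ?thesis
    using pos by (simp add: field_simps)
qed

lemma dual_norm_le:
  assumes "\<And>x. x \<in> vecs E \<Longrightarrow> cmod (\<phi> x) \<le> B * nrm E x" and "0 \<le> B"
  shows "dual_norm E \<phi> \<le> B"
  unfolding dual_norm_def
proof (rule cSUP_least)
  show "{x \<in> vecs E. nrm E x \<le> 1} \<noteq> {}"
    using zero_mem by (metis (mono_tags, lifting) empty_iff mem_Collect_eq nrm_zero zero_le_one)
  fix x assume x: "x \<in> {x \<in> vecs E. nrm E x \<le> 1}"
  then have "B * nrm E x \<le> B * 1"
    using assms(2) by (intro mult_left_mono) auto
  with assms(1)[of x] x show "cmod (\<phi> x) \<le> B" by simp
qed

end

text \<open>The terms tend to 0, so eventually they are at most 1, where a larger exponent gives a
  smaller power. This is l^s \<subseteq> l^t; with t = 1 it is the source of absolute convergence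
  throughout.\<close>

lemma summable_powr_mono:
  fixes a :: "nat \<Rightarrow> real"
  assumes nonneg: "\<And>k. 0 \<le> a k" and s: "0 < s" "s \<le> t" and summ: "summable (\<lambda>k. a k powr s)"
  shows "summable (\<lambda>k. a k powr t)"
proof (rule summable_comparison_test_ev[OF _ summ])
  have "(\<lambda>k. a k powr s) \<longlonglongrightarrow> 0"
    by (rule summable_LIMSEQ_zero[OF summ])
  then have "\<forall>\<^sub>F k in sequentially. a k powr s < 1"
    by (rule order_tendstoD) simp
  then show "\<forall>\<^sub>F k in sequentially. norm (a k powr t) \<le> a k powr s"
  proof eventually_elim
    case (elim k)
    have "a k \<le> 1"
    proof (rule ccontr)
      assume "\<not> a k \<le> 1"
      then have "1 \<le> a k powr s" using s by (intro ge_one_powr_ge_zero) auto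
      with elim show False by simp
    qed
    then have "a k powr t \<le> a k powr s"
      using nonneg[of k] s by (cases "a k = 0") (auto intro: powr_mono')
    then show ?case by simp
  qed
qed

text \<open>A bounded functional passes through the norm limit of the partial sums. If
  \<open>u\<close> and \<open>x\<close> are the two factors of a rank-one operator, the value
  \<open>u (T x)\<close> is the trace of its product with \<open>T\<close>.\<close>

lemma nuclear_decomposition_sums_dual:
  fixes E :: "'v::complex_vector normed_space" and F :: "'w::complex_vector normed_space"
  assumes E: "seminormed E" and F: "seminormed F"
    and T: "linear_operator E F T" and dec: "nuclear_decomposition s E F T \<phi> \<psi>"
    and u: "u \<in> dual F" and x: "x \<in> vecs E"
  shows "(\<lambda>k. \<phi> k x * u (\<psi> k)) sums u (T x)"
proof -
  interpret F: seminormed F by (rule F)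
  have mem: "\<phi> k x *\<^sub>C \<psi> k \<in> vecs F" for k
    using dec by (auto simp: nuclear_decomposition_def intro: F.scaleC_mem)
  have Tx: "T x \<in> vecs F"
    using T x by (simp add: linear_operator_def)
  have eq: "u (T x) - (\<Sum>k<m. \<phi> k x * u (\<psi> k)) = u (T x - (\<Sum>k<m. \<phi> k x *\<^sub>C \<psi> k))" for m
  proof -
    have "u (\<Sum>k<m. \<phi> k x *\<^sub>C \<psi> k) = (\<Sum>k<m. \<phi> k x * u (\<psi> k))"
      using dec by (subst F.dual_sum[OF u mem])
        (auto simp: nuclear_decomposition_def F.dual_scaleC[OF u])
    then show ?thesis
      by (simp add: F.dual_diff[OF u Tx F.sum_mem[OF mem]])
  qed
  have "(\<lambda>m. u (T x) - (\<Sum>k<m. \<phi> k x * u (\<psi> k))) \<longlonglongrightarrow> 0"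
  proof (rule Lim_null_comparison)
    show "\<forall>\<^sub>F m in sequentially. norm (u (T x) - (\<Sum>k<m. \<phi> k x * u (\<psi> k)))
        \<le> dual_norm F u * nrm F (T x - (\<Sum>k<m. \<phi> k x *\<^sub>C \<psi> k))"
      unfolding eq by (intro always_eventually allI F.dual_norm_bound u F.diff_mem Tx F.sum_mem mem)
    have "(\<lambda>m. nrm F (T x - (\<Sum>k<m. \<phi> k x *\<^sub>C \<psi> k))) \<longlonglongrightarrow> 0"
      using dec x by (simp add: nuclear_decomposition_def)
    then show "(\<lambda>m. dual_norm F u * nrm F (T x - (\<Sum>k<m. \<phi> k x *\<^sub>C \<psi> k))) \<longlonglongrightarrow> 0"
      by (rule tendsto_mult_right_zero)
  qed
  from tendsto_diff[OF tendsto_const[of "u (T x)"] this] show ?thesis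
    by (simp add: sums_def)
qed

lemma nuclear_decomposition_mono:
  fixes E :: "'v::complex_vector normed_space" and F :: "'w::complex_vector normed_space"
  assumes E: "seminormed E" and F: "seminormed F"
    and dec: "nuclear_decomposition s E F T \<phi> \<psi>" and s: "0 < s" "s \<le> t"
  shows "nuclear_decomposition t E F T \<phi> \<psi>"
proof -
  have nn: "0 \<le> dual_norm E (\<phi> k)" "0 \<le> nrm F (\<psi> k)" for k
    using dec seminormed.dual_norm_nonneg[OF E] seminormed.nrm_nonneg[OF F]
    by (auto simp: nuclear_decomposition_def)
  have "summable (\<lambda>k. (dual_norm E (\<phi> k) * nrm F (\<psi> k)) powr t)"
    using dec nn s by (intro summable_powr_mono[OF _ s])
      (auto simp: nuclear_decomposition_def powr_mult)
  with dec nn show ?thesis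
    by (auto simp: nuclear_decomposition_def powr_mult)
qed

lemma nuclear_decomposition_abs_summable:
  fixes E :: "'v::complex_vector normed_space" and F :: "'w::complex_vector normed_space"
  assumes E: "seminormed E" and F: "seminormed F"
    and dec: "nuclear_decomposition s E F T \<phi> \<psi>" and s: "0 < s" "s \<le> 1"
  shows "summable (\<lambda>k. dual_norm E (\<phi> k) * nrm F (\<psi> k))"
proof -
  have nn: "0 \<le> dual_norm E (\<phi> k)" "0 \<le> nrm F (\<psi> k)" for k
    using dec seminormed.dual_norm_nonneg[OF E] seminormed.nrm_nonneg[OF F]
    by (auto simp: nuclear_decomposition_def)
  show ?thesis
    using nuclear_decomposition_mono[OF E F dec s] nn by (simp add: nuclear_decomposition_def)
qed

section \<open>Finite-rank operators and uniqueness of the trace\<close>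

inductive finite_rank :: "'v::complex_vector normed_space \<Rightarrow> ('v \<Rightarrow> 'v) \<Rightarrow> bool" for E where
  finite_rank_zero: "finite_rank E (\<lambda>_. 0)"
| finite_rank_step: "finite_rank E P \<Longrightarrow> u \<in> dual E \<Longrightarrow> v \<in> vecs E \<Longrightarrow>
    finite_rank E (\<lambda>x. P x + u x *\<^sub>C v)"

lemma finite_rank_mem:
  assumes "seminormed E" "finite_rank E P" "x \<in> vecs E"
  shows "P x \<in> vecs E"
  using assms(2)
  by induction (use assms(1) in \<open>auto intro: seminormed.zero_mem seminormed.add_mem seminormed.scaleC_mem\<close>)

lemma finite_rank_add:
  assumes P: "finite_rank E P" and Q: "finite_rank E Q"
  shows "finite_rank E (\<lambda>x. P x + Q x)"
  using Q
proof induction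
  case finite_rank_zero
  show ?case using P by simp
next
  case (finite_rank_step Q u v)
  then have "finite_rank E (\<lambda>x. (P x + Q x) + u x *\<^sub>C v)"
    by (intro finite_rank.intros)
  then show ?case by (simp add: add.assoc)
qed

lemma finite_rank_sum:
  "(\<And>i. i \<in> A \<Longrightarrow> finite_rank E (P i)) \<Longrightarrow> finite_rank E (\<lambda>x. \<Sum>i\<in>A. P i x)"
  by (induction A rule: infinite_finite_induct) (auto intro: finite_rank_zero finite_rank_add)

lemma finite_rank_one:
  "u \<in> dual E \<Longrightarrow> v \<in> vecs E \<Longrightarrow> finite_rank E (\<lambda>x. u x *\<^sub>C v)"
  using finite_rank_step[OF finite_rank_zero, of u E v] by simp

text \<open>Finite sets \<open>S\<close> are enough because a decomposition involves only countably
  many vectors, exhausted by finite sets; for uniformly bounded operators, approximation on finite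
  sets also gives it on compact sets. The constant 1 in the bound furnishes the majorant for
  Tannery's theorem.\<close>

definition metric_approximation :: "'v::complex_vector normed_space \<Rightarrow> bool" where
  "metric_approximation E \<longleftrightarrow> (\<forall>S \<epsilon>. finite S \<longrightarrow> S \<subseteq> vecs E \<longrightarrow> 0 < \<epsilon> \<longrightarrow>
    (\<exists>P. finite_rank E P \<and> (\<forall>x\<in>vecs E. nrm E (P x) \<le> nrm E x) \<and> (\<forall>x\<in>S. nrm E (P x - x) < \<epsilon>)))"

text \<open>\<open>\<Sum>\<^sub>k u(\<psi>\<^sub>k) \<phi>\<^sub>k(v) = u(T v)\<close> for a rank-one \<open>P = u \<otimes> v\<close>, which does not see the decomposition.\<close>

lemma finite_rank_trace_indep:
  assumes E: "seminormed E" and T: "linear_operator E E T" and P: "finite_rank E P"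
  shows "\<exists>t. \<forall>\<phi> \<psi>. nuclear_decomposition 1 E E T \<phi> \<psi> \<longrightarrow> (\<lambda>k. \<phi> k (P (\<psi> k))) sums t"
  using P
proof induction
  case finite_rank_zero
  have "(\<lambda>k. \<phi> k 0) = (\<lambda>_. 0)" if "nuclear_decomposition 1 E E T \<phi> \<psi>" for \<phi> \<psi>
    using that seminormed.dual_zero[OF E] by (auto simp: nuclear_decomposition_def)
  then show ?case by (intro exI[of _ 0]) auto
next
  case (finite_rank_step P u v)
  interpret seminormed E by (rule E)
  obtain t where t: "\<And>\<phi> \<psi>. nuclear_decomposition 1 E E T \<phi> \<psi> \<Longrightarrow> (\<lambda>k. \<phi> k (P (\<psi> k))) sums t"
    using finite_rank_step.IH by blast
  have "(\<lambda>k. \<phi> k (P (\<psi> k) + u (\<psi> k) *\<^sub>C v)) sums (t + u (T v))"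
    if dec: "nuclear_decomposition 1 E E T \<phi> \<psi>" for \<phi> \<psi>
  proof -
    have \<phi>: "\<phi> k \<in> dual E" and \<psi>: "\<psi> k \<in> vecs E" for k
      using dec by (auto simp: nuclear_decomposition_def)
    have "\<phi> k (P (\<psi> k) + u (\<psi> k) *\<^sub>C v) = \<phi> k (P (\<psi> k)) + \<phi> k v * u (\<psi> k)" for k
      using finite_rank_mem[OF E finite_rank_step.hyps(1) \<psi>] finite_rank_step.hyps(3)
      by (simp add: dual_add[OF \<phi>] dual_scaleC[OF \<phi>] scaleC_mem)
    then show ?thesis
      using sums_add[OF t[OF dec] nuclear_decomposition_sums_dual[OF E E T dec finite_rank_step.hyps(2,3)]]
      by simp
  qed
  then show ?case by blast
qed

lemma nuclear_decomposition_summable_trace: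
  assumes E: "seminormed E" and dec: "nuclear_decomposition 1 E E T \<phi> \<psi>"
  shows "summable (\<lambda>k. \<phi> k (\<psi> k))"
proof (rule summable_comparison_test')
  show "summable (\<lambda>k. dual_norm E (\<phi> k) * nrm E (\<psi> k))"
    by (rule nuclear_decomposition_abs_summable[OF E E dec]) auto
  show "norm (\<phi> k (\<psi> k)) \<le> dual_norm E (\<phi> k) * nrm E (\<psi> k)" if "0 \<le> k" for k
    using dec by (intro seminormed.dual_norm_bound[OF E]) (auto simp: nuclear_decomposition_def)
qed

text \<open>Tannery's theorem: each term converges because \<open>\<phi> k\<close> is bounded, and
  contractivity gives a summable majorant, the product of the two norms, that does not depend on
  \<open>N\<close>.\<close>

lemma nuclear_decomposition_trace_approx:
  assumes E: "seminormed E" and dec: "nuclear_decomposition 1 E E T \<phi> \<psi>"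
    and P: "\<And>N. finite_rank E (P N)" and contr: "\<And>N x. x \<in> vecs E \<Longrightarrow> nrm E (P N x) \<le> nrm E x"
    and conv: "\<And>k. (\<lambda>N. nrm E (P N (\<psi> k) - \<psi> k)) \<longlonglongrightarrow> 0"
  shows "(\<lambda>N. \<Sum>k. \<phi> k (P N (\<psi> k))) \<longlonglongrightarrow> (\<Sum>k. \<phi> k (\<psi> k))"
proof -
  interpret seminormed E by (rule E)
  have \<phi>: "\<phi> k \<in> dual E" and \<psi>: "\<psi> k \<in> vecs E" for k
    using dec by (auto simp: nuclear_decomposition_def)
  note P\<psi> = finite_rank_mem[OF E P \<psi>]
  have lim: "(\<lambda>N. \<phi> k (P N (\<psi> k))) \<longlonglongrightarrow> \<phi> k (\<psi> k)" for k
  proof (rule LIM_zero_cancel, rule Lim_null_comparison)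
    show "\<forall>\<^sub>F N in sequentially. norm (\<phi> k (P N (\<psi> k)) - \<phi> k (\<psi> k))
        \<le> dual_norm E (\<phi> k) * nrm E (P N (\<psi> k) - \<psi> k)"
      by (intro always_eventually allI)
        (metis dual_norm_bound[OF \<phi>] dual_diff[OF \<phi>] P\<psi> \<psi> diff_mem)
    show "(\<lambda>N. dual_norm E (\<phi> k) * nrm E (P N (\<psi> k) - \<psi> k)) \<longlonglongrightarrow> 0"
      by (rule tendsto_mult_right_zero[OF conv])
  qed
  have bound: "norm (\<phi> k (P N (\<psi> k))) \<le> dual_norm E (\<phi> k) * nrm E (\<psi> k)" for k N
    using dual_norm_bound[OF \<phi> P\<psi>, of k N k]
      mult_left_mono[OF contr[OF \<psi>, of N k] dual_norm_nonneg[OF \<phi>, of k]]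
    by (rule order_trans)
  show ?thesis
    using tannerys_theorem[OF lim, where M = "\<lambda>k. dual_norm E (\<phi> k) * nrm E (\<psi> k)"]
      bound nuclear_decomposition_abs_summable[OF E E dec]
    by (simp add: always_eventually)
qed

text \<open>A single sequence \<open>P N\<close> serves both decompositions: it is accurate to
  1/(N+1) on the first N+1 vectors of each. With \<open>P N\<close> inserted the two traces
  coincide, and both pass to the limit.\<close>

lemma nuclear_trace_unique:
  assumes E: "seminormed E" and MAP: "metric_approximation E" and T: "linear_operator E E T"
    and dec: "nuclear_decomposition 1 E E T \<phi> \<psi>" and dec': "nuclear_decomposition 1 E E T \<phi>' \<psi>'"
  shows "(\<Sum>k. \<phi> k (\<psi> k)) = (\<Sum>k. \<phi>' k (\<psi>' k))"
proof -
  define S where "S N = \<psi> ` {..N} \<union> \<psi>' ` {..N}" for N :: nat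
  have "finite (S N)" "S N \<subseteq> vecs E" for N
    using dec dec' by (auto simp: S_def nuclear_decomposition_def)
  then have "\<exists>P. finite_rank E P \<and> (\<forall>x\<in>vecs E. nrm E (P x) \<le> nrm E x) \<and>
      (\<forall>x\<in>S N. nrm E (P x - x) < 1 / Suc N)" for N
    using MAP by (simp add: metric_approximation_def)
  then obtain P where P: "\<And>N. finite_rank E (P N)"
    and contr: "\<And>N x. x \<in> vecs E \<Longrightarrow> nrm E (P N x) \<le> nrm E x"
    and approx: "\<And>N x. x \<in> S N \<Longrightarrow> nrm E (P N x - x) < 1 / Suc N"
    by metis
  have conv: "(\<lambda>N. nrm E (P N x - x)) \<longlonglongrightarrow> 0" if "x \<in> vecs E" "x \<in> S k" for x k
  proof (rule Lim_null_comparison)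
    have "S k \<subseteq> S N" if "k \<le> N" for N
      using that by (auto simp: S_def)
    then show "\<forall>\<^sub>F N in sequentially. norm (nrm E (P N x - x)) \<le> 1 / Suc N"
      using approx that seminormed.nrm_nonneg[OF E seminormed.diff_mem[OF E finite_rank_mem[OF E P]]]
      by (intro eventually_sequentiallyI[of k]) (simp add: less_imp_le subset_iff)
    show "(\<lambda>N. 1 / real (Suc N)) \<longlonglongrightarrow> 0"
      by (rule LIMSEQ_inverse_real_of_nat[unfolded inverse_eq_divide])
  qed
  have "(\<lambda>N. \<Sum>k. \<phi> k (P N (\<psi> k))) \<longlonglongrightarrow> (\<Sum>k. \<phi> k (\<psi> k))"
    using dec by (intro nuclear_decomposition_trace_approx[OF E dec P contr] conv)
      (auto simp: nuclear_decomposition_def S_def)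
  moreover have "(\<lambda>N. \<Sum>k. \<phi>' k (P N (\<psi>' k))) \<longlonglongrightarrow> (\<Sum>k. \<phi>' k (\<psi>' k))"
    using dec' by (intro nuclear_decomposition_trace_approx[OF E dec' P contr] conv)
      (auto simp: nuclear_decomposition_def S_def)
  moreover have "(\<Sum>k. \<phi> k (P N (\<psi> k))) = (\<Sum>k. \<phi>' k (P N (\<psi>' k)))" for N
    using finite_rank_trace_indep[OF E T P] dec dec' by (metis sums_unique)
  ultimately show ?thesis
    by (simp add: LIMSEQ_unique)
qed

text \<open>Uniqueness gives the definite description its meaning. Since it ranges over
  decompositions of exponent 1, the given one is first weakened from \<open>s\<close> to 1.\<close>

theorem nuclear_trace_eq:
  assumes E: "seminormed E" and MAP: "metric_approximation E" and T: "linear_operator E E T"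
    and dec: "nuclear_decomposition s E E T \<phi> \<psi>" and s: "0 < s" "s \<le> 1"
  shows "(\<lambda>k. \<phi> k (\<psi> k)) sums nuclear_trace E T"
proof -
  have dec1: "nuclear_decomposition 1 E E T \<phi> \<psi>"
    by (rule nuclear_decomposition_mono[OF E E dec s])
  note sums = summable_sums[OF nuclear_decomposition_summable_trace[OF E dec1]]
  have "nuclear_trace E T = (\<Sum>k. \<phi> k (\<psi> k))"
    unfolding nuclear_trace_def
  proof (rule the_equality)
    fix t assume "\<exists>\<phi> \<psi>. nuclear_decomposition 1 E E T \<phi> \<psi> \<and> (\<lambda>k. \<phi> k (\<psi> k)) sums t"
    then show "t = (\<Sum>k. \<phi> k (\<psi> k))"
      using nuclear_trace_unique[OF E MAP T dec1] by (metis sums_unique)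
  qed (use dec1 sums in blast)
  with sums show ?thesis by simp
qed

text \<open>Both operators are bounded, so agreement on a dense set suffices.\<close>

lemma nuclear_decomposition_transfer:
  fixes E :: "'v::complex_vector normed_space" and F :: "'w::complex_vector normed_space"
  assumes E: "seminormed E" and F: "seminormed F"
    and s: "0 < s" "s \<le> 1"
    and T: "linear_operator E F T" and T': "linear_operator E F T'"
    and dec: "nuclear_decomposition s E F T \<phi> \<psi>" and dec': "nuclear_decomposition s E F T' \<phi>' \<psi>'"
    and eq: "\<And>x. x \<in> D \<Longrightarrow> T x = T' x" and D: "D \<subseteq> vecs E"
    and dense: "\<And>x \<epsilon>. x \<in> vecs E \<Longrightarrow> 0 < \<epsilon> \<Longrightarrow> \<exists>y\<in>D. nrm E (x - y) < \<epsilon>"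
  shows "nuclear_decomposition s E F T' \<phi> \<psi>"
proof -
  interpret E: seminormed E by (rule E)
  interpret F: seminormed F by (rule F)
  have bounded: "nrm F (R x) \<le> (\<Sum>k. dual_norm E (\<eta> k) * nrm F (\<omega> k)) * nrm E x"
    if R: "linear_operator E F R" and d: "nuclear_decomposition s E F R \<eta> \<omega>" and x: "x \<in> vecs E"
    for R \<eta> \<omega> x
  proof -
    have \<eta>: "\<eta> k \<in> dual E" and \<omega>: "\<omega> k \<in> vecs F" for k
      using d by (auto simp: nuclear_decomposition_def)
    note mem = F.scaleC_mem[OF \<omega>]
    note summ = nuclear_decomposition_abs_summable[OF E F d s]
    define S where "S m = (\<Sum>k<m. \<eta> k x *\<^sub>C \<omega> k)" for m
    have Smem: "S m \<in> vecs F" for m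
      unfolding S_def by (intro F.sum_mem mem)
    have Rx: "R x \<in> vecs F" using R x by (simp add: linear_operator_def)
    have "nrm F (S m) \<le> (\<Sum>k. dual_norm E (\<eta> k) * nrm F (\<omega> k)) * nrm E x" for m
    proof -
      have "nrm F (S m) \<le> (\<Sum>k<m. cmod (\<eta> k x) * nrm F (\<omega> k))"
        unfolding S_def using F.nrm_sum_le[of "{..<m}", OF mem] by (simp add: F.nrm_scaleC[OF \<omega>])
      also have "\<dots> \<le> (\<Sum>k<m. (dual_norm E (\<eta> k) * nrm E x) * nrm F (\<omega> k))"
        by (intro sum_mono mult_right_mono E.dual_norm_bound \<eta> x F.nrm_nonneg \<omega>)
      also have "\<dots> = (\<Sum>k<m. dual_norm E (\<eta> k) * nrm F (\<omega> k)) * nrm E x"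
        unfolding sum_distrib_right by (intro sum.cong) (simp_all add: mult_ac)
      also have "\<dots> \<le> (\<Sum>k. dual_norm E (\<eta> k) * nrm F (\<omega> k)) * nrm E x"
        by (intro mult_right_mono sum_le_suminf summ E.nrm_nonneg x)
          (auto intro!: mult_nonneg_nonneg E.dual_norm_nonneg \<eta> F.nrm_nonneg \<omega>)
      finally show ?thesis .
    qed
    moreover have "nrm F (R x) \<le> nrm F (R x - S m) + nrm F (S m)" for m
      using F.nrm_triangle[OF F.diff_mem[OF Rx Smem[of m]] Smem[of m]] by simp
    ultimately have "nrm F (R x) \<le> nrm F (R x - S m) + (\<Sum>k. dual_norm E (\<eta> k) * nrm F (\<omega> k)) * nrm E x" for m
      by (meson add_left_mono order_trans)
    moreover have "(\<lambda>m. nrm F (R x - S m)) \<longlonglongrightarrow> 0"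
      using d x by (simp add: nuclear_decomposition_def S_def)
    then have "(\<lambda>m. nrm F (R x - S m) + (\<Sum>k. dual_norm E (\<eta> k) * nrm F (\<omega> k)) * nrm E x)
        \<longlonglongrightarrow> 0 + (\<Sum>k. dual_norm E (\<eta> k) * nrm F (\<omega> k)) * nrm E x"
      by (intro tendsto_intros)
    ultimately show ?thesis
      by (intro LIMSEQ_le_const) auto
  qed
  define B where "B = (\<Sum>k. dual_norm E (\<phi> k) * nrm F (\<psi> k)) + (\<Sum>k. dual_norm E (\<phi>' k) * nrm F (\<psi>' k))"
  have B: "0 \<le> B"
    unfolding B_def using dec dec'
    by (intro add_nonneg_nonneg suminf_nonneg nuclear_decomposition_abs_summable[OF E F _ s])
      (auto simp: nuclear_decomposition_def intro!: mult_nonneg_nonneg E.dual_norm_nonneg F.nrm_nonneg)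
  \<comment> \<open>In a seminormed space the difference need not vanish, but its seminorm does, and
    that is enough to carry the limit of partial sums over from \<open>T x\<close> to
    \<open>T' x\<close>.\<close>
  have zero: "nrm F (T' x - T x) = 0" if x: "x \<in> vecs E" for x
  proof -
    have mem: "R z \<in> vecs F" if "linear_operator E F R" "z \<in> vecs E" for R z
      using that by (simp add: linear_operator_def)
    have sub: "R (x - y) = R x - R y" if "linear_operator E F R" "y \<in> vecs E" for R y
      using that x E.scaleC_mem[of y "-1"] unfolding linear_operator_def
      by (metis (no_types, lifting) scaleC_minus_left scaleC_one uminus_add_conv_diff add.commute)
    have small: "nrm F (T' x - T x) \<le> B * \<epsilon>" if \<epsilon>: "0 < \<epsilon>" for \<epsilon>
    proof -
      obtain y where y: "y \<in> D" "nrm E (x - y) < \<epsilon>"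
        using dense[OF x \<epsilon>] by blast
      with D have yE: "y \<in> vecs E" by blast
      note xy = E.diff_mem[OF x yE]
      have "T' x - T x = T' (x - y) - T (x - y)"
        using eq[OF y(1)] by (simp add: sub T T' yE)
      then have "nrm F (T' x - T x) \<le> nrm F (T' (x - y)) + nrm F (T (x - y))"
        using F.nrm_diff_triangle[OF mem[OF T' xy] mem[OF T xy]] by simp
      also have "\<dots> \<le> B * nrm E (x - y)"
        using bounded[OF T dec xy] bounded[OF T' dec' xy] by (simp add: B_def distrib_right)
      also have "\<dots> \<le> B * \<epsilon>"
        using y(2) B by (intro mult_left_mono) auto
      finally show ?thesis .
    qed
    have "nrm F (T' x - T x) \<le> 0"
    proof (rule field_le_epsilon)
      fix e :: real assume "0 < e"
      \<comment> \<open>Dividing by \<open>B + 1\<close> covers the case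
        \<open>B = 0\<close>.\<close>
      have "nrm F (T' x - T x) \<le> B * (e / (B + 1))"
        using \<open>0 < e\<close> B by (intro small) auto
      also have "\<dots> \<le> 0 + e"
        using \<open>0 < e\<close> B by (simp add: field_simps)
      finally show "nrm F (T' x - T x) \<le> 0 + e" .
    qed
    then show ?thesis
      using F.nrm_nonneg[OF F.diff_mem[OF mem[OF T' x] mem[OF T x]]] by simp
  qed
  have "(\<lambda>m. nrm F (T' x - (\<Sum>k<m. \<phi> k x *\<^sub>C \<psi> k))) \<longlonglongrightarrow> 0" if x: "x \<in> vecs E" for x
  proof (rule Lim_null_comparison)
    define S where "S m = (\<Sum>k<m. \<phi> k x *\<^sub>C \<psi> k)" for m
    have Smem: "S m \<in> vecs F" for m
      unfolding S_def using dec by (intro F.sum_mem F.scaleC_mem) (auto simp: nuclear_decomposition_def)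
    have Tx: "T x \<in> vecs F" "T' x \<in> vecs F"
      using T T' x by (auto simp: linear_operator_def)
    show "\<forall>\<^sub>F m in sequentially. norm (nrm F (T' x - (\<Sum>k<m. \<phi> k x *\<^sub>C \<psi> k)))
        \<le> nrm F (T x - (\<Sum>k<m. \<phi> k x *\<^sub>C \<psi> k))"
      using F.nrm_triangle_via[OF Tx(2,1) Smem] F.nrm_nonneg[OF F.diff_mem[OF Tx(2) Smem]]
      by (intro always_eventually allI) (simp add: S_def zero[OF x])
    show "(\<lambda>m. nrm F (T x - (\<Sum>k<m. \<phi> k x *\<^sub>C \<psi> k))) \<longlonglongrightarrow> 0"
      using dec x by (simp add: nuclear_decomposition_def)
  qed
  with dec show ?thesis by (simp add: nuclear_decomposition_def)
qed

section \<open>The Hilbert space as an instance\<close>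

lemma seminormed_H_space: "seminormed (H_space :: 'h::complex_hilbert normed_space)"
  by unfold_locales (simp_all add: H_space_def norm_triangle_ineq norm_scaleC)

text \<open>Orthogonal projections onto finitely many basis vectors are contractions of finite rank.
  Since \<open>S\<close> is finite, one finite index set is good enough for the expansions of all
  its members at once.\<close>

lemma metric_approximation_H_space:
  assumes B: "orthonormal_basis I (e :: 'i \<Rightarrow> 'h::complex_hilbert)"
  shows "metric_approximation (H_space :: 'h normed_space)"
  unfolding metric_approximation_def
proof (intro allI impI)
  fix S :: "'h set" and \<epsilon> :: real assume S: "finite S" and "0 < \<epsilon>"
  note on = orthonormal_basis_orthonormal[OF B]
  have "\<forall>\<^sub>F F in finite_subsets_at_top I. \<forall>x\<in>S. dist (\<Sum>\<alpha>\<in>F. cinner x (e \<alpha>) *\<^sub>C e \<alpha>) x < \<epsilon>"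
    using orthonormal_basis_expansion[OF B] \<open>0 < \<epsilon>\<close> unfolding has_sum_def
    by (intro eventually_ball_finite S ballI tendstoD)
  then obtain F where F: "finite F" "F \<subseteq> I"
    and G: "\<forall>G. finite G \<and> F \<subseteq> G \<and> G \<subseteq> I \<longrightarrow> (\<forall>x\<in>S. dist (\<Sum>\<alpha>\<in>G. cinner x (e \<alpha>) *\<^sub>C e \<alpha>) x < \<epsilon>)"
    unfolding eventually_finite_subsets_at_top by (elim exE conjE)
  have approx: "dist (\<Sum>\<alpha>\<in>F. cinner x (e \<alpha>) *\<^sub>C e \<alpha>) x < \<epsilon>" if "x \<in> S" for x
    using G F that by simp
  have "(\<lambda>x. cinner x v) \<in> dual (H_space :: 'h normed_space)" for v
    using cinner_Cauchy_Schwarz[of _ v]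
    by (auto simp: dual_def H_space_def cinner_add_left cinner_scaleC_left mult.commute intro!: exI[of _ "norm v"])
  then have "finite_rank H_space (\<lambda>x. \<Sum>\<alpha>\<in>F. cinner x (e \<alpha>) *\<^sub>C e \<alpha>)"
    by (intro finite_rank_sum finite_rank_one) (auto simp: H_space_def)
  then show "\<exists>P. finite_rank H_space P \<and> (\<forall>x\<in>vecs H_space. nrm H_space (P x) \<le> nrm H_space x) \<and>
      (\<forall>x\<in>S. nrm H_space (P x - x) < \<epsilon>)"
    using orthonormal_projection_norm_le[OF orthonormal_on_subset[OF on F(2)] F(1)] approx
    by (intro exI[of _ "\<lambda>x. \<Sum>\<alpha>\<in>F. cinner x (e \<alpha>) *\<^sub>C e \<alpha>"]) (auto simp: H_space_def dist_norm)
qed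

section \<open>Bochner spaces on the torus\<close>

text \<open>Bernoulli's inequality: the tangent at 1 to the convex function t^p. Both Jensen
  inequalities below arise by averaging it.\<close>

lemma powr_ge_tangent:
  fixes t p :: real
  assumes "0 \<le> t" "1 \<le> p"
  shows "1 + p * (t - 1) \<le> t powr p"
proof (cases "t = 0")
  case False
  then have "t powr p - 1 powr p \<ge> p * (t - 1)"
    using assms
    by (intro convex_on_imp_above_tangent[OF powr_convex[OF assms(2)]])
      (auto intro!: derivative_eq_intros simp: interior_open)
  then show ?thesis by simp
qed (use assms in auto)

text \<open>With \<open>m\<close> the weighted sum, the tangent inequality at each
  \<open>a i / m\<close> adds up to the lower bound 1 + (p - 1)(1 - \<open>sum w A\<close>), so
  missing mass only helps. Total weight below 1 is allowed because the weights used for singular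
  values are squared coefficients, whose sum Bessel's inequality bounds by 1.\<close>

lemma powr_sum_Jensen:
  fixes w a :: "'i \<Rightarrow> real"
  assumes w: "\<And>i. i \<in> A \<Longrightarrow> 0 \<le> w i" "sum w A \<le> 1" and a: "\<And>i. i \<in> A \<Longrightarrow> 0 \<le> a i"
    and p: "1 \<le> p" and fin: "finite A"
  shows "(\<Sum>i\<in>A. w i * a i) powr p \<le> (\<Sum>i\<in>A. w i * a i powr p)"
proof (cases "(\<Sum>i\<in>A. w i * a i) = 0")
  case True
  then show ?thesis using w by (auto intro!: sum_nonneg)
next
  case False
  define m where "m = (\<Sum>i\<in>A. w i * a i)"
  have m: "0 < m"
    using False w a by (auto simp: m_def less_le intro!: sum_nonneg)
  have "(\<Sum>i\<in>A. w i * (1 + p * (a i / m - 1))) = sum w A + p * ((\<Sum>i\<in>A. w i * a i) / m - sum w A)"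
    by (simp add: sum_divide_distrib sum_distrib_left sum_subtractf[symmetric] sum.distrib[symmetric] algebra_simps)
  also have "\<dots> = sum w A + p * (m / m - sum w A)"
    by (simp only: m_def)
  also have "\<dots> = 1 + (p - 1) * (1 - sum w A)"
    using m by (simp add: algebra_simps)
  also have "\<dots> \<ge> 1" using p w(2) by simp
  finally have "1 \<le> (\<Sum>i\<in>A. w i * (1 + p * (a i / m - 1)))" .
  also have "\<dots> \<le> (\<Sum>i\<in>A. w i * (a i / m) powr p)"
    using w a m p by (intro sum_mono mult_left_mono powr_ge_tangent) auto
  also have "\<dots> = (\<Sum>i\<in>A. w i * a i powr p) / m powr p"
    unfolding sum_divide_distrib using a m by (intro sum.cong) (auto simp: powr_divide)
  finally have "m powr p \<le> (\<Sum>i\<in>A. w i * a i powr p)"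
    using m by (simp add: field_simps)
  then show ?thesis by (simp only: m_def)
qed

lemma powr_convex_combination:
  fixes a b p l :: real
  assumes "0 \<le> a" "0 \<le> b" "0 \<le> l" "l \<le> 1" "1 \<le> p"
  shows "(l * a + (1 - l) * b) powr p \<le> l * a powr p + (1 - l) * b powr p"
  using powr_sum_Jensen[of "{True, False}" "\<lambda>c. if c then l else 1 - l" "\<lambda>c. if c then a else b" p] assms
  by (auto split: if_splits)

section \<open>The measure of the torus and seminorms of functions\<close>

lemma space_torus [simp]: "space (torus :: (real^'n::finite) measure) = cbox 0 1"
  by (simp add: torus_def)

lemma emeasure_torus_space: "emeasure (torus :: (real^'n::finite) measure) (cbox 0 1) = 1"
proof -
  have "emeasure (torus :: (real^'n) measure) (cbox 0 1) = emeasure lborel (cbox (0::real^'n) 1)"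
    by (simp add: torus_def emeasure_restrict_space)
  also have "\<dots> = 1"
  proof -
    have "(\<Prod>b\<in>Basis. (1 - 0 :: real^'n) \<bullet> b) = 1"
      by (rule prod.neutral) (auto simp: Basis_vec_def inner_axis)
    then show ?thesis
      by (subst emeasure_lborel_cbox) (auto simp: Basis_vec_def inner_axis)
  qed
  finally show ?thesis .
qed

interpretation torus: finite_measure "torus :: (real^'n::finite) measure"
  by (rule finite_measureI) (simp add: emeasure_torus_space)

lemma measure_torus_space [simp]: "measure (torus :: (real^'n::finite) measure) (cbox 0 1) = 1"
  by (simp add: measure_def emeasure_torus_space)

text \<open>\<open>Lp_norm\<close> before passing to classes, so that the analysis can be carried
  out on functions.\<close>

definition Lp_seminorm :: "real \<Rightarrow> (real^'n::finite \<Rightarrow> 'h::complex_hilbert) \<Rightarrow> real" where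
  "Lp_seminorm p f = (LINT x|torus. norm (f x) powr p) powr (1 / p)"

lemma Lp_fun_measurable [measurable_dest]: "f \<in> Lp_fun p \<Longrightarrow> f \<in> borel_measurable torus"
  and Lp_fun_integrable_powr: "f \<in> Lp_fun p \<Longrightarrow> integrable torus (\<lambda>x. norm (f x) powr p)"
  by (auto simp: Lp_fun_def)

lemma Lp_seminorm_nonneg [simp]: "0 \<le> Lp_seminorm p f"
  by (simp add: Lp_seminorm_def)

lemma Lp_seminorm_powr: "0 < p \<Longrightarrow> Lp_seminorm p f powr p = (LINT x|torus. norm (f x) powr p)"
  by (simp add: Lp_seminorm_def powr_powr)

lemma Lp_seminorm_le_iff:
  assumes "0 < p" "0 \<le> a"
  shows "Lp_seminorm p f \<le> a \<longleftrightarrow> (LINT x|torus. norm (f x) powr p) \<le> a powr p"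
  using assms Lp_seminorm_powr[OF assms(1), of f]
  by (metis Lp_seminorm_nonneg powr_mono2 powr_less_mono2 less_imp_le not_le)

lemma Lp_fun_bounded:
  assumes [measurable]: "f \<in> borel_measurable torus" and "0 < p"
    and bound: "AE x in torus. norm (f x) powr p \<le> g x" and g: "integrable torus g"
  shows "f \<in> Lp_fun p"
  unfolding Lp_fun_def using bound
  by (auto intro!: Bochner_Integration.integrable_bound[OF g])

lemma Lp_fun_scaleC:
  assumes f: "f \<in> Lp_fun p" and "0 < p"
  shows "(\<lambda>x. c *\<^sub>C f x) \<in> Lp_fun p"
    and "Lp_seminorm p (\<lambda>x. c *\<^sub>C f x) = cmod c * Lp_seminorm p f"
proof -
  have eq: "norm (c *\<^sub>C f x) powr p = cmod c powr p * norm (f x) powr p" for x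
    by (simp add: norm_scaleC powr_mult)
  show "(\<lambda>x. c *\<^sub>C f x) \<in> Lp_fun p"
    using f by (auto simp: Lp_fun_def eq intro: borel_measurable_scaleC)
  show "Lp_seminorm p (\<lambda>x. c *\<^sub>C f x) = cmod c * Lp_seminorm p f"
    using \<open>0 < p\<close> by (simp add: Lp_seminorm_def eq powr_mult powr_powr)
qed

text \<open>Minkowski's inequality by convexity: |y| + |z| is (a + b) times a convex combination of
  |y|/a and |z|/b. When \<open>a\<close> and \<open>b\<close> dominate the seminorms of two
  functions, integration leaves at most (a + b)^p.\<close>

lemma norm_add_powr_le:
  fixes y z :: "'b::real_normed_vector"
  assumes a: "0 < a" and b: "0 < b" and p: "1 \<le> p"
  shows "norm (y + z) powr p
    \<le> (a + b) powr p * (a / (a + b) * (norm y powr p / a powr p) + b / (a + b) * (norm z powr p / b powr p))"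
proof -
  have "norm (y + z) \<le> norm y + norm z"
    by (rule norm_triangle_ineq)
  also have "\<dots> = (a + b) * (a / (a + b) * (norm y / a) + (1 - a / (a + b)) * (norm z / b))"
  proof -
    have "1 - a / (a + b) = b / (a + b)"
      using a b by (simp add: field_simps)
    with a b show ?thesis by (simp add: add_divide_distrib[symmetric])
  qed
  finally have "norm (y + z) powr p
      \<le> ((a + b) * (a / (a + b) * (norm y / a) + (1 - a / (a + b)) * (norm z / b))) powr p"
    using p by (intro powr_mono2) auto
  also have "\<dots> = (a + b) powr p * (a / (a + b) * (norm y / a) + (1 - a / (a + b)) * (norm z / b)) powr p"
    by (rule powr_mult)
  also have "\<dots> \<le> (a + b) powr p * (a / (a + b) * (norm y / a) powr p + (1 - a / (a + b)) * (norm z / b) powr p)"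
    using a b p by (intro mult_left_mono powr_convex_combination) (auto simp: field_simps)
  also have "1 - a / (a + b) = b / (a + b)"
    using a b by (simp add: field_simps)
  finally show ?thesis
    using a b by (simp add: powr_divide)
qed

lemma Lp_fun_add:
  assumes f: "f \<in> Lp_fun p" and g: "g \<in> Lp_fun p" and p: "1 \<le> p"
  shows "(\<lambda>x. f x + g x) \<in> Lp_fun p"
    and Minkowski: "Lp_seminorm p (\<lambda>x. f x + g x) \<le> Lp_seminorm p f + Lp_seminorm p g"
proof -
  note [measurable] = f[THEN Lp_fun_measurable] g[THEN Lp_fun_measurable]
  define G where "G a b x = (a + b) powr p * (a / (a + b) * (norm (f x) powr p / a powr p) + b / (a + b) * (norm (g x) powr p / b powr p))"
    for a b x
  have G: "integrable torus (G a b)" for a b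
    unfolding G_def by (intro Bochner_Integration.integrable_add integrable_mult_right integrable_divide
        Lp_fun_integrable_powr f g)
  have le: "norm (f x + g x) powr p \<le> G a b x" if "0 < a" "0 < b" for a b x
    unfolding G_def by (rule norm_add_powr_le[OF that p])
  show mem: "(\<lambda>x. f x + g x) \<in> Lp_fun p"
    by (rule Lp_fun_bounded[OF _ _ _ G[of 1 1]]) (use le[of 1 1] p in auto)
  show "Lp_seminorm p (\<lambda>x. f x + g x) \<le> Lp_seminorm p f + Lp_seminorm p g"
  proof (rule field_le_epsilon)
    fix e :: real assume e: "0 < e"
    \<comment> \<open>The summand \<open>e / 2\<close> keeps \<open>a\<close> and \<open>b\<close>
      positive when a seminorm vanishes.\<close>
    define a b where "a = Lp_seminorm p f + e / 2" and "b = Lp_seminorm p g + e / 2"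
    have a: "0 < a" and b: "0 < b"
      using e Lp_seminorm_nonneg[of p f] Lp_seminorm_nonneg[of p g] by (simp_all add: a_def b_def add_nonneg_pos)
    have fa: "(LINT x|torus. norm (f x) powr p) \<le> a powr p" and gb: "(LINT x|torus. norm (g x) powr p) \<le> b powr p"
      using Lp_seminorm_le_iff[of p a f] Lp_seminorm_le_iff[of p b g] a b p e by (auto simp: a_def b_def)
    have "(LINT x|torus. norm (f x + g x) powr p) \<le> integral\<^sup>L torus (G a b)"
      using mem le[OF a b] by (intro integral_mono G Lp_fun_integrable_powr)
    also have "\<dots> = (a + b) powr p * (a / (a + b) * ((LINT x|torus. norm (f x) powr p) / a powr p)
        + b / (a + b) * ((LINT x|torus. norm (g x) powr p) / b powr p))"
      unfolding G_def using Lp_fun_integrable_powr[OF f] Lp_fun_integrable_powr[OF g] by simp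
    also have "\<dots> \<le> (a + b) powr p * (a / (a + b) * 1 + b / (a + b) * 1)"
      using fa gb a b by (intro mult_left_mono add_mono) (auto simp: divide_le_eq_1)
    also have "\<dots> = (a + b) powr p"
      using a b by (simp add: add_divide_distrib[symmetric])
    finally have "Lp_seminorm p (\<lambda>x. f x + g x) \<le> a + b"
      using a b p by (subst Lp_seminorm_le_iff) auto
    then show "Lp_seminorm p (\<lambda>x. f x + g x) \<le> Lp_seminorm p f + Lp_seminorm p g + e"
      by (simp add: a_def b_def)
  qed
qed

lemma Lp_fun_minus: "f \<in> Lp_fun p \<Longrightarrow> (\<lambda>x. - f x) \<in> Lp_fun p"
  by (auto simp: Lp_fun_def)

lemma Lp_fun_diff: "f \<in> Lp_fun p \<Longrightarrow> g \<in> Lp_fun p \<Longrightarrow> 1 \<le> p \<Longrightarrow> (\<lambda>x. f x - g x) \<in> Lp_fun p"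
  using Lp_fun_add(1)[of f p "\<lambda>x. - g x"] by (simp add: Lp_fun_minus)

lemma Lp_fun_zero: "(\<lambda>_. 0) \<in> Lp_fun p"
  by (simp add: Lp_fun_def)

lemma Lp_fun_sum:
  "(\<And>i. i \<in> A \<Longrightarrow> f i \<in> Lp_fun p) \<Longrightarrow> 1 \<le> p \<Longrightarrow> (\<lambda>x. \<Sum>i\<in>A. f i x) \<in> Lp_fun p"
  by (induction A rule: infinite_finite_induct) (auto intro: Lp_fun_add Lp_fun_zero)

lemma Lp_seminorm_sum_le:
  "(\<And>i. i \<in> A \<Longrightarrow> f i \<in> Lp_fun p) \<Longrightarrow> 1 \<le> p \<Longrightarrow>
    Lp_seminorm p (\<lambda>x. \<Sum>i\<in>A. f i x) \<le> (\<Sum>i\<in>A. Lp_seminorm p (f i))"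
proof (induction A rule: infinite_finite_induct)
  case (insert i A)
  then have "Lp_seminorm p (\<lambda>x. f i x + (\<Sum>i\<in>A. f i x)) \<le> Lp_seminorm p (f i) + Lp_seminorm p (\<lambda>x. \<Sum>i\<in>A. f i x)"
    by (intro Minkowski Lp_fun_sum) auto
  with insert show ?case by auto
qed (auto simp: Lp_seminorm_def)

lemma bounded_Lp_fun:
  assumes [measurable]: "f \<in> borel_measurable torus" and b: "\<And>x. x \<in> cbox 0 1 \<Longrightarrow> norm (f x) \<le> C" and p: "1 \<le> p"
  shows "f \<in> Lp_fun p"
proof (rule Lp_fun_bounded)
  show "AE x in torus. norm (f x) powr p \<le> C powr p"
    using b p by (intro AE_I2 powr_mono2) auto
qed (use p in auto)

lemma Lp_fun_integrable:
  assumes f: "f \<in> Lp_fun p" and p: "1 \<le> p"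
  shows "integrable torus f"
proof (rule Bochner_Integration.integrable_bound)
  show "integrable torus (\<lambda>x. 1 + norm (f x) powr p)"
    using f by (auto simp: Lp_fun_def)
  have "t \<le> 1 + t powr p" if "0 \<le> t" for t :: real
  proof (cases "t \<le> 1")
    case False
    then have "t powr 1 \<le> t powr p" using p by (intro powr_mono) auto
    with that show ?thesis by simp
  qed (simp add: add_increasing2)
  then show "AE x in torus. norm (f x) \<le> norm (1 + norm (f x) powr p)"
    by simp
qed (use f in measurable)

text \<open>The tangent to t^p at the mean \<open>a\<close> of |f| over \<open>Q\<close> is
  integrated over \<open>Q\<close>; by the choice of \<open>a\<close> the integral of the tangent is
  exactly the left-hand side. The factor \<open>measure torus Q\<close> makes that side 0 on null
  sets, where the mean is a division by zero.\<close>

lemma Jensen_on_set: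
  assumes f: "f \<in> Lp_fun p" and p: "1 \<le> p" and Q [measurable]: "Q \<in> sets torus"
  shows "measure torus Q * ((LINT x|torus. indicator Q x * norm (f x)) / measure torus Q) powr p
    \<le> (LINT x|torus. indicator Q x * norm (f x) powr p)"
proof -
  define \<mu> where "\<mu> = measure torus Q"
  define X where "X = (LINT x|torus. indicator Q x * norm (f x))"
  define a where "a = X / \<mu>"
  have intf: "integrable torus (\<lambda>x. indicator Q x * norm (f x))"
    using integrable_real_mult_indicator[OF Q integrable_norm[OF Lp_fun_integrable[OF f p]]] by (simp add: mult.commute)
  have intp: "integrable torus (\<lambda>x. indicator Q x * norm (f x) powr p)"
    using integrable_real_mult_indicator[OF Q Lp_fun_integrable_powr[OF f]] by (simp add: mult.commute)
  have intQ: "integrable torus (indicator Q :: _ \<Rightarrow> real)"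
    by (intro integrable_real_indicator Q) (simp add: torus.emeasure_eq_measure)
  show ?thesis
  proof (cases "a = 0 \<or> \<mu> = 0")
    case True
    have "0 \<le> (LINT x|torus. indicator Q x * norm (f x) powr p)"
      by (intro integral_nonneg_AE) auto
    with True show ?thesis by (auto simp: a_def \<mu>_def X_def)
  next
    case False
    have "0 \<le> X"
      unfolding X_def by (intro integral_nonneg_AE) auto
    with False have a: "0 < a" and \<mu>: "0 < \<mu>"
      by (auto simp: a_def \<mu>_def zero_less_measure_iff less_le)
    have "X = a * \<mu>"
      using \<mu> by (simp add: a_def)
    then have "\<mu> * a powr p = a powr p * ((1 - p) * \<mu> + p / a * X)"
      using a by (simp add: field_simps)
    also have "\<dots> = (LINT x|torus. a powr p * ((1 - p) * indicator Q x + p / a * (indicator Q x * norm (f x))))"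
      using intf intQ by (simp add: \<mu>_def X_def Q Int_absorb2[OF sets.sets_into_space[OF Q, unfolded space_torus]])

    also have "\<dots> \<le> (LINT x|torus. indicator Q x * norm (f x) powr p)"
    proof (intro integral_mono integrable_mult_right Bochner_Integration.integrable_add intf intQ intp)
      fix x
      have "a powr p * (1 + p * (norm (f x) / a - 1)) \<le> a powr p * (norm (f x) / a) powr p"
        using a p by (intro mult_left_mono powr_ge_tangent) auto
      also have "\<dots> = norm (f x) powr p"
        using a by (simp add: powr_divide)
      finally show "a powr p * ((1 - p) * indicator Q x + p / a * (indicator Q x * norm (f x)))
          \<le> indicator Q x * norm (f x) powr p"
        by (cases "x \<in> Q") (simp_all add: algebra_simps)
    qed
    finally show ?thesis by (simp add: a_def \<mu>_def X_def)
  qed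
qed

text \<open>Jensen on the whole cube, which has measure 1, so the constant is 1.\<close>

lemma integral_norm_le_Lp_seminorm:
  assumes f: "f \<in> Lp_fun p" and p: "1 \<le> p"
  shows "(LINT x|torus. norm (f x)) \<le> Lp_seminorm p f"
proof -
  have Q: "cbox 0 1 \<in> sets torus"
    using sets.top[of torus] by simp
  have eq: "(LINT x|torus. indicator (cbox 0 1) x * g x) = (LINT x|torus. g x)" for g :: "_ \<Rightarrow> real"
    by (intro Bochner_Integration.integral_cong) auto
  have "(LINT x|torus. norm (f x)) powr p \<le> (LINT x|torus. norm (f x) powr p)"
    using Jensen_on_set[OF f p Q] by (simp add: eq)
  also have "\<dots> = Lp_seminorm p f powr p"
    using p by (simp add: Lp_seminorm_powr)
  finally show ?thesis
    using p by (metis Lp_seminorm_nonneg integral_nonneg norm_ge_zero not_le powr_less_mono2 less_le_trans zero_less_one)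
qed

text \<open>Fatou's lemma makes balls of L^p closed under almost everywhere limits; this is how
  membership and norm bounds are obtained for sums of series.\<close>

lemma Lp_fun_Fatou:
  assumes h: "\<And>N. h N \<in> Lp_fun p" and lim: "AE x in torus. (\<lambda>N. h N x) \<longlonglongrightarrow> g x"
    and g [measurable]: "g \<in> borel_measurable torus"
    and bound: "\<And>N. Lp_seminorm p (h N) \<le> c" and p: "1 \<le> p"
  shows "g \<in> Lp_fun p" and "Lp_seminorm p g \<le> c"
proof -
  note [measurable] = h[THEN Lp_fun_measurable]
  have c: "0 \<le> c" using bound[of 0] Lp_seminorm_nonneg order_trans by blast
  have "(\<integral>\<^sup>+x. ennreal (norm (g x) powr p) \<partial>torus) = (\<integral>\<^sup>+x. liminf (\<lambda>N. ennreal (norm (h N x) powr p)) \<partial>torus)"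
  proof (rule nn_integral_cong_AE, use lim in eventually_elim)
    fix x assume "(\<lambda>N. h N x) \<longlonglongrightarrow> g x"
    then have "(\<lambda>N. ennreal (norm (h N x) powr p)) \<longlonglongrightarrow> ennreal (norm (g x) powr p)"
      using p by (intro tendsto_ennrealI tendsto_powr2 tendsto_norm tendsto_const) auto
    then show "ennreal (norm (g x) powr p) = liminf (\<lambda>N. ennreal (norm (h N x) powr p))"
      by (metis lim_imp_Liminf trivial_limit_sequentially)
  qed
  also have "\<dots> \<le> liminf (\<lambda>N. \<integral>\<^sup>+x. ennreal (norm (h N x) powr p) \<partial>torus)"
    by (rule nn_integral_liminf) simp
  also have "\<dots> \<le> liminf (\<lambda>N::nat. ennreal (c powr p))"
  proof (intro Liminf_mono always_eventually allI)
    fix N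
    have "(\<integral>\<^sup>+x. ennreal (norm (h N x) powr p) \<partial>torus) = ennreal (LINT x|torus. norm (h N x) powr p)"
      by (intro nn_integral_eq_integral Lp_fun_integrable_powr h) auto
    also have "\<dots> \<le> ennreal (c powr p)"
      using bound[of N] c p by (intro ennreal_leI) (simp add: Lp_seminorm_le_iff)
    finally show "(\<integral>\<^sup>+x. ennreal (norm (h N x) powr p) \<partial>torus) \<le> ennreal (c powr p)" .
  qed
  also have "\<dots> = ennreal (c powr p)"
    by (simp add: Liminf_const)
  finally have le: "(\<integral>\<^sup>+x. ennreal (norm (g x) powr p) \<partial>torus) \<le> ennreal (c powr p)" .
  then have int: "integrable torus (\<lambda>x. norm (g x) powr p)"
    by (intro integrableI_bounded) (auto simp: le_less_trans)
  then show "g \<in> Lp_fun p" by (simp add: Lp_fun_def)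
  have "ennreal (LINT x|torus. norm (g x) powr p) \<le> ennreal (c powr p)"
    using le nn_integral_eq_integral[OF int] by simp
  then have "(LINT x|torus. norm (g x) powr p) \<le> c powr p"
    by (simp add: ennreal_le_iff)
  with c p show "Lp_seminorm p g \<le> c" by (simp add: Lp_seminorm_le_iff)
qed

text \<open>The L^1 norm is at most the L^p norm, so by monotone convergence the sum of the norms
  has finite integral and is finite almost everywhere.\<close>

lemma Lp_series_AE_summable:
  assumes g: "\<And>k. g k \<in> Lp_fun p" and summ: "summable (\<lambda>k. Lp_seminorm p (g k))" and p: "1 \<le> p"
  shows "AE x in torus. summable (\<lambda>k. norm (g k x))"
proof -
  note [measurable] = g[THEN Lp_fun_measurable]
  have "(\<integral>\<^sup>+x. (\<Sum>k. ennreal (norm (g k x))) \<partial>torus) = (\<Sum>k. \<integral>\<^sup>+x. ennreal (norm (g k x)) \<partial>torus)"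
    by (rule nn_integral_suminf) simp
  also have "\<dots> = (\<Sum>k. ennreal (LINT x|torus. norm (g k x)))"
    by (intro suminf_cong nn_integral_eq_integral integrable_norm Lp_fun_integrable[OF g p]) auto
  also have "\<dots> \<le> (\<Sum>k. ennreal (Lp_seminorm p (g k)))"
    by (intro suminf_le ennreal_leI integral_norm_le_Lp_seminorm g p) auto
  also have "\<dots> = ennreal (\<Sum>k. Lp_seminorm p (g k))"
    by (rule suminf_ennreal2[OF _ summ]) simp
  finally have "(\<integral>\<^sup>+x. (\<Sum>k. ennreal (norm (g k x))) \<partial>torus) \<noteq> \<infinity>"
    by (auto simp: top_unique)
  then have "AE x in torus. (\<Sum>k. ennreal (norm (g k x))) \<noteq> \<infinity>"
    by (intro nn_integral_PInf_AE) auto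
  then show ?thesis
    by eventually_elim (auto intro: summable_suminf_not_top)
qed

text \<open>The tail is the almost everywhere limit of its partial sums, whose seminorms are bounded
  by the tail of the numerical series. For \<open>m = 0\<close> this puts the sum of the series in
  L^p.\<close>

lemma Lp_series_tail:
  assumes g: "\<And>k. g k \<in> Lp_fun p" and summ: "summable (\<lambda>k. Lp_seminorm p (g k))" and p: "1 \<le> p"
  shows "(\<lambda>x. (\<Sum>k. g k x) - (\<Sum>k<m. g k x)) \<in> Lp_fun p" (is "?G \<in> _")
    and "Lp_seminorm p (\<lambda>x. (\<Sum>k. g k x) - (\<Sum>k<m. g k x)) \<le> (\<Sum>k. Lp_seminorm p (g (k + m)))"
proof -
  note [measurable] = g[THEN Lp_fun_measurable]
  define h where "h N = (\<lambda>x. \<Sum>k<N. g (k + m) x)" for N :: nat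
  have h: "h N \<in> Lp_fun p" for N
    unfolding h_def by (intro Lp_fun_sum g p)
  have lim: "AE x in torus. (\<lambda>N. h N x) \<longlonglongrightarrow> ?G x"
    using Lp_series_AE_summable[OF g summ p]
  proof eventually_elim
    case (elim x)
    have "summable (\<lambda>k. g k x)" by (rule summable_norm_cancel[OF elim])
    from sums_split_initial_segment[OF summable_sums[OF this], of m] show ?case
      by (simp add: sums_def h_def)
  qed
  have summ': "summable (\<lambda>k. Lp_seminorm p (g (k + m)))"
    by (rule summable_ignore_initial_segment[OF summ])
  have bound: "Lp_seminorm p (h N) \<le> (\<Sum>k. Lp_seminorm p (g (k + m)))" for N
  proof -
    have "Lp_seminorm p (h N) \<le> (\<Sum>k<N. Lp_seminorm p (g (k + m)))"
      unfolding h_def by (intro Lp_seminorm_sum_le g p)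
    also have "\<dots> \<le> (\<Sum>k. Lp_seminorm p (g (k + m)))"
      by (intro sum_le_suminf summ') auto
    finally show ?thesis .
  qed
  show "?G \<in> Lp_fun p" "Lp_seminorm p ?G \<le> (\<Sum>k. Lp_seminorm p (g (k + m)))"
    by (rule Lp_fun_Fatou[OF h lim _ bound p]; simp)+
qed

lemma Lp_simple_function_dense:
  assumes f: "f \<in> Lp_fun p" and p: "1 \<le> p" and \<epsilon>: "0 < \<epsilon>"
  obtains g where "simple_function torus g" "g \<in> Lp_fun p" "Lp_seminorm p (\<lambda>x. f x - g x) < \<epsilon>"
proof -
  note [measurable] = Lp_fun_measurable[OF f]
  obtain F where F': "\<forall>i. simple_function torus (F i)" "\<forall>x\<in>space torus. (\<lambda>i. F i x) \<longlonglongrightarrow> f x"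
    "\<forall>i. \<forall>x\<in>space torus. dist (F i x) 0 \<le> 2 * dist (f x) 0"
    using borel_measurable_implies_sequence_metric[OF Lp_fun_measurable[OF f], of 0] by (elim exE conjE)
  have F: "simple_function torus (F i)"
    and lim: "x \<in> cbox 0 1 \<Longrightarrow> (\<lambda>i. F i x) \<longlonglongrightarrow> f x"
    and bound: "x \<in> cbox 0 1 \<Longrightarrow> norm (F i x) \<le> 2 * norm (f x)" for i x
    using F' by (simp_all del: mem_box_cart)
  have [measurable]: "F i \<in> borel_measurable torus" for i
    by (rule borel_measurable_simple_function[OF F])
  have FLp: "F i \<in> Lp_fun p" for i
  proof (rule Lp_fun_bounded)
    show "AE x in torus. norm (F i x) powr p \<le> 2 powr p * norm (f x) powr p"
      using bound p by (intro AE_I2) (auto simp: powr_mult[symmetric] intro!: powr_mono2)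
  qed (use p f in \<open>auto simp: Lp_fun_def\<close>)
  \<comment> \<open>Dominated convergence; the factor 3 is 1 for \<open>f\<close> plus 2 from the
    bound of \<open>F i\<close> by twice the norm of \<open>f\<close>.\<close>
  have "(\<lambda>i. LINT x|torus. norm (f x - F i x) powr p) \<longlonglongrightarrow> (LINT x|(torus :: (real^'a) measure). 0)"
  proof (rule integral_dominated_convergence)
    show "integrable torus (\<lambda>x. 3 powr p * norm (f x) powr p)"
      using f by (simp add: Lp_fun_def)
    show "AE x in torus. (\<lambda>i. norm (f x - F i x) powr p) \<longlonglongrightarrow> 0"
    proof (rule AE_I2)
      fix x :: "real^'a" assume x: "x \<in> space torus"
      have "(\<lambda>i. norm (f x - F i x)) \<longlonglongrightarrow> norm (f x - f x)"
        using x by (intro tendsto_norm tendsto_diff tendsto_const lim) simp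
      then have "(\<lambda>i. norm (f x - F i x) powr p) \<longlonglongrightarrow> norm (f x - f x) powr p"
        using p by (intro tendsto_powr2 tendsto_const) auto
      then show "(\<lambda>i. norm (f x - F i x) powr p) \<longlonglongrightarrow> 0" by simp
    qed
    show "AE x in torus. norm (norm (f x - F i x) powr p) \<le> 3 powr p * norm (f x) powr p" for i
    proof (rule AE_I2)
      fix x :: "real^'a" assume x: "x \<in> space torus"
      have "norm (f x - F i x) \<le> 3 * norm (f x)"
        using norm_triangle_ineq4[of "f x" "F i x"] bound[of x i] x by simp
      then show "norm (norm (f x - F i x) powr p) \<le> 3 powr p * norm (f x) powr p"
        using p by (auto simp: powr_mult[symmetric] intro!: powr_mono2)
    qed
  qed auto
  then have "\<forall>\<^sub>F i in sequentially. (LINT x|torus. norm (f x - F i x) powr p) < (\<epsilon> / 2) powr p"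
    using \<epsilon> by (intro order_tendstoD(2)[where y = 0]) auto
  then obtain i where "(LINT x|torus. norm (f x - F i x) powr p) < (\<epsilon> / 2) powr p"
    using eventually_happens'[OF sequentially_bot] by blast
  then have "Lp_seminorm p (\<lambda>x. f x - F i x) \<le> \<epsilon> / 2"
    using \<epsilon> p by (subst Lp_seminorm_le_iff) auto
  with \<epsilon> show thesis by (intro that[OF F FLp, of i]) auto
qed

section \<open>The metric approximation property\<close>

lemma bounded_bilinear_scaleC: "bounded_bilinear ((*\<^sub>C) :: complex \<Rightarrow> 'h \<Rightarrow> 'h::complex_hilbert)"
proof
  show "\<exists>K. \<forall>a b. norm (a *\<^sub>C b :: 'h) \<le> norm a * norm b * K"
    by (intro exI[of _ 1]) (simp add: norm_scaleC)
qed (simp_all add: scaleC_add_left scaleC_add_right scaleR_scaleC scaleC_scaleC scaleR_conv_of_real mult.commute)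

lemma borel_measurable_scaleC_Pair [measurable (raw)]:
  fixes g :: "'a \<Rightarrow> 'h::complex_hilbert"
  assumes "w \<in> borel_measurable M" "g \<in> borel_measurable M"
  shows "(\<lambda>x. w x *\<^sub>C g x) \<in> borel_measurable M"
  by (rule borel_measurable_continuous_Pair[OF assms])
    (intro bounded_bilinear.continuous_on[OF bounded_bilinear_scaleC] continuous_intros)

section \<open>From functions to almost-everywhere classes\<close>

lemma ae_rel_refl: "f \<in> borel_measurable torus \<Longrightarrow> ae_rel f f"
  by (simp add: ae_rel_def)

lemma ae_class_eqI:
  "AE x in torus. f x = g x \<Longrightarrow> f \<in> borel_measurable torus \<Longrightarrow> g \<in> borel_measurable torus \<Longrightarrow>
    ae_class f = ae_class g"
  by (rule Quotient_rel_abs[OF Quotient_torus_L0]) (simp add: ae_rel_def)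

lemma ae_class_rep [simp]: "ae_class (rep_L0 F) = F"
  by (rule Quotient_abs_rep[OF Quotient_torus_L0])

lemma rep_L0_measurable [measurable, simp]: "rep_L0 F \<in> borel_measurable torus"
  using Quotient_rep_reflp[OF Quotient_torus_L0, of F] by (simp add: ae_rel_def)

lemma rep_L0_ae_class:
  "f \<in> borel_measurable torus \<Longrightarrow> AE x in torus. rep_L0 (ae_class f) x = f x"
  using Quotient_rep_abs[OF Quotient_torus_L0, of f] by (simp add: ae_rel_def)

lemma ae_class_add: "f \<in> borel_measurable torus \<Longrightarrow> g \<in> borel_measurable torus \<Longrightarrow>
    ae_class f + ae_class g = ae_class (\<lambda>x. f x + g x)"
  and ae_class_diff: "f \<in> borel_measurable torus \<Longrightarrow> g \<in> borel_measurable torus \<Longrightarrow>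
    ae_class f - ae_class g = ae_class (\<lambda>x. f x - g x)"
  and ae_class_scaleC: "f \<in> borel_measurable torus \<Longrightarrow> c *\<^sub>C ae_class f = ae_class (\<lambda>x. c *\<^sub>C f x)"
  and Lp_norm_ae_class: "f \<in> borel_measurable torus \<Longrightarrow> Lp_norm p (ae_class f) = Lp_seminorm p f"
  and in_Lp_ae_class: "f \<in> borel_measurable torus \<Longrightarrow> in_Lp p (ae_class f) \<longleftrightarrow> f \<in> Lp_fun p"
  by (simp_all add: plus_torus_L0.abs_eq minus_torus_L0.abs_eq scaleC_torus_L0.abs_eq
      Lp_norm.abs_eq in_Lp.abs_eq ae_rel_refl Lp_seminorm_def)

lemma ae_class_zero: "ae_class (\<lambda>_. 0) = 0"
  by (simp add: zero_torus_L0_def)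

lemma ae_class_sum:
  "(\<And>i. i \<in> A \<Longrightarrow> f i \<in> borel_measurable torus) \<Longrightarrow>
    (\<Sum>i\<in>A. ae_class (f i)) = ae_class (\<lambda>x. \<Sum>i\<in>A. f i x)"
proof (induction A rule: infinite_finite_induct)
  case (insert i A)
  then show ?case
    by (simp add: ae_class_add borel_measurable_sum)
qed (simp_all add: ae_class_zero)

lemma vecs_Lp_space: "F \<in> vecs (Lp_space p) \<longleftrightarrow> rep_L0 F \<in> Lp_fun p"
  using in_Lp_ae_class[of "rep_L0 F" p] by (simp add: Lp_space_def)

lemma nrm_Lp_space: "nrm (Lp_space p) F = Lp_seminorm p (rep_L0 F)"
  using Lp_norm_ae_class[of "rep_L0 F" p] by (simp add: Lp_space_def)

lemma ae_class_mem_Lp_space: "f \<in> Lp_fun p \<Longrightarrow> ae_class f \<in> vecs (Lp_space p)"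
  using Lp_fun_measurable[of f p] by (simp add: Lp_space_def in_Lp_ae_class)

lemma nrm_ae_class: "f \<in> borel_measurable torus \<Longrightarrow> nrm (Lp_space p) (ae_class f) = Lp_seminorm p f"
  by (simp add: Lp_space_def Lp_norm_ae_class)

lemma Lp_space_cases:
  assumes "F \<in> vecs (Lp_space p)"
  obtains f where "f \<in> Lp_fun p" "F = ae_class f"
  using assms vecs_Lp_space[of F p] by (intro that[of "rep_L0 F"]) auto

lemma seminormed_Lp_space:
  assumes p: "1 \<le> p"
  shows "seminormed (Lp_space p :: ('n::finite, 'h::complex_hilbert) torus_L0 normed_space)"
proof
  let ?E = "Lp_space p :: ('n, 'h) torus_L0 normed_space"
  show "0 \<in> vecs ?E"
    unfolding ae_class_zero[symmetric] by (intro ae_class_mem_Lp_space Lp_fun_zero)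
  fix F G :: "('n, 'h) torus_L0" and c
  assume "F \<in> vecs ?E"
  then obtain f where f: "f \<in> Lp_fun p" "F = ae_class f"
    by (rule Lp_space_cases)
  note [simp] = Lp_fun_measurable[OF f(1)]
  show "c *\<^sub>C F \<in> vecs ?E" "nrm ?E (c *\<^sub>C F) = cmod c * nrm ?E F"
    using Lp_fun_scaleC[OF f(1), of c] p
    by (auto simp: f(2) ae_class_scaleC nrm_ae_class borel_measurable_scaleC intro: ae_class_mem_Lp_space)
  show "0 \<le> nrm ?E F"
    by (simp add: nrm_Lp_space)
  assume "G \<in> vecs ?E"
  then obtain g where g: "g \<in> Lp_fun p" "G = ae_class g"
    by (rule Lp_space_cases)
  note [simp] = Lp_fun_measurable[OF g(1)]
  show "F + G \<in> vecs ?E" "nrm ?E (F + G) \<le> nrm ?E F + nrm ?E G"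
    using Lp_fun_add[OF f(1) g(1) p]
    by (auto simp: f(2) g(2) ae_class_add nrm_ae_class intro: ae_class_mem_Lp_space)
qed

text \<open>One form for two constructions: the weight \<open>char (- \<xi>)\<close> gives a Fourier
  coefficient, a normalised indicator gives the mean over a cell.\<close>

definition weighted_integral ::
    "(real^'n::finite \<Rightarrow> complex) \<Rightarrow> (real^'n \<Rightarrow> 'h::complex_hilbert) \<Rightarrow> 'h" where
  "weighted_integral w f = (LINT x|torus. w x *\<^sub>C f x)"

lemma weighted_integral_cong_AE:
  assumes "AE x in torus. f x = g x" "w \<in> borel_measurable torus"
    "f \<in> borel_measurable torus" "g \<in> borel_measurable torus"
  shows "weighted_integral w f = weighted_integral w g"
  unfolding weighted_integral_def
  by (rule integral_cong_AE) (use assms in auto)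

lemma weighted_integral_rep:
  "w \<in> borel_measurable torus \<Longrightarrow> f \<in> borel_measurable torus \<Longrightarrow>
    weighted_integral w (rep_L0 (ae_class f)) = weighted_integral w f"
  by (intro weighted_integral_cong_AE rep_L0_ae_class) auto

lemma weighted_integrable:
  assumes f: "f \<in> Lp_fun p" and p: "1 \<le> p" and [measurable]: "w \<in> borel_measurable torus"
    and w: "\<And>x. cmod (w x) \<le> C"
  shows "integrable torus (\<lambda>x. w x *\<^sub>C f x)"
proof (rule Bochner_Integration.integrable_bound)
  show "integrable torus (\<lambda>x. C *\<^sub>R norm (f x))"
    using Lp_fun_integrable[OF f p] by simp
  show "(\<lambda>x. w x *\<^sub>C f x) \<in> borel_measurable torus"
    using f by measurable
  show "AE x in torus. norm (w x *\<^sub>C f x) \<le> norm (C *\<^sub>R norm (f x))"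
    using w by (auto simp: norm_scaleC abs_mult intro!: mult_right_mono order_trans[OF w])
qed

lemma weighted_integral_add:
  assumes "f \<in> Lp_fun p" "g \<in> Lp_fun p" "1 \<le> p" "w \<in> borel_measurable torus" "\<And>x. cmod (w x) \<le> C"
  shows "weighted_integral w (\<lambda>x. f x + g x) = weighted_integral w f + weighted_integral w g"
  unfolding weighted_integral_def
  using weighted_integrable[OF assms(1,3-5)] weighted_integrable[OF assms(2,3-5)]
  by (simp add: scaleC_add_right)

lemma weighted_integral_scaleC:
  assumes "f \<in> Lp_fun p" "1 \<le> p" "w \<in> borel_measurable torus" "\<And>x. cmod (w x) \<le> C"
  shows "weighted_integral w (\<lambda>x. c *\<^sub>C f x) = c *\<^sub>C weighted_integral w f"
proof -
  have "w x *\<^sub>C c *\<^sub>C f x = c *\<^sub>C w x *\<^sub>C f x" for x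
    by (simp add: scaleC_scaleC mult.commute)
  then show ?thesis
    unfolding weighted_integral_def
    using integral_bounded_linear[OF bounded_linear_scaleC weighted_integrable[OF assms], of c] by (simp only:)
qed

lemma norm_weighted_integral_le:
  assumes f: "f \<in> Lp_fun p" and p: "1 \<le> p" and [measurable]: "w \<in> borel_measurable torus"
    and w: "\<And>x. cmod (w x) \<le> C"
  shows "norm (weighted_integral w f) \<le> C * Lp_seminorm p f"
proof -
  have C: "0 \<le> C" using w[of 0] norm_ge_zero order_trans by blast
  have "norm (weighted_integral w f) \<le> (LINT x|torus. norm (w x *\<^sub>C f x))"
    unfolding weighted_integral_def by (rule integral_norm_bound)
  also have "\<dots> \<le> (LINT x|torus. C * norm (f x))"
    using integrable_norm[OF weighted_integrable[OF f p assms(3) w]] Lp_fun_integrable[OF f p]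
    by (intro integral_mono) (auto simp: norm_scaleC intro!: mult_right_mono w)
  also have "\<dots> = C * (LINT x|torus. norm (f x))"
    by simp
  also have "\<dots> \<le> C * Lp_seminorm p f"
    by (intro mult_left_mono integral_norm_le_Lp_seminorm f p C)
  finally show ?thesis .
qed

text \<open>Linearity holds although \<open>rep_L0\<close> is not linear, because integrals do not
  see null sets. The norm bound combines |w| \<le> C with the comparison of L^1 and L^p
  norms.\<close>

lemma weighted_integral_dual:
  fixes w :: "real^'n::finite \<Rightarrow> complex" and u :: "'h::complex_hilbert \<Rightarrow> complex"
  assumes u: "u \<in> dual H_space" and p: "1 \<le> p" and w [measurable]: "w \<in> borel_measurable torus"
    and wC: "\<And>x. cmod (w x) \<le> C"
  shows "(\<lambda>F. u (weighted_integral w (rep_L0 F))) \<in> dual (Lp_space p)"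
    and "dual_norm (Lp_space p) (\<lambda>F. u (weighted_integral w (rep_L0 F))) \<le> dual_norm H_space u * C"
proof -
  interpret H: seminormed "H_space :: 'h normed_space" by (rule seminormed_H_space)
  let ?E = "Lp_space p :: ('n, 'h) torus_L0 normed_space"
  interpret E: seminormed ?E by (rule seminormed_Lp_space[OF p])
  let ?\<phi> = "\<lambda>F. u (weighted_integral w (rep_L0 F))"
  have C: "0 \<le> C" using wC[of 0] norm_ge_zero order_trans by blast
  have bound: "cmod (?\<phi> F) \<le> (dual_norm H_space u * C) * nrm ?E F" if "F \<in> vecs ?E" for F
  proof -
    have "cmod (?\<phi> F) \<le> dual_norm H_space u * norm (weighted_integral w (rep_L0 F))"
      using H.dual_norm_bound[OF u, of "weighted_integral w (rep_L0 F)"] by (simp add: H_space_def)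
    also have "\<dots> \<le> dual_norm H_space u * (C * Lp_seminorm p (rep_L0 F))"
      using that by (intro mult_left_mono norm_weighted_integral_le p w wC H.dual_norm_nonneg u)
        (simp add: vecs_Lp_space)
    finally show ?thesis by (simp add: nrm_Lp_space mult.assoc)
  qed
  have add: "?\<phi> (F + G) = ?\<phi> F + ?\<phi> G" if FG: "F \<in> vecs ?E" "G \<in> vecs ?E" for F G
  proof -
    obtain f g where fg: "f \<in> Lp_fun p" "g \<in> Lp_fun p" and eq: "F = ae_class f" "G = ae_class g"
      using FG by (metis Lp_space_cases)
    have [measurable, simp]: "f \<in> borel_measurable torus" "g \<in> borel_measurable torus"
      using fg by (auto dest: Lp_fun_measurable)
    show ?thesis
      using H.dual_add[OF u] weighted_integral_add[OF fg p w wC]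
      by (simp add: eq ae_class_add weighted_integral_rep H_space_def)
  qed
  have scale: "?\<phi> (c *\<^sub>C F) = c * ?\<phi> F" if F: "F \<in> vecs ?E" for c F
  proof -
    obtain f where f: "f \<in> Lp_fun p" and eq: "F = ae_class f"
      using F by (rule Lp_space_cases)
    have [measurable, simp]: "f \<in> borel_measurable torus"
      using f by (rule Lp_fun_measurable)
    show ?thesis
      using H.dual_scaleC[OF u] weighted_integral_scaleC[OF f p w wC]
      by (simp add: eq ae_class_scaleC weighted_integral_rep H_space_def borel_measurable_scaleC)
  qed
  show "?\<phi> \<in> dual ?E"
    unfolding dual_def using add scale bound by blast
  show "dual_norm ?E ?\<phi> \<le> dual_norm H_space u * C"
    using bound by (intro E.dual_norm_le) (auto intro: mult_nonneg_nonneg C H.dual_norm_nonneg u)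
qed

section \<open>Averaging over finite partitions\<close>

lemma finite_rank_diff:
  assumes E: "seminormed E" and "finite_rank E P" "x \<in> vecs E" "y \<in> vecs E"
  shows "P (x - y) = P x - P y"
  using assms(2)
proof induction
  case (finite_rank_step P u v)
  then show ?case
    using seminormed.dual_diff[OF E finite_rank_step.hyps(2) assms(3,4)] by (simp add: scaleC_diff_left)
qed simp

text \<open>The partition consists of the level sets of \<open>h\<close>. The codomain of
  \<open>h\<close> is left open so that it may be a type of lists: one \<open>h\<close> then refines
  several simple functions together.\<close>

locale simple_partition =
  fixes h :: "real^'n::finite \<Rightarrow> 'c" and R :: "'h::complex_hilbert \<Rightarrow> 'h" and p :: real
  assumes h: "simple_function torus h" and R: "finite_rank H_space R"
    and R_le: "\<And>v. norm (R v) \<le> norm v" and p: "1 \<le> p"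
begin

definition cell :: "'c \<Rightarrow> (real^'n) set" where
  "cell y = h -` {y} \<inter> cbox 0 1"

text \<open>The density that computes the mean over a cell; on a null cell, division by zero makes
  it 0.\<close>

definition weight :: "'c \<Rightarrow> real^'n \<Rightarrow> complex" where
  "weight y x = indicator (cell y) x / complex_of_real (measure torus (cell y))"

definition averaging :: "(real^'n \<Rightarrow> 'h) \<Rightarrow> real^'n \<Rightarrow> 'h" where
  "averaging f x = (\<Sum>y\<in>h ` cbox 0 1. indicator (cell y) x *\<^sub>C R (weighted_integral (weight y) f))"

lemma finite_range: "finite (h ` cbox 0 1)"
  using simple_functionD(1)[OF h] by simp

lemma cell_sets [measurable]: "cell y \<in> sets torus"
  using simple_functionD(2)[OF h, of "{y}"] by (simp add: cell_def)

lemma weight_measurable [measurable]: "weight y \<in> borel_measurable torus"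
  unfolding weight_def by measurable

lemma weight_bound: "cmod (weight y x) \<le> 1 / measure torus (cell y)"
  by (simp add: weight_def indicator_def norm_divide)

lemma averaging_measurable [measurable]: "averaging f \<in> borel_measurable torus"
  unfolding averaging_def by measurable

lemma averaging_eq:
  assumes "x \<in> cbox 0 1"
  shows "averaging f x = R (weighted_integral (weight (h x)) f)"
proof -
  have "averaging f x = (\<Sum>y\<in>h ` cbox 0 1. if y = h x then R (weighted_integral (weight (h x)) f) else 0)"
    unfolding averaging_def using assms by (intro sum.cong) (auto simp: cell_def)
  then show ?thesis using assms finite_range by simp
qed

lemma norm_average_le:
  assumes f: "f \<in> Lp_fun p"
  shows "measure torus (cell y) * norm (R (weighted_integral (weight y) f)) powr p
    \<le> (LINT x|torus. indicator (cell y) x * norm (f x) powr p)"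
proof -
  have "norm (R (weighted_integral (weight y) f)) \<le> norm (weighted_integral (weight y) f)"
    by (rule R_le)
  also have "\<dots> \<le> (LINT x|torus. norm (weight y x *\<^sub>C f x))"
    unfolding weighted_integral_def by (rule integral_norm_bound)
  also have "\<dots> = (LINT x|torus. indicator (cell y) x * norm (f x) / measure torus (cell y))"
    by (intro Bochner_Integration.integral_cong) (auto simp: weight_def norm_scaleC norm_divide indicator_def)
  also have "\<dots> = (LINT x|torus. indicator (cell y) x * norm (f x)) / measure torus (cell y)"
    by simp
  finally have "norm (R (weighted_integral (weight y) f)) powr p
      \<le> ((LINT x|torus. indicator (cell y) x * norm (f x)) / measure torus (cell y)) powr p"
    using p by (intro powr_mono2) auto
  then have "measure torus (cell y) * norm (R (weighted_integral (weight y) f)) powr p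
      \<le> measure torus (cell y) * ((LINT x|torus. indicator (cell y) x * norm (f x)) / measure torus (cell y)) powr p"
    by (intro mult_left_mono) auto
  also have "\<dots> \<le> (LINT x|torus. indicator (cell y) x * norm (f x) powr p)"
    by (rule Jensen_on_set[OF f p cell_sets])
  finally show ?thesis .
qed

lemma sum_cells:
  fixes g :: "'c \<Rightarrow> real"
  assumes "x \<in> cbox 0 1"
  shows "(\<Sum>y\<in>h ` cbox 0 1. indicator (cell y) x * g y) = g (h x)"
proof -
  have "(\<Sum>y\<in>h ` cbox 0 1. indicator (cell y) x * g y) = (\<Sum>y\<in>h ` cbox 0 1. if y = h x then g (h x) else 0)"
    using assms by (intro sum.cong) (auto simp: cell_def)
  then show ?thesis using assms finite_range by simp
qed

text \<open>The averaged function is constant on each cell, where Jensen bounds its p-th power times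
  the measure of the cell by the integral of |f|^p over that cell. Summation over the finitely many
  cells recovers the integral over the torus.\<close>

lemma averaging_contraction:
  assumes f: "f \<in> Lp_fun p"
  shows "averaging f \<in> Lp_fun p" and "Lp_seminorm p (averaging f) \<le> Lp_seminorm p f"
proof -
  let ?a = "\<lambda>y. norm (R (weighted_integral (weight y) f)) powr p"
  have int: "integrable torus (indicator (cell y) :: _ \<Rightarrow> real)" for y
    by (intro integrable_real_indicator cell_sets) (simp add: torus.emeasure_eq_measure)
  have eq: "norm (averaging f x) powr p = (\<Sum>y\<in>h ` cbox 0 1. indicator (cell y) x * ?a y)"
    if "x \<in> cbox 0 1" for x
    using that by (simp add: averaging_eq sum_cells)
  show "averaging f \<in> Lp_fun p"
  proof (rule Lp_fun_bounded)
    show "AE x in torus. norm (averaging f x) powr p \<le> (\<Sum>y\<in>h ` cbox 0 1. indicator (cell y) x * ?a y)"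
      using eq by (intro AE_I2) simp
    show "integrable torus (\<lambda>x. \<Sum>y\<in>h ` cbox 0 1. indicator (cell y) x * ?a y)"
      by (intro Bochner_Integration.integrable_sum integrable_mult_left int)
  qed (use p in auto)
  have "(LINT x|torus. norm (averaging f x) powr p) = (LINT x|torus. (\<Sum>y\<in>h ` cbox 0 1. indicator (cell y) x * ?a y))"
    by (intro Bochner_Integration.integral_cong) (auto simp: eq)
  also have "\<dots> = (\<Sum>y\<in>h ` cbox 0 1. LINT x|torus. indicator (cell y) x * ?a y)"
    by (intro Bochner_Integration.integral_sum integrable_mult_left int)
  also have "\<dots> = (\<Sum>y\<in>h ` cbox 0 1. measure torus (cell y) * ?a y)"
    using sets.sets_into_space[OF cell_sets] by (intro sum.cong) (auto simp: Int_absorb2 int)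
  also have "\<dots> \<le> (\<Sum>y\<in>h ` cbox 0 1. LINT x|torus. indicator (cell y) x * norm (f x) powr p)"
    by (intro sum_mono norm_average_le f)
  also have "\<dots> = (LINT x|torus. (\<Sum>y\<in>h ` cbox 0 1. indicator (cell y) x * norm (f x) powr p))"
    using integrable_real_mult_indicator[OF cell_sets Lp_fun_integrable_powr[OF f]]
    by (intro Bochner_Integration.integral_sum[symmetric]) (simp add: mult.commute)
  also have "\<dots> = (LINT x|torus. norm (f x) powr p)"
    by (intro Bochner_Integration.integral_cong) (auto simp: sum_cells)
  finally show "Lp_seminorm p (averaging f) \<le> Lp_seminorm p f"
    using p by (subst Lp_seminorm_le_iff) (auto simp: Lp_seminorm_powr)
qed

text \<open>On a cell of positive measure the mean of a constant is that constant. On a null cell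
  the weight vanishes and the identity may fail, hence the restriction to almost every
  point.\<close>

lemma averaging_simple:
  assumes g: "g \<in> Lp_fun p" and const: "\<And>x x'. x \<in> cbox 0 1 \<Longrightarrow> x' \<in> cbox 0 1 \<Longrightarrow> h x = h x' \<Longrightarrow> g x = g x'"
  shows "AE x in torus. averaging g x = R (g x)"
proof -
  have "AE x in torus. x \<notin> cell y \<or> averaging g x = R (g x)" if y: "y \<in> h ` cbox 0 1" for y
  proof (cases "measure torus (cell y) = 0")
    case True
    then have "cell y \<in> null_sets torus"
      using cell_sets by (intro null_setsI) (auto simp: torus.emeasure_eq_measure)
    from AE_not_in[OF this] show ?thesis by eventually_elim auto
  next
    case False
    show ?thesis
    proof (rule AE_I2)
      fix x assume "x \<in> space (torus :: (real^'n) measure)"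
      then have x: "x \<in> cbox 0 1" by simp
      have "averaging g x = R (g x)" if "x \<in> cell y"
      proof -
        have "weighted_integral (weight y) g = (LINT z|torus. (indicator (cell y) z / measure torus (cell y)) *\<^sub>R g x)"
          unfolding weighted_integral_def
        proof (intro Bochner_Integration.integral_cong refl)
          fix z assume "z \<in> space (torus :: (real^'n) measure)"
          then have "g z = g x" if "z \<in> cell y"
            using that \<open>x \<in> cell y\<close> x by (intro const) (auto simp: cell_def)
          then show "weight y z *\<^sub>C g z = (indicator (cell y) z / measure torus (cell y)) *\<^sub>R g x"
            by (auto simp: weight_def scaleR_scaleC indicator_def)
        qed
        also have "\<dots> = g x"
          using False sets.sets_into_space[OF cell_sets[of y]] by (simp add: Int_absorb2 torus.emeasure_eq_measure)
        finally show ?thesis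
          using that x by (simp add: averaging_eq cell_def)
      qed
      then show "x \<notin> cell y \<or> averaging g x = R (g x)" by blast
    qed
  qed
  then have "AE x in torus. \<forall>y\<in>h ` cbox 0 1. x \<notin> cell y \<or> averaging g x = R (g x)"
    by (rule AE_finite_allI[OF finite_range])
  then show ?thesis
    by (rule AE_mp) (rule AE_I2, auto simp: cell_def)
qed

lemma averaging_rep:
  "f \<in> borel_measurable torus \<Longrightarrow> averaging (rep_L0 (ae_class f)) = averaging f"
  by (simp add: averaging_def[abs_def] weighted_integral_rep)

text \<open>Induction on the rank of \<open>R\<close>: on each cell a rank-one term of
  \<open>R\<close> with functional \<open>u\<close> and vector \<open>v\<close> becomes the
  functional "\<open>u\<close> of the mean over the cell" paired with the class of the indicator of
  the cell times \<open>v\<close>.\<close>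

lemma finite_rank_averaging: "finite_rank (Lp_space p) (\<lambda>F. ae_class (averaging (rep_L0 F)))"
proof -
  have one: "finite_rank (Lp_space p) (\<lambda>F. ae_class (\<lambda>x. indicator (cell y) x *\<^sub>C R (weighted_integral (weight y) (rep_L0 F))))" for y
    using R
  proof induction
    case finite_rank_zero
    show ?case by (simp add: ae_class_zero finite_rank.finite_rank_zero)
  next
    case (finite_rank_step Q u v)
    have "(\<lambda>x. indicator (cell y) x *\<^sub>C v) \<in> Lp_fun p"
      by (rule bounded_Lp_fun[where C = "norm v"]) (auto simp: p norm_scaleC indicator_def)
    then have "ae_class (\<lambda>x. indicator (cell y) x *\<^sub>C v) \<in> vecs (Lp_space p)"
      by (rule ae_class_mem_Lp_space)
    from finite_rank.finite_rank_step[OF finite_rank_step.IH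
        weighted_integral_dual(1)[OF finite_rank_step.hyps(2) p weight_measurable weight_bound] this]
    show ?case
      by (simp add: ae_class_scaleC ae_class_add scaleC_add_right scaleC_scaleC mult.commute)
  qed
  have eq: "ae_class (averaging (rep_L0 F)) =
      (\<Sum>y\<in>h ` cbox 0 1. ae_class (\<lambda>x. indicator (cell y) x *\<^sub>C R (weighted_integral (weight y) (rep_L0 F))))" for F
    by (subst ae_class_sum) (auto simp: averaging_def[abs_def])
  show ?thesis
    unfolding eq by (intro finite_rank_sum one)
qed

end

lemma simple_function_map_list:
  "(\<And>F. F \<in> set xs \<Longrightarrow> simple_function M (g F)) \<Longrightarrow> simple_function M (\<lambda>x. map (\<lambda>F. g F x) xs)"
  by (induction xs) (auto intro: simple_function_compose2[where h = Cons])

text \<open>Averaging over a finite measurable partition is contractive on \<open>L\<^sup>p\<close> and fixes the simple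
  functions that are constant on its cells; a contraction of finite rank on \<open>H\<close> makes the rank finite.\<close>

theorem metric_approximation_Lp_space:
  assumes H: "metric_approximation (H_space :: 'h::complex_hilbert normed_space)" and p: "1 \<le> p"
  shows "metric_approximation (Lp_space p :: ('n::finite, 'h) torus_L0 normed_space)"
  unfolding metric_approximation_def
proof (intro allI impI)
  let ?E = "Lp_space p :: ('n, 'h) torus_L0 normed_space"
  interpret E: seminormed ?E by (rule seminormed_Lp_space[OF p])
  fix S :: "('n, 'h) torus_L0 set" and \<epsilon> :: real
  assume S: "finite S" "S \<subseteq> vecs ?E" and \<epsilon>: "0 < \<epsilon>"
  have "\<exists>g. simple_function torus g \<and> g \<in> Lp_fun p \<and> Lp_seminorm p (\<lambda>x. rep_L0 F x - g x) < \<epsilon> / 3" if "F \<in> S" for F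
    using S(2) that \<epsilon> Lp_simple_function_dense[of "rep_L0 F" p "\<epsilon> / 3"] p by (auto simp: vecs_Lp_space subset_iff)
  then obtain g where g: "\<And>F. F \<in> S \<Longrightarrow> simple_function torus (g F)"
    and gLp: "\<And>F. F \<in> S \<Longrightarrow> g F \<in> Lp_fun p"
    and gF: "\<And>F. F \<in> S \<Longrightarrow> Lp_seminorm p (\<lambda>x. rep_L0 F x - g F x) < \<epsilon> / 3"
    by metis
  obtain xs where xs: "set xs = S" using finite_list[OF S(1)] by blast
  \<comment> \<open>Equality of two lists is equality of all entries, so every \<open>g F\<close> is
    constant on the level sets of \<open>h\<close>.\<close>
  define h where "h x = map (\<lambda>F. g F x) xs" for x
  have h: "simple_function torus h"
    unfolding h_def using g xs by (intro simple_function_map_list) auto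
  \<comment> \<open>\<open>R\<close> has to be close to the identity only at the finitely many
    values of the approximating simple functions.\<close>
  define V where "V = (\<Union>F\<in>S. g F ` cbox 0 1)"
  have "finite V"
    using S(1) simple_functionD(1)[OF g] by (auto simp: V_def)
  then obtain R where R: "finite_rank H_space R" "\<And>v. norm (R v) \<le> norm (v::'h)"
    and RV: "\<And>v. v \<in> V \<Longrightarrow> norm (R v - v) < \<epsilon> / 3"
    using H \<epsilon> unfolding metric_approximation_def
    by (elim allE[of _ V] allE[of _ "\<epsilon> / 3"]) (auto simp: H_space_def)
  interpret simple_partition h R p
    using h R p by unfold_locales
  let ?P = "\<lambda>F. ae_class (averaging (rep_L0 F))"
  have contr: "nrm ?E (?P F) \<le> nrm ?E F" if "F \<in> vecs ?E" for F
    using that averaging_contraction(2)[of "rep_L0 F"]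
    by (simp add: nrm_ae_class vecs_Lp_space) (simp add: nrm_Lp_space)
  \<comment> \<open>One third of \<epsilon> each: passing from \<open>F\<close> to its simple
    approximation \<open>G\<close>, the same difference under the contraction \<open>?P\<close>, and
    the error of \<open>R\<close> on the values of \<open>G\<close>.\<close>
  have approx: "nrm ?E (?P F - F) < \<epsilon>" if F: "F \<in> S" for F
  proof -
    have FE: "F \<in> vecs ?E" using S(2) F by blast
    have gm [measurable]: "g F \<in> borel_measurable torus"
      by (rule Lp_fun_measurable[OF gLp[OF F]])
    define G where "G = ae_class (g F)"
    have G: "G \<in> vecs ?E" unfolding G_def by (rule ae_class_mem_Lp_space[OF gLp[OF F]])
    have FG: "nrm ?E (F - G) < \<epsilon> / 3"
    proof -
      have "F - G = ae_class (\<lambda>x. rep_L0 F x - g F x)"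
        unfolding G_def using ae_class_diff[of "rep_L0 F" "g F"] by simp
      then show ?thesis using gF[OF F] by (simp add: nrm_ae_class)
    qed
    note mem = finite_rank_mem[OF E.seminormed_axioms finite_rank_averaging]
    have 1: "nrm ?E (?P F - ?P G) < \<epsilon> / 3"
      using contr[OF E.diff_mem[OF FE G]] FG
      unfolding finite_rank_diff[OF E.seminormed_axioms finite_rank_averaging FE G, symmetric]
      by linarith
    have 2: "nrm ?E (?P G - G) \<le> \<epsilon> / 3"
    proof -
      have ae: "AE x in torus. averaging (g F) x = R (g F x)"
      proof (rule averaging_simple[OF gLp[OF F]])
        fix x x' assume "h x = h x'"
        then show "g F x = g F x'" using F xs by (auto simp: h_def)
      qed
      have bd: "norm (R (g F x) - g F x) \<le> \<epsilon> / 3" if "x \<in> cbox 0 1" for x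
      proof -
        have "g F x \<in> V" using F that by (auto simp: V_def simp del: mem_box_cart)
        from RV[OF this] show ?thesis by simp
      qed
      from ae have le: "AE x in torus. norm (averaging (g F) x - g F x) powr p \<le> (\<epsilon> / 3) powr p"
      proof (rule AE_mp, intro AE_I2 impI)
        fix x assume "x \<in> space (torus :: (real^'n) measure)" "averaging (g F) x = R (g F x)"
        with bd[of x] show "norm (averaging (g F) x - g F x) powr p \<le> (\<epsilon> / 3) powr p"
          using p by (intro powr_mono2) simp_all
      qed
      have "(LINT x|torus. norm (averaging (g F) x - g F x) powr p) \<le> (LINT x|(torus :: (real^'n) measure). (\<epsilon> / 3) powr p)"
        using le by (intro integral_mono_AE Lp_fun_integrable_powr Lp_fun_diff averaging_contraction gLp F p) auto
      then have "Lp_seminorm p (\<lambda>x. averaging (g F) x - g F x) \<le> \<epsilon> / 3"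
        using \<epsilon> p by (subst Lp_seminorm_le_iff) auto
      then show ?thesis
        by (simp add: G_def averaging_rep ae_class_diff nrm_ae_class)
    qed
    have "nrm ?E (?P F - F) \<le> nrm ?E (?P F - ?P G) + nrm ?E (?P G - F)"
      by (intro E.nrm_triangle_via mem FE G)
    also have "nrm ?E (?P G - F) \<le> nrm ?E (?P G - G) + nrm ?E (G - F)"
      by (intro E.nrm_triangle_via mem FE G)
    also have "nrm ?E (G - F) = nrm ?E (F - G)"
      using E.nrm_minus[OF E.diff_mem[OF FE G]] by simp
    finally show ?thesis using 1 2 FG by linarith
  qed
  show "\<exists>P. finite_rank ?E P \<and> (\<forall>x\<in>vecs ?E. nrm ?E (P x) \<le> nrm ?E x) \<and> (\<forall>x\<in>S. nrm ?E (P x - x) < \<epsilon>)"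
    by (intro exI[of _ ?P] conjI ballI finite_rank_averaging contr approx)
qed

section \<open>Density of trigonometric polynomials\<close>

definition char :: "int^'n::finite \<Rightarrow> real^'n \<Rightarrow> complex" where
  "char \<xi> x = cis (2 * pi * (x \<bullet> int_vec \<xi>))"

lemma int_vec_add: "int_vec (\<xi> + \<eta>) = int_vec \<xi> + int_vec \<eta>"
  by (simp add: int_vec_def vec_eq_iff)

lemma int_vec_minus: "int_vec (- \<xi>) = - int_vec \<xi>"
  by (simp add: int_vec_def vec_eq_iff)

lemma char_mult: "char \<xi> x * char \<eta> x = char (\<xi> + \<eta>) x"
  by (simp add: char_def cis_mult int_vec_add inner_add_right distrib_left)

lemma char_zero [simp]: "char 0 x = 1"
  by (simp add: char_def int_vec_def inner_vec_def)

lemma norm_char [simp]: "cmod (char \<xi> x) = 1"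
  by (simp add: char_def)

lemma char_minus: "char (- \<xi>) x * char \<xi> x = 1"
  by (simp add: char_mult)

lemma continuous_on_char: "continuous_on S (char \<xi>)"
  unfolding char_def by (intro continuous_intros)

lemma continuous_torus_measurable:
  "continuous_on UNIV f \<Longrightarrow> f \<in> borel_measurable (torus :: (real^'n::finite) measure)"
  unfolding torus_def
  by (intro continuous_imp_measurable_on_sets_lebesgue) (auto intro: continuous_on_subset)

lemma char_measurable [measurable, simp]: "char \<xi> \<in> borel_measurable torus"
  by (intro continuous_torus_measurable continuous_on_char)

lemma char_add_int_vec: "char \<xi> (x + int_vec m) = char \<xi> x"
proof -
  have "int_vec m \<bullet> int_vec \<xi> = of_int (\<Sum>i\<in>UNIV. m $ i * \<xi> $ i)"
    by (simp add: int_vec_def inner_vec_def)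
  then have "cis (2 * pi * (int_vec m \<bullet> int_vec \<xi>)) = 1"
    by (simp only: cis_multiple_2pi Ints_of_int)
  then show ?thesis
    by (simp add: char_def inner_add_left distrib_left cis_mult[symmetric])
qed

lemma mode_has_derivative:
  fixes v :: "'h::complex_hilbert"
  shows "((\<lambda>x. char \<xi> x *\<^sub>C v) has_derivative
    (\<lambda>h. char \<xi> x *\<^sub>C (\<i> * complex_of_real (2 * pi * (h \<bullet> int_vec \<xi>))) *\<^sub>C v)) (at x)"
proof -
  have "((\<lambda>x. char \<xi> x) has_derivative
      (\<lambda>h. (2 * pi * (h \<bullet> int_vec \<xi>)) *\<^sub>R (\<i> * char \<xi> x))) (at x)"
    unfolding char_def by (auto intro!: derivative_eq_intros)
  from bounded_linear.has_derivative[OF bounded_linear_scaleC_left this, of v] show ?thesis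
    by (simp add: scaleC_scaleC scaleR_conv_of_real mult_ac)
qed

text \<open>A directional derivative multiplies the coefficient vector of a mode by a scalar
  depending on the direction, so the result is a mode of the same frequency. Hence the induction
  over \<open>k\<close> with \<open>v\<close> arbitrary.\<close>

lemma mode_Ck: "Ck k (\<lambda>x. char \<xi> x *\<^sub>C (v::'h::complex_hilbert))"
proof (induction k arbitrary: v)
  case 0
  show ?case
    by (simp, intro bounded_bilinear.continuous_on[OF bounded_bilinear_scaleC] continuous_on_char continuous_intros)
next
  case (Suc k)
  have fd: "frechet_derivative (\<lambda>x. char \<xi> x *\<^sub>C v) (at x) h
      = char \<xi> x *\<^sub>C (\<i> * complex_of_real (2 * pi * (h \<bullet> int_vec \<xi>))) *\<^sub>C v" for x h
    by (simp add: frechet_derivative_at[OF mode_has_derivative, symmetric])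
  show ?case
    unfolding Ck.simps fd differentiable_def using mode_has_derivative[of \<xi> v]
    by (intro conjI allI Suc.IH) (rule exI)
qed

lemma mode_smooth: "(\<lambda>x. char \<xi> x *\<^sub>C v) \<in> smooth_torus"
  by (auto simp: smooth_torus_def periodic_def char_add_int_vec mode_Ck)

lemma smooth_torus_continuous: "f \<in> smooth_torus \<Longrightarrow> continuous_on UNIV f"
  unfolding smooth_torus_def by (auto dest: spec[of _ 0])

lemma continuous_Lp_fun:
  assumes f: "continuous_on UNIV f" and p: "1 \<le> p"
  shows "f \<in> Lp_fun p"
proof -
  have "compact (f ` cbox 0 1)"
    using f by (intro compact_continuous_image) (auto intro: continuous_on_subset)
  then obtain C where "\<And>y. y \<in> f ` cbox 0 1 \<Longrightarrow> norm y \<le> C"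
    by (meson bounded_iff compact_imp_bounded)
  then show ?thesis
    by (intro bounded_Lp_fun[of _ C] continuous_torus_measurable f p) blast
qed

lemma smooth_Lp_fun: "f \<in> smooth_torus \<Longrightarrow> 1 \<le> p \<Longrightarrow> f \<in> Lp_fun p"
  by (intro continuous_Lp_fun smooth_torus_continuous)

text \<open>The vectors on which an extension of A that is linear is already determined.\<close>

definition mode_span :: "('n::finite, 'h::complex_hilbert) torus_L0 set" where
  "mode_span = cspan {ae_class (\<lambda>x. char \<xi> x *\<^sub>C v) | \<xi> v. True}"

section \<open>The algebra of scalar trigonometric polynomials\<close>

inductive trig_poly :: "(real^'n::finite \<Rightarrow> complex) \<Rightarrow> bool" where
  trig_poly_char: "trig_poly (\<lambda>x. c * char \<xi> x)"
| trig_poly_add: "trig_poly f \<Longrightarrow> trig_poly g \<Longrightarrow> trig_poly (\<lambda>x. f x + g x)"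

lemma trig_poly_const: "trig_poly (\<lambda>x. c)"
  using trig_poly_char[of c 0] by simp

lemma trig_poly_char_mult:
  assumes "trig_poly g"
  shows "trig_poly (\<lambda>x. c * char \<xi> x * g x)"
  using assms
proof induction
  case (trig_poly_char d \<eta>)
  have eq: "(\<lambda>x. c * char \<xi> x * (d * char \<eta> x)) = (\<lambda>x. (c * d) * char (\<xi> + \<eta>) x)"
    by (simp add: fun_eq_iff char_mult[symmetric])
  show ?case unfolding eq by (rule trig_poly.trig_poly_char)
next
  case (trig_poly_add f g)
  then show ?case by (simp add: distrib_left trig_poly.trig_poly_add)
qed

lemma trig_poly_mult:
  assumes "trig_poly f" and g: "trig_poly g"
  shows "trig_poly (\<lambda>x. f x * g x)"
  using assms(1)
proof induction
  case (trig_poly_char c \<xi>)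
  show ?case by (rule trig_poly_char_mult[OF g])
next
  case (trig_poly_add f f')
  then show ?case by (simp add: distrib_right trig_poly.trig_poly_add)
qed

lemma trig_poly_sum: "(\<And>i. i \<in> A \<Longrightarrow> trig_poly (f i)) \<Longrightarrow> trig_poly (\<lambda>x. \<Sum>i\<in>A. f i x)"
  by (induction A rule: infinite_finite_induct) (auto intro: trig_poly_const trig_poly_add)

lemma trig_poly_continuous: "trig_poly f \<Longrightarrow> continuous_on S f"
  by (induction rule: trig_poly.induct) (auto intro!: continuous_intros continuous_on_char)

lemma trig_poly_measurable: "trig_poly f \<Longrightarrow> f \<in> borel_measurable torus"
  by (intro continuous_torus_measurable trig_poly_continuous)

lemma trig_poly_mode_span:
  assumes "trig_poly w"
  shows "ae_class (\<lambda>x. w x *\<^sub>C v) \<in> mode_span"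
  using assms
proof induction
  case (trig_poly_char c \<xi>)
  have "ae_class (\<lambda>x. char \<xi> x *\<^sub>C c *\<^sub>C v) \<in> mode_span"
    unfolding mode_span_def by (intro complex_vector.span_base) blast
  then show ?case by (simp add: scaleC_scaleC mult.commute)
next
  case (trig_poly_add f g)
  then have "ae_class (\<lambda>x. f x *\<^sub>C v) + ae_class (\<lambda>x. g x *\<^sub>C v) \<in> mode_span"
    unfolding mode_span_def by (intro complex_vector.span_add)
  then show ?case
    using trig_poly_measurable[OF trig_poly_add.hyps(1)] trig_poly_measurable[OF trig_poly_add.hyps(2)]
    by (subst (asm) ae_class_add) (auto simp: scaleC_add_left)
qed

text \<open>The torus as a product of unit circles in complex n-space: real polynomials in the
  ambient coordinates pull back to trigonometric polynomials, and Stone-Weierstrass applies on the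
  compact image.\<close>

definition circle_map :: "real^'n::finite \<Rightarrow> complex^'n" where
  "circle_map x = (\<chi> i. cis (2 * pi * x $ i))"

lemma continuous_on_circle_map: "continuous_on S circle_map"
  unfolding circle_map_def by (intro continuous_intros)

text \<open>Corresponding coordinates differ by an integer. One point in the open cube and the other
  in the closed cube make the difference less than 1 in modulus; two points of the boundary could be
  identified.\<close>

lemma circle_map_inj:
  assumes x: "x \<in> box 0 1" and y: "y \<in> cbox 0 1" and eq: "circle_map x = circle_map y"
  shows "x = y"
proof -
  have "x $ i = y $ i" for i
  proof -
    have "cis (2 * pi * x $ i) = cis (2 * pi * y $ i)"
      using eq by (simp add: circle_map_def vec_eq_iff)
    then have "cis (2 * pi * (x $ i - y $ i)) = 1"
      by (simp add: right_diff_distrib cis_divide[symmetric])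
    then have "cos (2 * pi * (x $ i - y $ i)) = 1"
      by (simp add: complex_eq_iff)
    then obtain n :: int where "2 * pi * (x $ i - y $ i) = of_int n * 2 * pi"
      using cos_one_2pi_int by auto
    then have n: "x $ i - y $ i = of_int n" by simp
    moreover have "\<bar>x $ i - y $ i\<bar> < 1"
      using x y by (auto simp: mem_box_cart abs_less_iff dest!: spec[of _ i])
    ultimately have "n = 0" by linarith
    with n show ?thesis by simp
  qed
  then show ?thesis by (simp add: vec_eq_iff)
qed

lemma char_axis: "char (axis i k) x = cis (2 * pi * (x $ i * real_of_int k))"
proof -
  have "x \<bullet> int_vec (axis i k) = (\<Sum>j\<in>UNIV. if j = i then x $ i * real_of_int k else 0)"
    unfolding int_vec_def inner_vec_def by (intro sum.cong) (auto simp: axis_def)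
  then show ?thesis by (simp add: char_def)
qed

lemma trig_poly_circle_map_component:
  "trig_poly (\<lambda>x. complex_of_real (Re (circle_map x $ i)))"
  "trig_poly (\<lambda>x. complex_of_real (Im (circle_map x $ i)))"
proof -
  have Re: "complex_of_real (Re (circle_map x $ i)) = 1/2 * char (axis i 1) x + 1/2 * char (axis i (-1)) x"
    and Im: "complex_of_real (Im (circle_map x $ i)) = (- \<i>/2) * char (axis i 1) x + \<i>/2 * char (axis i (-1)) x" for x
    by (auto simp: circle_map_def char_axis complex_eq_iff)
  show "trig_poly (\<lambda>x. complex_of_real (Re (circle_map x $ i)))"
    "trig_poly (\<lambda>x. complex_of_real (Im (circle_map x $ i)))"
    unfolding Re Im by (rule trig_poly_add[OF trig_poly_char trig_poly_char])+
qed

text \<open>A real-linear functional is a combination of the real and imaginary parts of the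
  coordinates, which are trigonometric polynomials by Euler's formulas; closure under sums and
  products gives the rest.\<close>

lemma trig_poly_polynomial_circle_map:
  assumes "real_polynomial_function q"
  shows "trig_poly (\<lambda>x. complex_of_real (q (circle_map x)))"
  using assms
proof induction
  case (linear f)
  note lin = bounded_linear.linear[OF linear]
  have "f (circle_map x) = (\<Sum>i\<in>UNIV. Re (circle_map x $ i) * f (axis i 1) + Im (circle_map x $ i) * f (axis i \<i>))" for x
  proof -
    have "z = (\<Sum>i\<in>UNIV. Re (z $ i) *\<^sub>R axis i 1 + Im (z $ i) *\<^sub>R axis i \<i>)" for z :: "complex^'a"
    proof (rule vec_eq_iff[THEN iffD2, OF allI])
      fix j
      have "(\<Sum>i\<in>UNIV. (Re (z $ i) *\<^sub>R axis i 1 + Im (z $ i) *\<^sub>R axis i \<i>) $ j)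
          = (\<Sum>i\<in>UNIV. if i = j then z $ j else 0)"
        by (intro sum.cong) (auto simp: axis_def complex_eq_iff)
      then show "z $ j = (\<Sum>i\<in>UNIV. Re (z $ i) *\<^sub>R axis i 1 + Im (z $ i) *\<^sub>R axis i \<i>) $ j"
        by simp
    qed
    then have "f (circle_map x) = f (\<Sum>i\<in>UNIV. Re (circle_map x $ i) *\<^sub>R axis i 1 + Im (circle_map x $ i) *\<^sub>R axis i \<i>)"
      by (rule arg_cong)
    also have "\<dots> = (\<Sum>i\<in>UNIV. Re (circle_map x $ i) * f (axis i 1) + Im (circle_map x $ i) * f (axis i \<i>))"
      by (simp add: linear_sum[OF lin] linear_add[OF lin] linear_cmul[OF lin])
    finally show ?thesis .
  qed
  then show ?case
    by (simp add: trig_poly_sum trig_poly_add trig_poly_mult trig_poly_const trig_poly_circle_map_component)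
next
  case (const c)
  show ?case by (rule trig_poly_const)
next
  case (add f g)
  then show ?case by (simp add: trig_poly_add)
next
  case (mult f g)
  then show ?case by (simp add: trig_poly_mult)
qed

section \<open>Approximation of indicators and density\<close>

lemma emeasure_torus: "A \<subseteq> cbox 0 1 \<Longrightarrow> emeasure torus A = emeasure lebesgue A"
  unfolding torus_def by (rule emeasure_restrict_space) auto

lemma sets_torus: "A \<in> sets (torus :: (real^'n::finite) measure) \<longleftrightarrow> A \<subseteq> cbox 0 1 \<and> A \<in> sets lebesgue"
  unfolding torus_def by (rule sets_restrict_space_iff) auto

lemma AE_torus_box: "AE x in (torus :: (real^'n::finite) measure). x \<in> box 0 1"
proof -
  have "cbox 0 1 - box 0 1 \<in> null_sets (torus :: (real^'n) measure)"
    using negligible_frontier_interval[of "0::real^'n" 1]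
    unfolding torus_def by (subst null_sets_restrict_space) (auto simp: negligible_iff_null_sets)
  from AE_not_in[OF this] show ?thesis
    by (rule AE_mp) (rule AE_I2, auto simp del: mem_box_cart)
qed

text \<open>The circle map is injective on the open cube, so Urysohn and Stone--Weierstrass on its image
  give a trigonometric polynomial close to the indicator.\<close>

lemma trig_poly_approx_indicator:
  assumes B: "B \<in> sets (torus :: (real^'n::finite) measure)" and \<eta>: "0 < \<eta>" "\<eta> \<le> 1"
  obtains w N where "trig_poly w" "N \<in> sets (torus :: (real^'n) measure)" "measure torus N \<le> 2 * \<eta>"
    "AE x in torus. cmod (indicator B x - w x) \<le> indicator N x + \<eta>"
proof -
  have B': "B \<inter> box 0 1 \<in> sets lebesgue"
    using B by (auto simp: sets_torus)
  obtain K where K: "closed K" "K \<subseteq> B \<inter> box 0 1" "B \<inter> box 0 1 - K \<in> lmeasurable"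
      "emeasure lebesgue (B \<inter> box 0 1 - K) < ennreal \<eta>"
    by (rule sets_lebesgue_inner_closed[OF B' \<eta>(1)])
  have Ks: "K \<in> sets lebesgue" using K(1) by auto
  obtain U where U: "open U" "K \<subseteq> U" "U - K \<in> lmeasurable" "emeasure lebesgue (U - K) < ennreal \<eta>"
    by (rule sets_lebesgue_outer_open[OF Ks \<eta>(1)])
  define W where "W = U \<inter> box 0 1"
  have W: "open W" "K \<subseteq> W" "W \<subseteq> box 0 1"
    using U K by (auto simp: W_def)
  \<comment> \<open>The exceptional set joins the part of \<open>B\<close> lost to the compact set
    \<open>K\<close> and the margin between \<open>K\<close> and its neighbourhood \<open>W\<close>,
    each of measure at most \<eta>. A point of the open cube outside \<open>N\<close> lies in
    \<open>K\<close> or outside both \<open>B\<close> and \<open>W\<close>.\<close>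
  define N where "N = (B \<inter> box 0 1 - K) \<union> (W - K)"
  have Nb: "B \<inter> box 0 1 - K \<subseteq> cbox 0 1" "W - K \<subseteq> cbox 0 1"
    using W box_subset_cbox[of "0::real^'n" 1] by blast+
  have sets: "B \<inter> box 0 1 - K \<in> sets torus" "W - K \<in> sets torus"
    using Nb K(3) W(1) Ks by (auto simp: sets_torus simp del: mem_box_cart)
  then have N: "N \<in> sets torus" by (auto simp: N_def)
  have "emeasure torus N \<le> emeasure torus (B \<inter> box 0 1 - K) + emeasure torus (W - K)"
    unfolding N_def by (rule emeasure_subadditive[OF sets])
  also have "\<dots> \<le> ennreal \<eta> + ennreal \<eta>"
  proof (rule add_mono)
    show "emeasure torus (B \<inter> box 0 1 - K) \<le> ennreal \<eta>"
      using K(4) by (simp add: emeasure_torus[OF Nb(1)])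
    have "emeasure lebesgue (W - K) \<le> emeasure lebesgue (U - K)"
      using U(1) Ks by (intro emeasure_mono) (auto simp: W_def)
    then show "emeasure torus (W - K) \<le> ennreal \<eta>"
      using U(4) by (simp add: emeasure_torus[OF Nb(2)])
  qed
  also have "\<dots> = ennreal (2 * \<eta>)"
    using \<eta> by (simp add: ennreal_plus[symmetric] del: ennreal_plus)
  finally have Nm: "measure torus N \<le> 2 * \<eta>"
    using \<eta> by (simp add: torus.emeasure_eq_measure ennreal_le_iff)
  have "compact K"
    using K(1,2) bounded_subset[OF bounded_box, of K "0::real^'n" 1] by (simp add: compact_eq_bounded_closed)
  then have clK: "closed (circle_map ` K)"
    by (intro compact_imp_closed compact_continuous_image continuous_on_circle_map)
  have "compact (cbox 0 1 - W)"
    by (intro compact_diff W compact_cbox)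
  then have clW: "closed (circle_map ` (cbox 0 1 - W))"
    by (intro compact_imp_closed compact_continuous_image continuous_on_circle_map)
  \<comment> \<open>As \<open>K\<close> lies in the open cube, its image also avoids that of the
    boundary faces.\<close>
  have disj: "circle_map ` K \<inter> circle_map ` (cbox 0 1 - W) = {}"
  proof (rule ccontr)
    assume "circle_map ` K \<inter> circle_map ` (cbox 0 1 - W) \<noteq> {}"
    then obtain x y where xy: "x \<in> K" "y \<in> cbox 0 1" "y \<notin> W" "circle_map x = circle_map y"
      by blast
    then have "x = y" using K(2) by (intro circle_map_inj) auto
    with xy W show False by blast
  qed
  have "\<exists>g :: complex^'n \<Rightarrow> real. continuous_on UNIV g \<and> (\<forall>z. 0 \<le> g z \<and> g z \<le> 1) \<and>
      (\<forall>z\<in>circle_map ` K. g z = 1) \<and> (\<forall>z\<in>circle_map ` (cbox 0 1 - W). g z = 0)"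
  proof (rule Urysohn[OF clK clW disj, of "1::real" 0])
    fix g :: "complex^'n \<Rightarrow> real"
    assume g: "continuous_on UNIV g" "\<And>z. g z \<in> closed_segment 1 0"
      "\<And>z. z \<in> circle_map ` K \<Longrightarrow> g z = 1" "\<And>z. z \<in> circle_map ` (cbox 0 1 - W) \<Longrightarrow> g z = 0"
    have "0 \<le> g z \<and> g z \<le> 1" for z
      using g(2)[of z] by (simp add: closed_segment_eq_real_ivl)
    with g show ?thesis by (intro exI[of _ g]) blast
  qed
  then obtain g :: "complex^'n \<Rightarrow> real" where g: "continuous_on UNIV g"
    and g': "\<forall>z. 0 \<le> g z \<and> g z \<le> 1" "\<forall>z\<in>circle_map ` K. g z = 1" "\<forall>z\<in>circle_map ` (cbox 0 1 - W). g z = 0"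
    by (elim exE conjE)
  have g01': "0 \<le> g z \<and> g z \<le> 1" and gK: "z \<in> circle_map ` K \<Longrightarrow> g z = 1"
    and gW: "z \<in> circle_map ` (cbox 0 1 - W) \<Longrightarrow> g z = 0" for z
    using g' by blast+
  obtain q where q: "real_polynomial_function q"
    and gq: "\<And>z. z \<in> circle_map ` cbox 0 1 \<Longrightarrow> \<bar>g z - q z\<bar> < \<eta>"
    by (rule Stone_Weierstrass_real_polynomial_function[of "circle_map ` cbox 0 1" g \<eta>])
      (auto intro!: compact_continuous_image continuous_on_circle_map continuous_on_subset[OF g] \<eta> simp del: mem_box_cart)
  define w where "w x = complex_of_real (q (circle_map x))" for x
  have approx: "cmod (indicator B x - w x) \<le> indicator N x + \<eta>" if x: "x \<in> box 0 1" for x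
  proof -
    have xc: "x \<in> cbox 0 1" using x box_subset_cbox by blast
    have "\<bar>indicator B x - g (circle_map x)\<bar> \<le> (indicator N x :: real)"
    proof (cases "x \<in> N")
      case True
      then show ?thesis using g01'[of "circle_map x"] by (auto simp: indicator_def)
    next
      case False
      show ?thesis
      proof (cases "x \<in> K")
        case True
        then show ?thesis using K(2) gK[of "circle_map x"] by (auto simp: indicator_def)
      next
        case False
        with \<open>x \<notin> N\<close> x have "x \<notin> B" "x \<notin> W" by (auto simp: N_def)
        then have "g (circle_map x) = 0" using xc gW by blast
        with \<open>x \<notin> B\<close> show ?thesis by simp
      qed
    qed
    moreover have "\<bar>g (circle_map x) - q (circle_map x)\<bar> < \<eta>"
      using gq xc by blast
    moreover have "cmod (indicator B x - w x) = \<bar>indicator B x - q (circle_map x)\<bar>"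
    proof -
      have "indicator B x - w x = complex_of_real (indicator B x - q (circle_map x))"
        by (simp add: w_def indicator_def)
      then show ?thesis by (simp only: norm_of_real real_norm_def)
    qed
    ultimately show ?thesis by linarith
  qed
  have "AE x in torus. cmod (indicator B x - w x) \<le> indicator N x + \<eta>"
    using AE_torus_box by eventually_elim (rule approx)
  moreover have "trig_poly w"
    unfolding w_def by (rule trig_poly_polynomial_circle_map[OF q])
  ultimately show thesis using N Nm that by blast
qed

lemma mode_span_indicator_dense:
  fixes v :: "'h::complex_hilbert"
  assumes B: "B \<in> sets (torus :: (real^'n::finite) measure)" and p: "1 \<le> p" and \<epsilon>: "0 < \<epsilon>"
  shows "\<exists>G\<in>mode_span. nrm (Lp_space p) (ae_class (\<lambda>x. indicator B x *\<^sub>C v) - G) < \<epsilon>"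
proof -
  \<comment> \<open>On \<open>N\<close>, of measure at most 2 \<eta>, the scalar error to the power
    p is at most (1 + \<eta>)^p \<le> 2^p; elsewhere it is at most \<eta>^p \<le> \<eta>. So
    \<open>c * \<eta>\<close> bounds the integral of the error, and \<eta> is chosen from this, with
    \<open>c + 1\<close> in the denominator in case \<open>v = 0\<close>.\<close>
  define c where "c = norm v powr p * (2 powr p * 2 + 1)"
  have c: "0 \<le> c" by (simp add: c_def)
  define \<eta> where "\<eta> = min 1 ((\<epsilon> / 2) powr p / (c + 1))"
  have \<eta>: "0 < \<eta>" "\<eta> \<le> 1"
    using \<epsilon> c by (auto simp: \<eta>_def intro!: divide_pos_pos add_nonneg_pos)
  obtain w N where w: "trig_poly w" and N [measurable]: "N \<in> sets torus" and Nm: "measure torus N \<le> 2 * \<eta>"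
    and approx: "AE x in torus. cmod (indicator B x - w x) \<le> indicator N x + \<eta>"
    by (rule trig_poly_approx_indicator[OF B \<eta>])
  note [measurable] = B trig_poly_measurable[OF w]
  let ?d = "\<lambda>x. indicator B x *\<^sub>C v - w x *\<^sub>C v"
  have intN: "integrable torus (indicator N :: _ \<Rightarrow> real)"
    by (intro integrable_real_indicator N) (simp add: torus.emeasure_eq_measure)
  have le: "AE x in torus. norm (?d x) powr p \<le> norm v powr p * (2 powr p * indicator N x + \<eta>)"
    using approx
  proof eventually_elim
    case (elim x)
    have "norm (?d x) powr p = norm v powr p * cmod (indicator B x - w x) powr p"
      by (simp add: scaleC_diff_left[symmetric] norm_scaleC powr_mult)
    also have "\<dots> \<le> norm v powr p * (indicator N x + \<eta>) powr p"
      using elim p by (intro mult_left_mono powr_mono2) auto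
    also have "(indicator N x + \<eta>) powr p \<le> 2 powr p * indicator N x + \<eta>"
    proof (cases "x \<in> N")
      case True
      have "(1 + \<eta>) powr p \<le> 2 powr p" using \<eta> p by (intro powr_mono2) auto
      with True \<eta> show ?thesis by simp
    next
      case False
      have "\<eta> powr p \<le> \<eta> powr 1" using \<eta> p by (intro powr_mono') auto
      with False \<eta> show ?thesis by simp
    qed
    finally show ?case by (simp add: mult_left_mono)
  qed
  have int: "integrable torus (\<lambda>x. norm v powr p * (2 powr p * indicator N x + \<eta>))"
    by (intro integrable_mult_right Bochner_Integration.integrable_add intN integrable_const) auto
  have d: "?d \<in> Lp_fun p"
    by (rule Lp_fun_bounded[OF _ _ le int]) (use p in auto)
  have "(LINT x|torus. norm (?d x) powr p) \<le> (LINT x|torus. norm v powr p * (2 powr p * indicator N x + \<eta>))"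
    by (intro integral_mono_AE int le Lp_fun_integrable_powr d)
  also have "\<dots> = norm v powr p * (2 powr p * measure torus N + \<eta>)"
    using intN sets.sets_into_space[OF N] by (simp add: Int_absorb2)
  also have "\<dots> \<le> norm v powr p * (2 powr p * (2 * \<eta>) + \<eta>)"
    using Nm by (intro mult_left_mono add_mono) auto
  also have "\<dots> = c * \<eta>"
    by (simp add: c_def algebra_simps)
  also have "\<dots> \<le> c * ((\<epsilon> / 2) powr p / (c + 1))"
    using c by (intro mult_left_mono) (auto simp: \<eta>_def)
  also have "\<dots> \<le> (\<epsilon> / 2) powr p"
    using c by (simp add: field_simps)
  finally have "Lp_seminorm p ?d \<le> \<epsilon> / 2"
    using \<epsilon> p by (subst Lp_seminorm_le_iff) auto
  then have "nrm (Lp_space p) (ae_class (\<lambda>x. indicator B x *\<^sub>C v) - ae_class (\<lambda>x. w x *\<^sub>C v)) < \<epsilon>"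
    using \<epsilon> by (simp add: ae_class_diff nrm_ae_class)
  with trig_poly_mode_span[OF w] show ?thesis by blast
qed

lemma mode_span_subset:
  assumes p: "1 \<le> p"
  shows "(mode_span :: ('n::finite, 'h::complex_hilbert) torus_L0 set) \<subseteq> vecs (Lp_space p)"
proof
  interpret seminormed "Lp_space p :: ('n, 'h) torus_L0 normed_space"
    by (rule seminormed_Lp_space[OF p])
  fix F :: "('n, 'h) torus_L0" assume "F \<in> mode_span"
  then show "F \<in> vecs (Lp_space p)"
    unfolding mode_span_def
  proof (induction rule: complex_vector.span_induct_alt)
    case (step c x y)
    then show ?case
      by (auto intro!: add_mem scaleC_mem ae_class_mem_Lp_space smooth_Lp_fun mode_smooth p)
  qed simp
qed

text \<open>Simple functions are dense, and each is a finite sum of indicators times vectors, which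
  are approximated one by one with the tolerance halved at every summand.\<close>

lemma mode_span_dense:
  fixes F :: "('n::finite, 'h::complex_hilbert) torus_L0"
  assumes p: "1 \<le> p" and F: "F \<in> vecs (Lp_space p)" and \<epsilon>: "0 < \<epsilon>"
  shows "\<exists>G\<in>mode_span. nrm (Lp_space p) (F - G) < \<epsilon>"
proof -
  let ?E = "Lp_space p :: ('n, 'h) torus_L0 normed_space"
  interpret seminormed ?E by (rule seminormed_Lp_space[OF p])
  have sum: "\<exists>G\<in>mode_span. nrm ?E ((\<Sum>y\<in>A. f y) - G) < \<delta>"
    if "finite A" "0 < \<delta>" "\<And>y. y \<in> A \<Longrightarrow> f y \<in> vecs ?E"
      "\<And>y \<delta>. y \<in> A \<Longrightarrow> 0 < \<delta> \<Longrightarrow> \<exists>G\<in>mode_span. nrm ?E (f y - G) < \<delta>"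
    for A :: "'h set" and f \<delta>
    using that
  proof (induction A arbitrary: \<delta> rule: finite_induct)
    case empty
    then show ?case
      by (intro bexI[of _ 0]) (simp_all add: mode_span_def complex_vector.span_zero)
  next
    case (insert a A)
    obtain G where G: "G \<in> mode_span" "nrm ?E ((\<Sum>y\<in>A. f y) - G) < \<delta> / 2"
      using insert.IH[of "\<delta> / 2"] insert.prems by auto
    obtain G' where G': "G' \<in> mode_span" "nrm ?E (f a - G') < \<delta> / 2"
      using insert.prems(1) insert.prems(3)[of a "\<delta> / 2"] by auto
    have mem: "f a - G' \<in> vecs ?E" "(\<Sum>y\<in>A. f y) - G \<in> vecs ?E"
      using G(1) G'(1) mode_span_subset[OF p] insert.prems(2) by (auto intro!: diff_mem sum_mem)
    have eq: "(\<Sum>y\<in>insert a A. f y) - (G' + G) = (f a - G') + ((\<Sum>y\<in>A. f y) - G)"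
      using insert.hyps by simp
    have "nrm ?E ((\<Sum>y\<in>insert a A. f y) - (G' + G)) < \<delta>"
      using nrm_triangle[OF mem] G(2) G'(2) unfolding eq by linarith
    moreover have "G' + G \<in> mode_span"
      using G(1) G'(1) unfolding mode_span_def by (rule complex_vector.span_add[rotated])
    ultimately show ?case by blast
  qed
  obtain g where g: "simple_function torus g" "g \<in> Lp_fun p"
    and Fg: "Lp_seminorm p (\<lambda>x. rep_L0 F x - g x) < \<epsilon> / 2"
    by (rule Lp_simple_function_dense[OF F[unfolded vecs_Lp_space] p, of "\<epsilon> / 2"]) (use \<epsilon> in simp)
  have gm [measurable]: "g \<in> borel_measurable torus" by (rule Lp_fun_measurable[OF g(2)])
  define C where "C y = g -` {y} \<inter> cbox 0 1" for y
  have fin: "finite (g ` cbox 0 1)" and C [measurable]: "C y \<in> sets torus" for y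
    using simple_functionD[OF g(1)] by (simp_all add: C_def)
  have gx: "g x = (\<Sum>y\<in>g ` cbox 0 1. indicator (C y) x *\<^sub>C y)" if "x \<in> cbox 0 1" for x
  proof -
    have "(\<Sum>y\<in>g ` cbox 0 1. indicator (C y) x *\<^sub>C y) = (\<Sum>y\<in>g ` cbox 0 1. if y = g x then g x else 0)"
      using that by (intro sum.cong) (auto simp: C_def)
    then show ?thesis using that fin by simp
  qed
  have "ae_class g = ae_class (\<lambda>x. \<Sum>y\<in>g ` cbox 0 1. indicator (C y) x *\<^sub>C y)"
    by (rule ae_class_eqI, rule AE_I2, rule gx) auto
  also have "\<dots> = (\<Sum>y\<in>g ` cbox 0 1. ae_class (\<lambda>x. indicator (C y) x *\<^sub>C y))"
    by (subst ae_class_sum) auto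
  finally have eq: "ae_class g = (\<Sum>y\<in>g ` cbox 0 1. ae_class (\<lambda>x. indicator (C y) x *\<^sub>C y))" .
  have "(\<lambda>x. indicator (C y) x *\<^sub>C y) \<in> Lp_fun p" for y
    by (rule bounded_Lp_fun[where C = "norm y"]) (auto simp: p norm_scaleC indicator_def)
  then have "\<exists>G\<in>mode_span. nrm ?E (ae_class g - G) < \<epsilon> / 2"
    unfolding eq using \<epsilon> by (intro sum fin mode_span_indicator_dense C p ae_class_mem_Lp_space) auto
  then obtain G where G: "G \<in> mode_span" "nrm ?E (ae_class g - G) < \<epsilon> / 2"
    by blast
  have "F - ae_class g = ae_class (\<lambda>x. rep_L0 F x - g x)"
    using ae_class_diff[of "rep_L0 F" g] by simp
  then have "nrm ?E (F - ae_class g) < \<epsilon> / 2"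
    using Fg by (simp add: nrm_ae_class)
  moreover have "nrm ?E (F - G) \<le> nrm ?E (F - ae_class g) + nrm ?E (ae_class g - G)"
    using F G(1) mode_span_subset[OF p] by (intro nrm_triangle_via ae_class_mem_Lp_space g) auto
  ultimately show ?thesis using G by (intro bexI[of _ G]) auto
qed

lemma linear_operator_eq_on_mode_span:
  fixes T T' :: "('n::finite, 'h::complex_hilbert) torus_L0 \<Rightarrow> 'w::complex_vector"
  assumes p: "1 \<le> p" and T: "linear_operator (Lp_space p) E T" and T': "linear_operator (Lp_space p) E T'"
    and eq: "\<And>\<xi> v. T (ae_class (\<lambda>x. char \<xi> x *\<^sub>C v)) = T' (ae_class (\<lambda>x. char \<xi> x *\<^sub>C v))"
    and F: "F \<in> mode_span"
  shows "T F = T' F"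
proof -
  interpret seminormed "Lp_space p :: ('n, 'h) torus_L0 normed_space"
    by (rule seminormed_Lp_space[OF p])
  have mode: "ae_class (\<lambda>x. char \<xi> x *\<^sub>C v) \<in> vecs (Lp_space p)" for \<xi> :: "int^'n" and v :: 'h
    by (intro ae_class_mem_Lp_space smooth_Lp_fun mode_smooth p)
  have zero: "S 0 = 0" if "linear_operator (Lp_space p :: ('n, 'h) torus_L0 normed_space) E S"
    for S :: "_ \<Rightarrow> 'w"
  proof -
    have "S (0 *\<^sub>C 0) = 0 *\<^sub>C S 0"
      using that zero_mem unfolding linear_operator_def by blast
    then show ?thesis by simp
  qed
  have "F \<in> vecs (Lp_space p) \<and> T F = T' F"
    using F unfolding mode_span_def
  proof (induction rule: complex_vector.span_induct_alt)
    case base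
    show ?case using zero[OF T] zero[OF T'] by simp
  next
    case (step c x y)
    then obtain \<xi> v where x: "x = ae_class (\<lambda>x. char \<xi> x *\<^sub>C v)" by blast
    have xE: "x \<in> vecs (Lp_space p)" unfolding x by (rule mode)
    have yE: "y \<in> vecs (Lp_space p)" and y: "T y = T' y" using step(2) by auto
    have "S (c *\<^sub>C x + y) = c *\<^sub>C S x + S y" if "linear_operator (Lp_space p) E S" for S :: "_ \<Rightarrow> 'w"
      using that xE yE scaleC_mem[OF xE] unfolding linear_operator_def by simp
    from this[OF T] this[OF T'] show ?case
      using eq[of \<xi> v] y add_mem[OF scaleC_mem[OF xE] yE] by (simp only: x simp_thms)
  qed
  then show ?thesis ..
qed

section \<open>The operator as a nuclear series\<close>

text \<open>The series is summed pointwise before passing to classes; under the assumptions below it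
  converges almost everywhere, and the values of \<open>suminf\<close> elsewhere do not affect the
  class.\<close>

definition series_operator ::
    "(nat \<Rightarrow> 'v \<Rightarrow> complex) \<Rightarrow> (nat \<Rightarrow> real^'n::finite \<Rightarrow> 'h::complex_hilbert) \<Rightarrow> 'v \<Rightarrow> ('n, 'h) torus_L0" where
  "series_operator \<phi> \<psi> F = ae_class (\<lambda>x. \<Sum>k. \<phi> k F *\<^sub>C \<psi> k x)"

text \<open>Functionals of norm at most 1 reduce every convergence question to the summability of
  the norms of the \<open>\<psi> k\<close>. Linearity is checked at the points where the series
  involved converge, and the remainders of the decomposition are tails in the sense of
  \<open>Lp_series_tail\<close>.\<close>

lemma series_operator_nuclear:
  fixes E :: "'v::complex_vector normed_space" and \<psi> :: "nat \<Rightarrow> real^'n::finite \<Rightarrow> 'h::complex_hilbert"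
  assumes E: "seminormed E" and \<phi>: "\<And>k. \<phi> k \<in> dual E" and \<phi>1: "\<And>k. dual_norm E (\<phi> k) \<le> 1"
    and \<psi>: "\<And>k. \<psi> k \<in> Lp_fun p" and summ: "summable (\<lambda>k. Lp_seminorm p (\<psi> k) powr s)"
    and s: "0 < s" "s \<le> 1" and p: "1 \<le> p"
  shows "linear_operator E (Lp_space p) (series_operator \<phi> \<psi>)"
    and "nuclear_decomposition s E (Lp_space p) (series_operator \<phi> \<psi>) \<phi> (\<lambda>k. ae_class (\<psi> k))"
proof -
  interpret E: seminormed E by (rule E)
  note [measurable] = \<psi>[THEN Lp_fun_measurable]
  have summ1: "summable (\<lambda>k. Lp_seminorm p (\<psi> k))"
    using summable_powr_mono[of "\<lambda>k. Lp_seminorm p (\<psi> k)" s 1] summ s by simp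
  have bound: "cmod (\<phi> k F) \<le> nrm E F" if "F \<in> vecs E" for k F
    using E.dual_norm_bound[OF \<phi> that, of k] mult_right_mono[OF \<phi>1[of k] E.nrm_nonneg[OF that]] by simp
  have term_Lp: "(\<lambda>x. \<phi> k F *\<^sub>C \<psi> k x) \<in> Lp_fun p" for k F
    using Lp_fun_scaleC(1)[OF \<psi>] p by simp
  have term_summ: "summable (\<lambda>k. Lp_seminorm p (\<lambda>x. \<phi> k F *\<^sub>C \<psi> k x))" if "F \<in> vecs E" for F
  proof (rule summable_comparison_test')
    show "summable (\<lambda>k. nrm E F * Lp_seminorm p (\<psi> k))"
      by (intro summable_mult summ1)
    show "norm (Lp_seminorm p (\<lambda>x. \<phi> k F *\<^sub>C \<psi> k x)) \<le> nrm E F * Lp_seminorm p (\<psi> k)" if "0 \<le> k" for k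
      using bound[OF \<open>F \<in> vecs E\<close>, of k] p by (simp add: Lp_fun_scaleC(2)[OF \<psi>] mult_right_mono)
  qed
  have mem: "(\<lambda>x. \<Sum>k. \<phi> k F *\<^sub>C \<psi> k x) \<in> Lp_fun p" if "F \<in> vecs E" for F
    using Lp_series_tail(1)[OF term_Lp term_summ[OF that] p, of 0] by simp
  have ae: "AE x in torus. summable (\<lambda>k. \<phi> k F *\<^sub>C \<psi> k x)" if "F \<in> vecs E" for F
    using Lp_series_AE_summable[OF term_Lp term_summ[OF that] p]
    by eventually_elim (rule summable_norm_cancel)
  have meas: "(\<lambda>x. \<Sum>k. \<phi> k F *\<^sub>C \<psi> k x) \<in> borel_measurable torus" for F
    by measurable
  show "linear_operator E (Lp_space p) (series_operator \<phi> \<psi>)"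
    unfolding linear_operator_def
  proof (intro conjI ballI allI)
    fix F assume F: "F \<in> vecs E"
    show "series_operator \<phi> \<psi> F \<in> vecs (Lp_space p)"
      unfolding series_operator_def by (intro ae_class_mem_Lp_space mem F)
    fix G assume G: "G \<in> vecs E"
    have "AE x in torus. (\<Sum>k. \<phi> k (F + G) *\<^sub>C \<psi> k x) = (\<Sum>k. \<phi> k F *\<^sub>C \<psi> k x) + (\<Sum>k. \<phi> k G *\<^sub>C \<psi> k x)"
      using ae[OF F] ae[OF G]
      by eventually_elim (simp add: suminf_add E.dual_add[OF \<phi> F G] scaleC_add_left)
    then show "series_operator \<phi> \<psi> (F + G) = series_operator \<phi> \<psi> F + series_operator \<phi> \<psi> G"
      unfolding series_operator_def ae_class_add[OF meas meas]
      by (rule ae_class_eqI) (intro meas borel_measurable_add)+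
  next
    fix c F assume F: "F \<in> vecs E"
    have "AE x in torus. (\<Sum>k. \<phi> k (c *\<^sub>C F) *\<^sub>C \<psi> k x) = c *\<^sub>C (\<Sum>k. \<phi> k F *\<^sub>C \<psi> k x)"
      using ae[OF F]
    proof eventually_elim
      case (elim x)
      from bounded_linear.suminf[OF bounded_linear_scaleC elim, of c] show ?case
        by (simp add: E.dual_scaleC[OF \<phi> F] scaleC_scaleC)
    qed
    then show "series_operator \<phi> \<psi> (c *\<^sub>C F) = c *\<^sub>C series_operator \<phi> \<psi> F"
      unfolding series_operator_def ae_class_scaleC[OF meas]
      by (rule ae_class_eqI) (intro meas borel_measurable_scaleC)+
  qed
  have conv: "(\<lambda>m. nrm (Lp_space p) (series_operator \<phi> \<psi> F - (\<Sum>k<m. \<phi> k F *\<^sub>C ae_class (\<psi> k)))) \<longlonglongrightarrow> 0"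
    if F: "F \<in> vecs E" for F
  proof (rule Lim_null_comparison)
    let ?a = "\<lambda>k. Lp_seminorm p (\<lambda>x. \<phi> k F *\<^sub>C \<psi> k x)"
    have "nrm (Lp_space p) (series_operator \<phi> \<psi> F - (\<Sum>k<m. \<phi> k F *\<^sub>C ae_class (\<psi> k))) \<le> (\<Sum>k. ?a (k + m))" for m
    proof -
      have "series_operator \<phi> \<psi> F - (\<Sum>k<m. \<phi> k F *\<^sub>C ae_class (\<psi> k))
          = ae_class (\<lambda>x. (\<Sum>k. \<phi> k F *\<^sub>C \<psi> k x) - (\<Sum>k<m. \<phi> k F *\<^sub>C \<psi> k x))"
        unfolding series_operator_def by (simp add: ae_class_scaleC ae_class_sum ae_class_diff)
      then show ?thesis
        using Lp_series_tail(2)[OF term_Lp term_summ[OF F] p, of m] by (simp add: nrm_ae_class)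
    qed
    then show "\<forall>\<^sub>F m in sequentially. norm (nrm (Lp_space p) (series_operator \<phi> \<psi> F - (\<Sum>k<m. \<phi> k F *\<^sub>C ae_class (\<psi> k))))
        \<le> (\<Sum>k. ?a (k + m))"
      by (simp add: nrm_Lp_space)
    have "(\<lambda>m. suminf ?a - sum ?a {..<m}) \<longlonglongrightarrow> suminf ?a - suminf ?a"
      by (intro tendsto_diff tendsto_const summable_LIMSEQ term_summ F)
    then show "(\<lambda>m. \<Sum>k. ?a (k + m)) \<longlonglongrightarrow> 0"
      using suminf_minus_initial_segment[OF term_summ[OF F]] by simp
  qed
  have "summable (\<lambda>k. dual_norm E (\<phi> k) powr s * nrm (Lp_space p) (ae_class (\<psi> k)) powr s)"
  proof (rule summable_comparison_test'[OF summ])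
    fix k :: nat
    have "dual_norm E (\<phi> k) powr s \<le> 1"
      using E.dual_norm_nonneg[OF \<phi>, of k] \<phi>1[of k] s by (intro powr_le1) auto
    then show "norm (dual_norm E (\<phi> k) powr s * nrm (Lp_space p) (ae_class (\<psi> k)) powr s) \<le> Lp_seminorm p (\<psi> k) powr s"
      by (simp add: nrm_ae_class mult_left_le_one_le)
  qed
  with conv show "nuclear_decomposition s E (Lp_space p) (series_operator \<phi> \<psi>) \<phi> (\<lambda>k. ae_class (\<psi> k))"
    unfolding nuclear_decomposition_def by (auto intro: \<phi> ae_class_mem_Lp_space \<psi>)
qed

section \<open>The series attached to a symbol\<close>

lemma fourier_coeff_eq: "fourier_coeff f \<xi> = weighted_integral (char (- \<xi>)) f"
  by (simp add: fourier_coeff_def weighted_integral_def char_def int_vec_minus)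

lemma basis_functional:
  fixes v :: "'h::complex_hilbert"
  assumes "norm v = 1"
  shows "(\<lambda>x. cinner x v) \<in> dual H_space" and "dual_norm H_space (\<lambda>x. cinner x v) \<le> 1"
proof -
  show "(\<lambda>x. cinner x v) \<in> dual H_space"
    using cinner_Cauchy_Schwarz[of _ v]
    by (auto simp: dual_def H_space_def cinner_add_left cinner_scaleC_left mult.commute intro!: exI[of _ "norm v"])
  show "dual_norm H_space (\<lambda>x. cinner x v) \<le> 1"
    using cinner_Cauchy_Schwarz[of _ v] assms
    by (intro seminormed.dual_norm_le[OF seminormed_H_space]) (auto simp: H_space_def)
qed

text \<open>Nuclear decompositions are series over the natural numbers, whereas the result speaks of
  unordered sums; summability of the norms makes the passage along an enumeration
  legitimate.\<close>

lemma summable_norm_imp_has_sum_reindex: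
  fixes f :: "'b \<Rightarrow> 'a::banach"
  assumes en: "bij_betw en (UNIV :: nat set) A" and summ: "summable (\<lambda>k. norm (f (en k)))"
  shows "(f has_sum (\<Sum>k. f (en k))) A"
  using norm_summable_imp_has_sum[OF summ summable_sums[OF summable_norm_cancel[OF summ]]]
  by (simp add: has_sum_reindex_bij_betw[OF en])

lemma summable_on_imp_summable_reindex:
  fixes f :: "'b \<Rightarrow> real"
  assumes en: "bij_betw en (UNIV :: nat set) A" and summ: "f summable_on A"
  shows "summable (\<lambda>k. f (en k))"
  using summ summable_on_reindex_bij_betw[OF en, of f] summable_on_UNIV_nonneg_real_iff
  by (metis summable_on_imp_summable)

locale torus_symbol =
  fixes I :: "'i set" and e :: "'i \<Rightarrow> 'h::complex_hilbert"
    and \<sigma> :: "real^'n::finite \<Rightarrow> int^'n \<Rightarrow> 'h \<Rightarrow> 'h" and A :: "(real^'n \<Rightarrow> 'h) \<Rightarrow> real^'n \<Rightarrow> 'h"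
    and s p q :: real
  assumes basis: "orthonormal_basis I e" and inf: "infinite I"
    and s: "0 < s" "s \<le> 1" and p: "1 \<le> p" and q: "1 \<le> q"
    and psdo: "pseudo_differential \<sigma> A"
    and \<sigma>_Lp: "\<And>\<xi> \<alpha>. \<alpha> \<in> I \<Longrightarrow> (\<lambda>x. \<sigma> x \<xi> (e \<alpha>)) \<in> Lp_fun q"
    and \<sigma>_summable: "(\<lambda>(\<xi>, \<alpha>). Lp_seminorm q (\<lambda>x. \<sigma> x \<xi> (e \<alpha>)) powr s) summable_on UNIV \<times> I"
begin

definition en :: "nat \<Rightarrow> (int^'n) \<times> 'i" where
  "en = from_nat_into (UNIV \<times> I)"

lemma bij_en: "bij_betw en UNIV (UNIV \<times> I)"
proof -
  have "countable ((UNIV :: (int^'n) set) \<times> I)"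
    using orthonormal_on_countable[OF orthonormal_basis_orthonormal[OF basis]]
    by (intro countable_SIGMA) simp_all
  moreover have "infinite ((UNIV :: (int^'n) set) \<times> I)"
    using inf by (auto simp: finite_cartesian_product_iff)
  ultimately show ?thesis
    unfolding en_def by (rule bij_betw_from_nat_into)
qed

lemma en_mem: "snd (en k) \<in> I"
  using bij_betwE[OF bij_en] by (metis UNIV_I mem_Times_iff)

lemma norm_e: "\<alpha> \<in> I \<Longrightarrow> norm (e \<alpha>) = 1"
  by (rule orthonormal_on_norm[OF orthonormal_basis_orthonormal[OF basis]])

lemma \<sigma>_bounded_linear: "bounded_linear (\<sigma> x \<xi>)"
  using psdo by (simp add: pseudo_differential_def operator_symbol_def bounded_clinear_def)

lemma \<sigma>_scaleC: "\<sigma> x \<xi> (c *\<^sub>C v) = c *\<^sub>C \<sigma> x \<xi> v"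
  using psdo by (simp add: pseudo_differential_def operator_symbol_def bounded_clinear_def)

definition \<phi> :: "nat \<Rightarrow> ('n, 'h) torus_L0 \<Rightarrow> complex" where
  "\<phi> k F = cinner (weighted_integral (char (- fst (en k))) (rep_L0 F)) (e (snd (en k)))"

definition \<psi> :: "nat \<Rightarrow> real^'n \<Rightarrow> 'h" where
  "\<psi> k x = char (fst (en k)) x *\<^sub>C \<sigma> x (fst (en k)) (e (snd (en k)))"

lemma \<psi>_Lp: "\<psi> k \<in> Lp_fun q" and Lp_seminorm_\<psi>:
  "Lp_seminorm q (\<psi> k) = Lp_seminorm q (\<lambda>x. \<sigma> x (fst (en k)) (e (snd (en k))))"
proof -
  note f = \<sigma>_Lp[OF en_mem, of "fst (en k)" k]
  have [measurable]: "(\<lambda>x. \<sigma> x (fst (en k)) (e (snd (en k)))) \<in> borel_measurable torus"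
    by (rule Lp_fun_measurable[OF f])
  have eq: "norm (\<psi> k x) = norm (\<sigma> x (fst (en k)) (e (snd (en k))))" for x
    by (simp add: \<psi>_def norm_scaleC)
  have "\<psi> k \<in> borel_measurable torus"
    unfolding \<psi>_def[abs_def] by measurable
  with f show "\<psi> k \<in> Lp_fun q"
    by (simp add: Lp_fun_def eq)
  show "Lp_seminorm q (\<psi> k) = Lp_seminorm q (\<lambda>x. \<sigma> x (fst (en k)) (e (snd (en k))))"
    by (simp add: Lp_seminorm_def eq)
qed

lemma \<psi>_summable_powr: "summable (\<lambda>k. Lp_seminorm q (\<psi> k) powr s)"
  using summable_on_imp_summable_reindex[OF bij_en \<sigma>_summable]
  by (simp add: Lp_seminorm_\<psi> case_prod_beta)

lemma \<psi>_summable: "summable (\<lambda>k. Lp_seminorm q (\<psi> k))"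
  using summable_powr_mono[OF _ s \<psi>_summable_powr] by simp

lemma \<phi>_dual: "\<phi> k \<in> dual (Lp_space p)" and \<phi>_norm: "dual_norm (Lp_space p) (\<phi> k) \<le> 1"
proof -
  note u = basis_functional[OF norm_e[OF en_mem], of k]
  have "char (- fst (en k)) \<in> borel_measurable torus" by simp
  note w = weighted_integral_dual[OF u(1) p this, of 1, unfolded norm_char, OF order_refl]
  show "\<phi> k \<in> dual (Lp_space p)"
    using w(1) by (simp add: \<phi>_def[abs_def])
  show "dual_norm (Lp_space p) (\<phi> k) \<le> 1"
    using order_trans[OF w(2)] u(2) by (simp add: \<phi>_def[abs_def])
qed

abbreviation T\<^sub>0 :: "('n, 'h) torus_L0 \<Rightarrow> ('n, 'h) torus_L0" where
  "T\<^sub>0 \<equiv> series_operator \<phi> \<psi>"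

lemma T0_nuclear:
  "linear_operator (Lp_space p) (Lp_space q) T\<^sub>0"
  "nuclear_decomposition s (Lp_space p) (Lp_space q) T\<^sub>0 \<phi> (\<lambda>k. ae_class (\<psi> k))"
  by (rule series_operator_nuclear[OF seminormed_Lp_space[OF p] \<phi>_dual \<phi>_norm \<psi>_Lp \<psi>_summable_powr s q])+

text \<open>At almost every x the family over pairs (\<xi>, \<alpha>) is absolutely summable, since
  the Fourier coefficients of f are bounded. It may then be summed first over \<alpha>, where
  continuity of \<sigma>(x, \<xi>) reassembles the \<xi>-term of the series for A f, and limits of
  unordered sums are unique.\<close>

lemma T0_extends: "extends_psdo A T\<^sub>0"
  unfolding extends_psdo_def
proof
  fix f :: "real^'n \<Rightarrow> 'h" assume f: "f \<in> smooth_torus"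
  have fp: "f \<in> Lp_fun p" by (rule smooth_Lp_fun[OF f p])
  have fm [measurable]: "f \<in> borel_measurable torus" by (rule Lp_fun_measurable[OF fp])
  have Af: "A f \<in> borel_measurable torus"
    using psdo f by (auto simp: pseudo_differential_def intro!: continuous_torus_measurable smooth_torus_continuous)
  have \<phi>f: "\<phi> k (ae_class f) = cinner (fourier_coeff f (fst (en k))) (e (snd (en k)))" for k
    by (simp add: \<phi>_def fourier_coeff_eq weighted_integral_rep)
  have coeff: "norm (fourier_coeff f \<xi>) \<le> Lp_seminorm p f" for \<xi>
    using norm_weighted_integral_le[OF fp p, of "char (- \<xi>)" 1] by (simp add: fourier_coeff_eq)
  have "AE x in torus. (\<Sum>k. \<phi> k (ae_class f) *\<^sub>C \<psi> k x) = A f x"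
    using Lp_series_AE_summable[OF \<psi>_Lp \<psi>_summable q]
  proof eventually_elim
    case (elim x)
    define a where "a = (\<lambda>(\<xi>, \<alpha>). cinner (fourier_coeff f \<xi>) (e \<alpha>) *\<^sub>C char \<xi> x *\<^sub>C \<sigma> x \<xi> (e \<alpha>))"
    have a: "\<phi> k (ae_class f) *\<^sub>C \<psi> k x = a (en k)" for k
      by (simp add: a_def \<phi>f \<psi>_def case_prod_beta)
    have "summable (\<lambda>k. norm (a (en k)))"
    proof (rule summable_comparison_test')
      show "summable (\<lambda>k. Lp_seminorm p f * norm (\<psi> k x))"
        by (intro summable_mult elim)
      fix k :: nat
      have "cmod (\<phi> k (ae_class f)) \<le> norm (fourier_coeff f (fst (en k))) * norm (e (snd (en k)))"
        unfolding \<phi>f by (rule cinner_Cauchy_Schwarz)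
      also have "\<dots> \<le> Lp_seminorm p f"
        using coeff by (simp add: norm_e[OF en_mem])
      finally show "norm (norm (a (en k))) \<le> Lp_seminorm p f * norm (\<psi> k x)"
        by (simp add: a[symmetric] norm_scaleC mult_right_mono)
    qed
    then have sum1: "(a has_sum (\<Sum>k. a (en k))) (UNIV \<times> I)"
      by (rule summable_norm_imp_has_sum_reindex[OF bij_en])
    have sum2: "((\<lambda>\<alpha>. a (\<xi>, \<alpha>)) has_sum char \<xi> x *\<^sub>C \<sigma> x \<xi> (fourier_coeff f \<xi>)) I" for \<xi>
    proof -
      have "((\<lambda>\<alpha>. \<sigma> x \<xi> (cinner (fourier_coeff f \<xi>) (e \<alpha>) *\<^sub>C e \<alpha>)) has_sum \<sigma> x \<xi> (fourier_coeff f \<xi>)) I"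
        by (rule has_sum_bounded_linear[OF \<sigma>_bounded_linear orthonormal_basis_expansion[OF basis]])
      from has_sum_bounded_linear[OF bounded_linear_scaleC this, of "char \<xi> x"] show ?thesis
        by (simp add: a_def \<sigma>_scaleC scaleC_scaleC mult.commute)
    qed
    have "((\<lambda>\<xi>. char \<xi> x *\<^sub>C \<sigma> x \<xi> (fourier_coeff f \<xi>)) has_sum (\<Sum>k. a (en k))) UNIV"
      by (rule has_sum_SigmaD[OF sum1 sum2])
    moreover have "((\<lambda>\<xi>. char \<xi> x *\<^sub>C \<sigma> x \<xi> (fourier_coeff f \<xi>)) has_sum A f x) UNIV"
      using psdo f unfolding pseudo_differential_def char_def by blast
    ultimately show ?case
      unfolding a by (rule has_sum_unique)
  qed
  moreover have [measurable]: "\<psi> k \<in> borel_measurable torus" for k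
    by (rule Lp_fun_measurable[OF \<psi>_Lp])
  have "(\<lambda>x. \<Sum>k. \<phi> k (ae_class f) *\<^sub>C \<psi> k x) \<in> borel_measurable torus"
    by measurable
  ultimately show "T\<^sub>0 (ae_class f) = ae_class (A f)"
    unfolding series_operator_def using Af by (intro ae_class_eqI)
qed

lemma extension_exists: "\<exists>T. extends_psdo A T \<and> s_nuclear s (Lp_space p) (Lp_space q) T"
  using T0_extends T0_nuclear by (auto simp: s_nuclear_def)

definition diag :: "int^'n \<Rightarrow> 'i \<Rightarrow> complex" where
  "diag \<xi> \<alpha> = (LINT x|torus. cinner (\<sigma> x \<xi> (e \<alpha>)) (e \<alpha>))"

text \<open>The two characters cancel, leaving the mean of \<sigma>(x, \<xi>)
  \<open>e \<alpha>\<close> over the torus; the bounded functional \<open>cinner\<close> moves under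
  the Bochner integral.\<close>

lemma \<phi>_\<psi>: "\<phi> k (ae_class (\<psi> k)) = (\<lambda>(\<xi>, \<alpha>). diag \<xi> \<alpha>) (en k)"
proof -
  let ?\<xi> = "fst (en k)" and ?\<alpha> = "snd (en k)"
  have "weighted_integral (char (- ?\<xi>)) (rep_L0 (ae_class (\<psi> k))) = weighted_integral (char (- ?\<xi>)) (\<psi> k)"
    by (intro weighted_integral_rep Lp_fun_measurable[OF \<psi>_Lp]) simp
  also have "\<dots> = (LINT x|torus. \<sigma> x ?\<xi> (e ?\<alpha>))"
    by (simp add: weighted_integral_def \<psi>_def scaleC_scaleC char_minus)
  finally have "\<phi> k (ae_class (\<psi> k)) = cinner (LINT x|torus. \<sigma> x ?\<xi> (e ?\<alpha>)) (e ?\<alpha>)"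
    by (simp add: \<phi>_def)
  also have "\<dots> = (LINT x|torus. cinner (\<sigma> x ?\<xi> (e ?\<alpha>)) (e ?\<alpha>))"
    by (rule integral_bounded_linear[OF bounded_linear_cinner_left, symmetric])
      (rule Lp_fun_integrable[OF \<sigma>_Lp[OF en_mem] q])
  finally show ?thesis by (simp add: diag_def case_prod_beta)
qed

lemma diag_norm_summable: "summable (\<lambda>k. norm ((\<lambda>(\<xi>, \<alpha>). diag \<xi> \<alpha>) (en k)))"
proof (rule summable_comparison_test'[OF \<psi>_summable])
  fix k :: nat
  let ?\<xi> = "fst (en k)" and ?\<alpha> = "snd (en k)"
  note f = \<sigma>_Lp[OF en_mem, of ?\<xi> k]
  have "cmod (diag ?\<xi> ?\<alpha>) \<le> (LINT x|torus. cmod (cinner (\<sigma> x ?\<xi> (e ?\<alpha>)) (e ?\<alpha>)))"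
    unfolding diag_def by (rule integral_norm_bound)
  also have "\<dots> \<le> (LINT x|torus. norm (\<sigma> x ?\<xi> (e ?\<alpha>)))"
  proof (rule integral_mono)
    show "integrable torus (\<lambda>x. cmod (cinner (\<sigma> x ?\<xi> (e ?\<alpha>)) (e ?\<alpha>)))"
      by (intro integrable_norm integrable_bounded_linear[OF bounded_linear_cinner_left] Lp_fun_integrable[OF f q])
    show "integrable torus (\<lambda>x. norm (\<sigma> x ?\<xi> (e ?\<alpha>)))"
      by (intro integrable_norm Lp_fun_integrable[OF f q])
    show "cmod (cinner (\<sigma> x ?\<xi> (e ?\<alpha>)) (e ?\<alpha>)) \<le> norm (\<sigma> x ?\<xi> (e ?\<alpha>))" for x
      using cinner_Cauchy_Schwarz[of "\<sigma> x ?\<xi> (e ?\<alpha>)" "e ?\<alpha>"] by (simp add: norm_e[OF en_mem])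
  qed
  also have "\<dots> \<le> Lp_seminorm q (\<psi> k)"
    unfolding Lp_seminorm_\<psi> by (rule integral_norm_le_Lp_seminorm[OF f q])
  finally show "norm (norm ((\<lambda>(\<xi>, \<alpha>). diag \<xi> \<alpha>) (en k))) \<le> Lp_seminorm q (\<psi> k)"
    by (simp add: case_prod_beta)
qed

lemma diag_has_sum: "((\<lambda>(\<xi>, \<alpha>). diag \<xi> \<alpha>) has_sum (\<Sum>k. \<phi> k (ae_class (\<psi> k)))) (UNIV \<times> I)"
  unfolding \<phi>_\<psi> by (rule summable_norm_imp_has_sum_reindex[OF bij_en diag_norm_summable])

lemma diag_summable_on: "diag \<xi> summable_on I"
  by (rule summable_on_SigmaD1[OF has_sum_imp_summable[OF diag_has_sum]]) simp

lemma trace_formula: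
  assumes pq: "p = q" and T: "extends_psdo A T" "s_nuclear s (Lp_space p) (Lp_space p) T"
  shows "((\<lambda>\<xi>. \<Sum>\<^sub>\<infinity>\<alpha>\<in>I. diag \<xi> \<alpha>) has_sum nuclear_trace (Lp_space p) T) UNIV"
proof -
  have E: "seminormed (Lp_space p :: ('n, 'h) torus_L0 normed_space)"
    by (rule seminormed_Lp_space[OF p])
  have lin: "linear_operator (Lp_space p) (Lp_space p) T"
    using T(2) by (simp add: s_nuclear_def)
  obtain \<phi>' \<psi>' where dec': "nuclear_decomposition s (Lp_space p) (Lp_space p) T \<phi>' \<psi>'"
    using T(2) by (auto simp: s_nuclear_def)
  note T0 = T0_nuclear[folded pq]
  have "T\<^sub>0 (ae_class f) = T (ae_class f)" if "f \<in> smooth_torus" for f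
    using that T0_extends T(1) by (simp add: extends_psdo_def)
  from linear_operator_eq_on_mode_span[OF p T0(1) lin this[OF mode_smooth]]
  have "nuclear_decomposition s (Lp_space p) (Lp_space p) T \<phi> (\<lambda>k. ae_class (\<psi> k))"
    by (intro nuclear_decomposition_transfer[OF E E s T0(1) lin T0(2) dec' _ mode_span_subset[OF p]]
        mode_span_dense[OF p])
  then have "(\<lambda>k. \<phi> k (ae_class (\<psi> k))) sums nuclear_trace (Lp_space p) T"
    by (intro nuclear_trace_eq[OF E metric_approximation_Lp_space[OF metric_approximation_H_space[OF basis] p] lin _ s])
  \<comment> \<open>The series along the enumeration is returned to an unordered sum over pairs,
    which then splits into the iterated sum.\<close>
  then have "((\<lambda>(\<xi>, \<alpha>). diag \<xi> \<alpha>) has_sum nuclear_trace (Lp_space p) T) (UNIV \<times> I)"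
    using diag_has_sum by (simp add: sums_iff)
  then show ?thesis
    by (rule has_sum_SigmaD) (simp add: has_sum_infsum diag_summable_on)
qed

end

section \<open>Schatten classes and Fourier multipliers\<close>

lemma Gram_Schmidt:
  fixes B :: "'h::complex_hilbert set"
  assumes "finite B" "complex_vector.independent B"
  shows "\<exists>Q. finite Q \<and> Q \<subseteq> cspan B \<and> card Q = card B \<and> orthonormal_on Q (\<lambda>x. x)"
  using assms
proof (induction B rule: finite_induct)
  case empty
  show ?case by (intro exI[of _ "{}"]) (simp add: orthonormal_on_def)
next
  case (insert b B)
  then have indep: "complex_vector.independent B" and b: "b \<notin> cspan B"
    by (auto simp: complex_vector.independent_insert)
  obtain Q where Q: "finite Q" "Q \<subseteq> cspan B" "card Q = card B" "orthonormal_on Q (\<lambda>x. x)"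
    using insert.IH[OF indep] by (elim exE conjE)
  define y where "y = (\<Sum>o'\<in>Q. cinner b o' *\<^sub>C o')"
  define z where "z = b - y"
  have y: "y \<in> cspan B"
    unfolding y_def using Q(2) by (intro complex_vector.span_sum complex_vector.span_scale) auto
  then have z: "z \<noteq> 0" using b by (auto simp: z_def)
  have orth: "cinner z o' = 0" if "o' \<in> Q" for o'
    using orthonormal_projection_cinner[OF Q(4,1) that, of "\<lambda>x. cinner b x"]
    by (simp add: z_def y_def cinner_diff_left)
  define x where "x = complex_of_real (1 / norm z) *\<^sub>C z"
  have x1: "cinner x x = 1"
    using z by (simp add: x_def cinner_self norm_scaleC norm_divide)
  have xo: "cinner x o' = 0" "cinner o' x = 0" if "o' \<in> Q" for o'
    using orth[OF that] cnj_cinner[of x o'] by (simp_all add: x_def cinner_scaleC_left)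
  have xO: "x \<notin> Q" using x1 xo(1)[of x] by auto
  have sub: "cspan B \<subseteq> cspan (insert b B)"
    by (rule complex_vector.span_mono) auto
  have "x \<in> cspan (insert b B)"
    unfolding x_def z_def using y sub
    by (intro complex_vector.span_scale complex_vector.span_diff) (auto intro: complex_vector.span_base)
  moreover have "orthonormal_on (insert x Q) (\<lambda>x. x)"
    using Q(4) x1 xo xO unfolding orthonormal_on_def by auto
  ultimately show ?case
    using Q sub xO insert.hyps by (intro exI[of _ "insert x Q"]) auto
qed

text \<open>In infinite dimension \<open>cdim V\<close> is the cardinality of an infinite set, hence
  0, and the empty set qualifies.\<close>

lemma subspace_orthonormal_subset:
  fixes V :: "'h::complex_hilbert set"
  assumes V: "complex_vector.subspace V"
  obtains Q where "finite Q" "Q \<subseteq> V" "card Q = cdim V" "orthonormal_on Q (\<lambda>x. x)"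
proof -
  obtain B where B: "B \<subseteq> V" "complex_vector.independent B" "card B = cdim V"
    by (rule complex_vector.basis_exists[of V])
  show thesis
  proof (cases "finite B")
    case True
    then obtain Q where Q: "finite Q" "Q \<subseteq> cspan B" "card Q = card B" "orthonormal_on Q (\<lambda>x. x)"
      using Gram_Schmidt[OF True B(2)] by (elim exE conjE)
    with complex_vector.span_minimal[OF B(1) V] B(3) show thesis by (intro that) auto
  next
    case False
    with B(3) show thesis by (intro that[of "{}"]) (auto simp: orthonormal_on_def)
  qed
qed

section \<open>Operators with summable images of a basis\<close>

lemma orthonormal_basis_reindex:
  assumes B: "orthonormal_basis I e" and b: "bij_betw b (UNIV :: nat set) I"
  shows "orthonormal_basis UNIV (\<lambda>k. e (b k))"
proof -
  have mem: "b k \<in> I" for k using b by (auto dest: bij_betwE)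
  have inj: "b k = b j \<longleftrightarrow> k = j" for k j
    using b by (auto simp: bij_betw_def dest: injD)
  have "(\<lambda>k. e (b k)) ` UNIV = e ` I"
    using b by (auto simp: bij_betw_def)
  with B mem inj show ?thesis
    unfolding orthonormal_basis_def by simp
qed

text \<open>The situation of a multiplier at one fixed frequency, with the basis enumerated by the
  natural numbers.\<close>

locale summable_operator =
  fixes g :: "nat \<Rightarrow> 'h::complex_hilbert" and \<tau> :: "'h \<Rightarrow> 'h" and s :: real
  assumes basis: "orthonormal_basis UNIV g" and \<tau>: "bounded_clinear \<tau>"
    and summ: "summable (\<lambda>k. norm (\<tau> (g k)) powr s)" and s: "0 < s" "s \<le> 1"
begin

lemma summable_image: "summable (\<lambda>k. norm (\<tau> (g k)))"
  using summable_powr_mono[OF _ s summ] by simp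

lemma norm_g: "norm (g k) = 1"
  by (rule orthonormal_on_norm[OF orthonormal_basis_orthonormal[OF basis]]) simp

lemma bounded_linear_\<tau>: "bounded_linear \<tau>"
  using \<tau> by (simp add: bounded_clinear_def)

lemma \<tau>_scaleC: "\<tau> (c *\<^sub>C x) = c *\<^sub>C \<tau> x"
  using \<tau> by (simp add: bounded_clinear_def)

lemma \<tau>_expansion: "((\<lambda>k. cinner x (g k) *\<^sub>C \<tau> (g k)) has_sum \<tau> x) UNIV"
  using has_sum_bounded_linear[OF bounded_linear_\<tau> orthonormal_basis_expansion[OF basis], of x]
  by (simp add: \<tau>_scaleC)

lemma coeff_le: "cmod (cinner x (g k)) \<le> norm x"
  using cinner_Cauchy_Schwarz[of x "g k"] by (simp add: norm_g)

text \<open>Applying \<tau> to the basis expansion of x gives a nuclear decomposition whose trace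
  series is the diagonal of \<tau>; the summability hypothesis is its nuclearity condition.\<close>

lemma nuclear_trace_H: "((\<lambda>k. cinner (\<tau> (g k)) (g k)) sums nuclear_trace H_space \<tau>)"
proof -
  have lin: "linear_operator H_space H_space \<tau>"
    using bounded_linear_\<tau>
    by (auto simp: linear_operator_def H_space_def \<tau>_scaleC linear_add[OF bounded_linear.linear])
  note u = basis_functional[OF norm_g]
  have "summable (\<lambda>k. dual_norm H_space (\<lambda>x. cinner x (g k)) powr s * norm (\<tau> (g k)) powr s)"
  proof (rule summable_comparison_test'[OF summ])
    fix k :: nat
    have "dual_norm H_space (\<lambda>x. cinner x (g k)) powr s \<le> 1"
      using seminormed.dual_norm_nonneg[OF seminormed_H_space u(1)] u(2) s by (intro powr_le1) auto
    then show "norm (dual_norm H_space (\<lambda>x. cinner x (g k)) powr s * norm (\<tau> (g k)) powr s) \<le> norm (\<tau> (g k)) powr s"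
      by (simp add: mult_left_le_one_le)
  qed
  moreover have "(\<lambda>m. norm (\<tau> x - (\<Sum>k<m. cinner x (g k) *\<^sub>C \<tau> (g k)))) \<longlonglongrightarrow> 0" for x
  proof -
    have "(\<lambda>m. \<Sum>k<m. cinner x (g k) *\<^sub>C \<tau> (g k)) \<longlonglongrightarrow> \<tau> x"
      using has_sum_imp_sums[OF \<tau>_expansion] by (simp add: sums_def)
    from tendsto_norm[OF tendsto_diff[OF tendsto_const[of "\<tau> x"] this]] show ?thesis by simp
  qed
  ultimately have "nuclear_decomposition s H_space H_space \<tau> (\<lambda>k x. cinner x (g k)) (\<lambda>k. \<tau> (g k))"
    using u(1) by (simp add: nuclear_decomposition_def) (simp add: H_space_def)
  from nuclear_trace_eq[OF seminormed_H_space metric_approximation_H_space[OF basis] lin this s]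
  show ?thesis .
qed

text \<open>Coefficients of a vector in the unit ball have modulus at most 1, so this set contains
  all m-th partial sums of \<tau> on the unit ball.\<close>

lemma compact_disc_combinations: "compact {\<Sum>k<m. c k *\<^sub>C \<tau> (g k) | c. \<forall>k. cmod (c k) \<le> 1}" (is "compact (?C m)")
proof (induction m)
  case 0
  have "?C 0 = {0}" by (auto intro: exI[of _ "\<lambda>_. 0"])
  then show ?case by (simp only: compact_sing)
next
  case (Suc m)
  have "?C (Suc m) = {x + y | x y. x \<in> ?C m \<and> y \<in> (\<lambda>c. c *\<^sub>C \<tau> (g m)) ` cball 0 1}" (is "_ = ?S")
  proof (intro equalityI subsetI)
    fix z assume "z \<in> ?C (Suc m)"
    then obtain c where "\<forall>k. cmod (c k) \<le> 1" "z = (\<Sum>k<m. c k *\<^sub>C \<tau> (g k)) + c m *\<^sub>C \<tau> (g m)"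
      by auto
    then show "z \<in> ?S" by (auto intro!: exI)
  next
    fix z assume "z \<in> ?S"
    then obtain c d where c: "\<forall>k. cmod (c k) \<le> 1" "cmod d \<le> 1" "z = (\<Sum>k<m. c k *\<^sub>C \<tau> (g k)) + d *\<^sub>C \<tau> (g m)"
      by auto
    then show "z \<in> ?C (Suc m)"
      by (intro CollectI exI[of _ "c(m := d)"]) auto
  qed
  moreover have "compact ?S"
    by (intro compact_sums Suc.IH compact_continuous_image compact_cball
        linear_continuous_on bounded_linear_scaleC_left)
  ultimately show ?case by simp
qed

lemma \<tau>_tail:
  assumes "norm x \<le> 1"
  shows "norm (\<tau> x - (\<Sum>k<m. cinner x (g k) *\<^sub>C \<tau> (g k))) \<le> (\<Sum>k. norm (\<tau> (g (k + m))))"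
proof -
  have le: "norm (cinner x (g (k + m)) *\<^sub>C \<tau> (g (k + m))) \<le> norm (\<tau> (g (k + m)))" for k
    using coeff_le[of x "k + m"] assms by (simp add: norm_scaleC mult_left_le_one_le)
  have summ': "summable (\<lambda>k. norm (\<tau> (g (k + m))))"
    by (rule summable_ignore_initial_segment[OF summable_image])
  have "(\<lambda>k. cinner x (g (k + m)) *\<^sub>C \<tau> (g (k + m))) sums (\<tau> x - (\<Sum>k<m. cinner x (g k) *\<^sub>C \<tau> (g k)))"
    by (rule sums_split_initial_segment[OF has_sum_imp_sums[OF \<tau>_expansion]])
  then have "\<tau> x - (\<Sum>k<m. cinner x (g k) *\<^sub>C \<tau> (g k)) = (\<Sum>k. cinner x (g (k + m)) *\<^sub>C \<tau> (g (k + m)))"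
    by (rule sums_unique)
  also have "norm \<dots> \<le> (\<Sum>k. norm (cinner x (g (k + m)) *\<^sub>C \<tau> (g (k + m))))"
    by (rule summable_norm) (rule summable_comparison_test'[OF summ'], simp add: le)
  also have "\<dots> \<le> (\<Sum>k. norm (\<tau> (g (k + m))))"
    by (intro suminf_le le summ' summable_comparison_test'[OF summ']) (simp add: le)
  finally show ?thesis .
qed

text \<open>By \<open>\<tau>_tail\<close> the partial sums approximate \<tau> uniformly on the unit
  ball, so \<epsilon>/4 for the tail and \<epsilon>/4 for a net of the partial sums cover the image
  by closed balls of radius \<epsilon>/2. These absorb the closure and fit into open balls of radius
  \<epsilon>.\<close>

lemma compact_\<tau>: "compact_operator \<tau>"
  unfolding compact_operator_def
proof (intro conjI \<tau>)
  show "compact (closure (\<tau> ` cball 0 1))"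
    unfolding compact_eq_totally_bounded
  proof (intro conjI allI impI)
    show "complete (closure (\<tau> ` cball 0 1))"
      by (simp add: complete_eq_closed)
    fix \<epsilon> :: real assume \<epsilon>: "0 < \<epsilon>"
    have "(\<lambda>m. (\<Sum>k. norm (\<tau> (g k))) - (\<Sum>k<m. norm (\<tau> (g k)))) \<longlonglongrightarrow>
        (\<Sum>k. norm (\<tau> (g k))) - (\<Sum>k. norm (\<tau> (g k)))"
      by (intro tendsto_diff tendsto_const summable_LIMSEQ summable_image)
    then have "(\<lambda>m. \<Sum>k. norm (\<tau> (g (k + m)))) \<longlonglongrightarrow> 0"
      using suminf_minus_initial_segment[OF summable_image] by simp
    then have "\<forall>\<^sub>F m in sequentially. (\<Sum>k. norm (\<tau> (g (k + m)))) < \<epsilon> / 4"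
      using \<epsilon> by (intro order_tendstoD) auto
    then obtain m where m: "(\<Sum>k. norm (\<tau> (g (k + m)))) < \<epsilon> / 4"
      using eventually_happens'[OF sequentially_bot] by blast
    have "\<exists>K. finite K \<and> {\<Sum>k<m. c k *\<^sub>C \<tau> (g k) | c. \<forall>k. cmod (c k) \<le> 1} \<subseteq> (\<Union>z\<in>K. ball z (\<epsilon> / 4))"
      using compact_disc_combinations[of m, unfolded compact_eq_totally_bounded] \<epsilon> by simp
    then obtain K where K: "finite K"
      "{\<Sum>k<m. c k *\<^sub>C \<tau> (g k) | c. \<forall>k. cmod (c k) \<le> 1} \<subseteq> (\<Union>z\<in>K. ball z (\<epsilon> / 4))"
      by (elim exE conjE)
    have "\<tau> ` cball 0 1 \<subseteq> (\<Union>z\<in>K. cball z (\<epsilon> / 2))"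
    proof
      fix y assume "y \<in> \<tau> ` cball 0 1"
      then obtain x where x: "norm x \<le> 1" "y = \<tau> x" by auto
      let ?y = "\<Sum>k<m. cinner x (g k) *\<^sub>C \<tau> (g k)"
      have "?y \<in> {\<Sum>k<m. c k *\<^sub>C \<tau> (g k) | c. \<forall>k. cmod (c k) \<le> 1}"
        using order_trans[OF coeff_le x(1)] by (intro CollectI exI[of _ "\<lambda>k. cinner x (g k)"]) auto
      then obtain z where z: "z \<in> K" "dist z ?y < \<epsilon> / 4"
        using K(2) by (auto simp: subset_iff)
      have "dist ?y y < \<epsilon> / 4"
        using le_less_trans[OF \<tau>_tail[OF x(1)] m] unfolding x(2) dist_norm by (simp only: norm_minus_commute)
      then have "dist z y \<le> \<epsilon> / 2"
        using dist_triangle[of z y ?y] z(2) by linarith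
      with z(1) show "y \<in> (\<Union>z\<in>K. cball z (\<epsilon> / 2))" by auto
    qed
    then have "closure (\<tau> ` cball 0 1) \<subseteq> (\<Union>z\<in>K. cball z (\<epsilon> / 2))"
      using K(1) by (intro closure_minimal closed_UN) auto
    also have "\<dots> \<subseteq> (\<Union>z\<in>K. ball z \<epsilon>)"
      using \<epsilon> by (intro UN_mono) auto
    finally show "\<exists>K. finite K \<and> closure (\<tau> ` cball 0 1) \<subseteq> (\<Union>z\<in>K. ball z \<epsilon>)"
      using K(1) by (intro exI[of _ K] conjI)
  qed
qed

text \<open>\<open>cadjoint\<close> is a definite description, so an adjoint has to be exhibited.
  The witness \<open>S\<close> is the series with coefficients
  \<open>cinner y (\<tau> (g k))\<close> along \<open>g k\<close>, absolutely convergent because the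
  norms of the \<open>\<tau> (g k)\<close> are summable.\<close>

lemma cinner_cadjoint: "cinner (\<tau> x) y = cinner x (cadjoint \<tau> y)"
proof -
  define S where "S y = (\<Sum>k. cinner y (\<tau> (g k)) *\<^sub>C g k)" for y
  have S: "cinner (\<tau> x) y = cinner x (S y)" for x y
  proof -
    have "summable (\<lambda>k. cinner y (\<tau> (g k)) *\<^sub>C g k)"
    proof (rule summable_norm_cancel, rule summable_comparison_test')
      show "summable (\<lambda>k. norm y * norm (\<tau> (g k)))"
        by (intro summable_mult summable_image)
      show "norm (norm (cinner y (\<tau> (g k)) *\<^sub>C g k)) \<le> norm y * norm (\<tau> (g k))" if "0 \<le> k" for k
        using cinner_Cauchy_Schwarz[of y "\<tau> (g k)"] by (simp add: norm_scaleC norm_g)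
    qed
    then have "(\<lambda>k. cinner y (\<tau> (g k)) *\<^sub>C g k) sums S y"
      unfolding S_def by (rule summable_sums)
    from bounded_linear.sums[OF bounded_linear_cinner_right this, of x]
    have "(\<lambda>k. cinner x (g k) * cinner (\<tau> (g k)) y) sums cinner x (S y)"
      by (simp add: cinner_scaleC_right cnj_cinner mult.commute)
    moreover from bounded_linear.sums[OF bounded_linear_cinner_left has_sum_imp_sums[OF \<tau>_expansion], of x y]
    have "(\<lambda>k. cinner x (g k) * cinner (\<tau> (g k)) y) sums cinner (\<tau> x) y"
      by (simp add: cinner_scaleC_left)
    ultimately show ?thesis by (rule sums_unique2[rotated])
  qed
  have "cadjoint \<tau> = S"
    unfolding cadjoint_def
  proof (rule the_equality)
    show "\<forall>x y. cinner (\<tau> x) y = cinner x (S y)" using S by blast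
    fix R assume R: "\<forall>x y. cinner (\<tau> x) y = cinner x (R y)"
    show "R = S"
    proof
      fix y
      show "R y = S y"
      proof (rule cinner_eqI)
        fix z
        have "cinner z (R y) = cinner z (S y)" using R S by metis
        then show "cinner (R y) z = cinner (S y) z"
          using cnj_cinner[of z "R y"] cnj_cinner[of z "S y"] by simp
      qed
    qed
  qed
  with S show ?thesis by simp
qed

text \<open>The weak form of the eigenvalue equation: testing against all \<open>z\<close>
  eliminates the adjoint from the arguments that follow.\<close>

lemma sv_eigenspace_iff:
  "x \<in> sv_eigenspace \<tau> \<mu> \<longleftrightarrow> (\<forall>z. cinner (\<tau> z) (\<tau> x) = complex_of_real (\<mu>\<^sup>2) * cinner z x)"
proof
  assume "x \<in> sv_eigenspace \<tau> \<mu>"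
  then have "cadjoint \<tau> (\<tau> x) = complex_of_real (\<mu>\<^sup>2) *\<^sub>C x"
    by (simp add: sv_eigenspace_def)
  then show "\<forall>z. cinner (\<tau> z) (\<tau> x) = complex_of_real (\<mu>\<^sup>2) * cinner z x"
    by (simp add: cinner_cadjoint[of _ "\<tau> x"] cinner_scaleC_right)
next
  assume *: "\<forall>z. cinner (\<tau> z) (\<tau> x) = complex_of_real (\<mu>\<^sup>2) * cinner z x"
  have "cinner (cadjoint \<tau> (\<tau> x)) z = cinner (complex_of_real (\<mu>\<^sup>2) *\<^sub>C x) z" for z
  proof -
    have "cinner z (cadjoint \<tau> (\<tau> x)) = cinner z (complex_of_real (\<mu>\<^sup>2) *\<^sub>C x)"
      using * by (simp add: cinner_cadjoint[of z "\<tau> x", symmetric] cinner_scaleC_right)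
    from arg_cong[OF this, of cnj] show ?thesis by (simp only: cnj_cinner)
  qed
  then show "x \<in> sv_eigenspace \<tau> \<mu>"
    unfolding sv_eigenspace_def by (intro CollectI cinner_eqI)
qed

lemma subspace_sv_eigenspace: "complex_vector.subspace (sv_eigenspace \<tau> \<mu>)"
proof -
  have "\<tau> 0 = 0" "\<tau> (x + y) = \<tau> x + \<tau> y" for x y
    using linear_0[OF bounded_linear.linear[OF bounded_linear_\<tau>]]
      linear_add[OF bounded_linear.linear[OF bounded_linear_\<tau>]] by auto
  then show ?thesis
    unfolding complex_vector.subspace_def
    by (auto simp: sv_eigenspace_iff cinner_add_right \<tau>_scaleC cinner_scaleC_right algebra_simps)
qed

text \<open>Computing \<open>cinner (\<tau> x) (\<tau> y)\<close> from either eigenvector gives two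
  multiples of \<open>cinner x y\<close>, whose factors differ because \<mu> and \<nu> are positive
  and distinct.\<close>

lemma sv_eigenspace_orthogonal:
  assumes "x \<in> sv_eigenspace \<tau> \<mu>" "y \<in> sv_eigenspace \<tau> \<nu>" "0 < \<mu>" "0 < \<nu>" "\<mu> \<noteq> \<nu>"
  shows "cinner x y = 0"
proof -
  have 1: "cinner (\<tau> x) (\<tau> y) = complex_of_real (\<nu>\<^sup>2) * cinner x y"
    using assms(2) unfolding sv_eigenspace_iff by blast
  have "cinner (\<tau> y) (\<tau> x) = complex_of_real (\<mu>\<^sup>2) * cinner y x"
    using assms(1) unfolding sv_eigenspace_iff by blast
  from arg_cong[OF this, of cnj] have "cinner (\<tau> x) (\<tau> y) = complex_of_real (\<mu>\<^sup>2) * cinner x y"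
    by (simp only: complex_cnj_mult cnj_cinner complex_cnj_complex_of_real)
  with 1 have "complex_of_real (\<mu>\<^sup>2) = complex_of_real (\<nu>\<^sup>2) \<or> cinner x y = 0"
    by (auto simp del: of_real_power)
  then show ?thesis
    using assms(3-5) by (auto simp del: of_real_power simp: power2_eq_iff_nonneg)
qed

text \<open>With \<open>w\<^sub>x = \<bar>\<langle>g, x\<rangle>\<bar>\<^sup>2\<close>, Jensen gives \<open>(\<Sum> w\<^sub>x m\<^sub>x\<^sup>s)\<^bsup>2/s\<^esup> \<le> \<Sum> w\<^sub>x m\<^sub>x\<^sup>2\<close>, and
  the right-hand side is a Bessel sum of \<open>\<tau> g\<close> along the orthonormal vectors \<open>\<tau> x / m\<^sub>x\<close>.\<close>

lemma singular_Jensen: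
  fixes m :: "'h \<Rightarrow> real"
  assumes Q: "finite Q" "orthonormal_on Q (\<lambda>x. x)"
    and m: "\<And>x. x \<in> Q \<Longrightarrow> 0 < m x" and eig: "\<And>x. x \<in> Q \<Longrightarrow> x \<in> sv_eigenspace \<tau> (m x)"
    and v: "norm v = 1"
  shows "(\<Sum>x\<in>Q. m x powr s * (cmod (cinner v x))\<^sup>2) \<le> norm (\<tau> v) powr s"
proof -
  let ?w = "\<lambda>x. (cmod (cinner v x))\<^sup>2"
  have eq: "cinner (\<tau> z) (\<tau> x) = complex_of_real ((m x)\<^sup>2) * cinner z x" if "x \<in> Q" for z x
    using eig[OF that] unfolding sv_eigenspace_iff by blast
  define y where "y x = complex_of_real (1 / m x) *\<^sub>C \<tau> x" for x
  have y: "orthonormal_on Q y"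
    unfolding orthonormal_on_def
  proof (intro ballI)
    fix a b assume ab: "a \<in> Q" "b \<in> Q"
    have "cinner a b = (if a = b then 1 else 0)"
      using Q(2) ab by (simp add: orthonormal_on_def)
    then show "cinner (y a) (y b) = (if a = b then 1 else 0)"
      using m[OF ab(2)] by (auto simp: y_def cinner_scaleC_left cinner_scaleC_right eq[OF ab(2)] power2_eq_square)
  qed
  have vy: "(cmod (cinner (\<tau> v) (y x)))\<^sup>2 = ?w x * (m x)\<^sup>2" if "x \<in> Q" for x
  proof -
    have "cinner (\<tau> v) (y x) = complex_of_real (m x) * cinner v x"
      using m[OF that] by (simp add: y_def cinner_scaleC_right eq[OF that] power2_eq_square)
    then show ?thesis by (simp add: norm_mult power_mult_distrib)
  qed
  \<comment> \<open>The exponent 2/s is at least 1, and Bessel's inequality for the unit vector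
    \<open>v\<close> bounds the total weight by 1.\<close>
  have "(\<Sum>x\<in>Q. ?w x * m x powr s) powr (2 / s) \<le> (\<Sum>x\<in>Q. ?w x * (m x powr s) powr (2 / s))"
    using Bessel[OF Q(2,1), of v] v s Q(1) by (intro powr_sum_Jensen) auto
  also have "\<dots> = (\<Sum>x\<in>Q. ?w x * (m x)\<^sup>2)"
  proof (intro sum.cong refl)
    fix x assume "x \<in> Q"
    then have "m x powr 2 = (m x)\<^sup>2" using m[of x] by (simp add: powr_numeral)
    then show "?w x * (m x powr s) powr (2 / s) = ?w x * (m x)\<^sup>2"
      using s by (simp add: powr_powr)
  qed
  also have "\<dots> = (\<Sum>x\<in>Q. (cmod (cinner (\<tau> v) (y x)))\<^sup>2)"
    by (intro sum.cong refl) (simp only: vy)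
  also have "\<dots> \<le> (norm (\<tau> v))\<^sup>2"
    by (rule Bessel[OF y Q(1)])
  finally have "((\<Sum>x\<in>Q. ?w x * m x powr s) powr (2 / s)) powr (s / 2) \<le> ((norm (\<tau> v))\<^sup>2) powr (s / 2)"
    using s by (intro powr_mono2) auto
  moreover have "((norm (\<tau> v))\<^sup>2) powr (s / 2) = norm (\<tau> v) powr s"
  proof (cases "norm (\<tau> v) = 0")
    case False
    then show ?thesis
      using powr_powr[of "norm (\<tau> v)" 2 "s / 2"] by (simp add: powr_numeral)
  qed simp
  moreover have "0 \<le> (\<Sum>x\<in>Q. ?w x * m x powr s)"
    by (intro sum_nonneg) auto
  ultimately show ?thesis
    using s by (simp add: powr_powr mult.commute)
qed

text \<open>By Parseval the squared coefficients of a unit vector \<open>x\<close> along the basis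
  sum to 1. Weighting each power of \<open>m x\<close> by them and exchanging the two sums leaves
  one instance of \<open>singular_Jensen\<close> for every basis vector.\<close>

lemma sum_singular_powr_le:
  fixes m :: "'h \<Rightarrow> real"
  assumes Q: "finite Q" "orthonormal_on Q (\<lambda>x. x)"
    and m: "\<And>x. x \<in> Q \<Longrightarrow> 0 < m x" and eig: "\<And>x. x \<in> Q \<Longrightarrow> x \<in> sv_eigenspace \<tau> (m x)"
  shows "(\<Sum>x\<in>Q. m x powr s) \<le> (\<Sum>k. norm (\<tau> (g k)) powr s)"
proof -
  have "(\<lambda>k. m x powr s * (cmod (cinner (g k) x))\<^sup>2) sums (m x powr s)" if "x \<in> Q" for x
  proof -
    have "(\<lambda>k. (cmod (cinner x (g k)))\<^sup>2) sums (norm x)\<^sup>2"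
      by (rule has_sum_imp_sums[OF orthonormal_basis_Parseval[OF basis]])
    moreover have "cmod (cinner x (g k)) = cmod (cinner (g k) x)" for k
      by (metis cnj_cinner complex_mod_cnj)
    ultimately have "(\<lambda>k. (cmod (cinner (g k) x))\<^sup>2) sums 1"
      using orthonormal_on_norm[OF Q(2) that] by simp
    from sums_mult[OF this, of "m x powr s"] show ?thesis by simp
  qed
  then have "(\<lambda>k. \<Sum>x\<in>Q. m x powr s * (cmod (cinner (g k) x))\<^sup>2) sums (\<Sum>x\<in>Q. m x powr s)"
    by (rule sums_sum)
  then show ?thesis
    by (rule sums_le[OF _ _ summable_sums[OF summ], rotated]) (rule singular_Jensen[OF Q m eig norm_g])
qed

text \<open>For finitely many singular values, orthonormal sets of full dimension in their
  eigenspaces are merged into one orthonormal set, so the sum weighted by multiplicity becomes a sum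
  over vectors with a bound independent of the choice.\<close>

lemma \<tau>_schatten: "\<tau> \<in> schatten s"
  unfolding schatten_def
proof (intro CollectI conjI compact_\<tau>)
  let ?V = "sv_eigenspace \<tau>"
  have "\<exists>Q. finite Q \<and> Q \<subseteq> ?V \<mu> \<and> card Q = cdim (?V \<mu>) \<and> orthonormal_on Q (\<lambda>x. x)" for \<mu>
    by (rule subspace_orthonormal_subset[OF subspace_sv_eigenspace[of \<mu>]]) (intro exI conjI)
  then obtain Q where Q: "\<And>\<mu>. finite (Q \<mu>)" "\<And>\<mu>. Q \<mu> \<subseteq> ?V \<mu>" "\<And>\<mu>. card (Q \<mu>) = cdim (?V \<mu>)"
      "\<And>\<mu>. orthonormal_on (Q \<mu>) (\<lambda>x. x)"
    by metis
  show "(\<lambda>\<mu>. real (cdim (?V \<mu>)) * \<mu> powr s) summable_on singular_values \<tau>"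
  proof (rule nonneg_bdd_above_summable_on)
    show "0 \<le> real (cdim (?V \<mu>)) * \<mu> powr s" for \<mu> by simp
    show "bdd_above (sum (\<lambda>\<mu>. real (cdim (?V \<mu>)) * \<mu> powr s) ` {M. M \<subseteq> singular_values \<tau> \<and> finite M})"
    proof (rule bdd_aboveI2[where M = "\<Sum>k. norm (\<tau> (g k)) powr s"])
      fix M assume "M \<in> {M. M \<subseteq> singular_values \<tau> \<and> finite M}"
      then have M: "finite M" "\<And>\<mu>. \<mu> \<in> M \<Longrightarrow> 0 < \<mu>"
        by (auto simp: singular_values_def)
      have orth: "cinner x y = 0" if "x \<in> Q \<mu>" "y \<in> Q \<nu>" "\<mu> \<in> M" "\<nu> \<in> M" "\<mu> \<noteq> \<nu>" for x y \<mu> \<nu>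
        using that Q(2) M(2) by (intro sv_eigenspace_orthogonal) auto
      have one: "cinner x x = 1" if "x \<in> Q \<mu>" for x \<mu>
        using Q(4)[of \<mu>] that by (simp add: orthonormal_on_def)
      have uniq: "\<mu> = \<nu>" if "x \<in> Q \<mu>" "x \<in> Q \<nu>" "\<mu> \<in> M" "\<nu> \<in> M" for x \<mu> \<nu>
        using orth[OF that] one[OF that(1)] by (metis zero_neq_one)
      \<comment> \<open>Recovers the singular value from a vector; unit vectors from different
        eigenspaces are orthogonal, so no vector belongs to two of the sets \<open>Q \<mu>\<close>
        with \<mu> in \<open>M\<close>.\<close>
      define m where "m x = (THE \<mu>. \<mu> \<in> M \<and> x \<in> Q \<mu>)" for x
      have m: "m x = \<mu>" if "x \<in> Q \<mu>" "\<mu> \<in> M" for x \<mu>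
        unfolding m_def using that uniq by (intro the_equality) auto
      define U where "U = (\<Union>\<mu>\<in>M. Q \<mu>)"
      have U: "finite U" unfolding U_def using M(1) Q(1) by auto
      have "orthonormal_on U (\<lambda>x. x)"
        unfolding orthonormal_on_def
      proof (intro ballI)
        fix x y assume "x \<in> U" "y \<in> U"
        then obtain \<mu> \<nu> where xy: "x \<in> Q \<mu>" "y \<in> Q \<nu>" "\<mu> \<in> M" "\<nu> \<in> M" by (auto simp: U_def)
        show "cinner x y = (if x = y then 1 else 0)"
        proof (cases "\<mu> = \<nu>")
          case True
          with xy Q(4)[of \<mu>] show ?thesis by (simp add: orthonormal_on_def)
        next
          case False
          with xy uniq have "x \<noteq> y" by blast
          with orth[OF xy False] show ?thesis by simp
        qed
      qed
      have "(\<Sum>\<mu>\<in>M. real (cdim (?V \<mu>)) * \<mu> powr s) = (\<Sum>\<mu>\<in>M. \<Sum>x\<in>Q \<mu>. m x powr s)"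
      proof (intro sum.cong refl)
        fix \<mu> assume "\<mu> \<in> M"
        then have "(\<Sum>x\<in>Q \<mu>. m x powr s) = (\<Sum>x\<in>Q \<mu>. \<mu> powr s)"
          by (intro sum.cong) (auto simp: m)
        then show "real (cdim (?V \<mu>)) * \<mu> powr s = (\<Sum>x\<in>Q \<mu>. m x powr s)"
          by (simp add: Q(3))
      qed
      also have "\<dots> = (\<Sum>x\<in>U. m x powr s)"
        unfolding U_def using M(1) Q(1) uniq by (intro sum.UNION_disjoint[symmetric]) auto
      also have "\<dots> \<le> (\<Sum>k. norm (\<tau> (g k)) powr s)"
      proof (rule sum_singular_powr_le[OF U \<open>orthonormal_on U (\<lambda>x. x)\<close>])
        fix x assume "x \<in> U"
        then obtain \<mu> where "x \<in> Q \<mu>" "\<mu> \<in> M" by (auto simp: U_def)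
        then show "0 < m x" "x \<in> ?V (m x)" using m M(2) subsetD[OF Q(2)] by auto
      qed
      finally show "(\<Sum>\<mu>\<in>M. real (cdim (?V \<mu>)) * \<mu> powr s) \<le> (\<Sum>k. norm (\<tau> (g k)) powr s)" .
    qed
  qed
qed

end

section \<open>Extension, trace formula and Fourier multipliers\<close>

theorem theorem3p6:
  fixes I :: "'i set" and e :: "'i \<Rightarrow> 'h::complex_hilbert"
    and \<sigma> :: "real^'n::finite \<Rightarrow> int^'n \<Rightarrow> 'h \<Rightarrow> 'h"
    and A :: "(real^'n \<Rightarrow> 'h) \<Rightarrow> real^'n \<Rightarrow> 'h"
    and s p\<^sub>1 p\<^sub>2 :: real
  assumes "infinite_dimensional TYPE('h)"
    and "orthonormal_basis I e"
    and "0 < s" and "s \<le> 1"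
    and "pseudo_differential \<sigma> A"
    and "1 \<le> p\<^sub>1" and "1 \<le> p\<^sub>2"
    and "\<forall>\<xi>. \<forall>\<alpha>\<in>I. (\<lambda>x. \<sigma> x \<xi> (e \<alpha>)) \<in> Lp_fun p\<^sub>2"
    and "(\<lambda>(\<xi>, \<alpha>). Lp_norm p\<^sub>2 (ae_class (\<lambda>x. \<sigma> x \<xi> (e \<alpha>))) powr s) summable_on (UNIV \<times> I)"
  shows "(\<exists>T. extends_psdo A T \<and> s_nuclear s (Lp_space p\<^sub>1) (Lp_space p\<^sub>2) T) \<and>
    (p\<^sub>1 = p\<^sub>2 \<longrightarrow>
      (\<forall>\<xi>. (\<lambda>\<alpha>. LINT x|torus. cinner (\<sigma> x \<xi> (e \<alpha>)) (e \<alpha>)) summable_on I) \<and>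
      (\<forall>T. extends_psdo A T \<and> s_nuclear s (Lp_space p\<^sub>1) (Lp_space p\<^sub>1) T \<longrightarrow>
        ((\<lambda>\<xi>. \<Sum>\<^sub>\<infinity>\<alpha>\<in>I. LINT x|torus. cinner (\<sigma> x \<xi> (e \<alpha>)) (e \<alpha>))
          has_sum nuclear_trace (Lp_space p\<^sub>1) T) UNIV)) \<and>
    (\<forall>\<tau> :: int^'n \<Rightarrow> 'h \<Rightarrow> 'h. (\<forall>x \<xi>. \<sigma> x \<xi> = \<tau> \<xi>) \<longrightarrow>
      (\<forall>\<xi>. \<tau> \<xi> \<in> schatten s) \<and>
      (p\<^sub>1 = p\<^sub>2 \<longrightarrow>
        (\<forall>T. extends_psdo A T \<and> s_nuclear s (Lp_space p\<^sub>1) (Lp_space p\<^sub>1) T \<longrightarrow>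
          ((\<lambda>\<xi>. nuclear_trace H_space (\<tau> \<xi>))
            has_sum nuclear_trace (Lp_space p\<^sub>1) T) UNIV)))"
proof -
  have inf: "infinite I"
    by (rule orthonormal_basis_infinite[OF assms(2,1)])
  have summ: "(\<lambda>(\<xi>, \<alpha>). Lp_seminorm p\<^sub>2 (\<lambda>x. \<sigma> x \<xi> (e \<alpha>)) powr s) summable_on UNIV \<times> I"
  proof (rule summable_on_cong[THEN iffD1, OF _ assms(9)])
    fix z :: "(int^'n) \<times> 'i" assume "z \<in> UNIV \<times> I"
    then have "(\<lambda>x. \<sigma> x (fst z) (e (snd z))) \<in> borel_measurable torus"
      using assms(8) by (intro Lp_fun_measurable[of _ p\<^sub>2]) auto
    then show "(\<lambda>(\<xi>, \<alpha>). Lp_norm p\<^sub>2 (ae_class (\<lambda>x. \<sigma> x \<xi> (e \<alpha>))) powr s) z =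
        (\<lambda>(\<xi>, \<alpha>). Lp_seminorm p\<^sub>2 (\<lambda>x. \<sigma> x \<xi> (e \<alpha>)) powr s) z"
      by (simp add: case_prod_beta Lp_norm_ae_class)
  qed
  interpret torus_symbol I e \<sigma> A s p\<^sub>1 p\<^sub>2
    using assms(2-8) inf summ by unfold_locales auto
  have mult: "\<tau> \<xi> \<in> schatten s \<and> (\<Sum>\<^sub>\<infinity>\<alpha>\<in>I. diag \<xi> \<alpha>) = nuclear_trace H_space (\<tau> \<xi>)"
    if \<tau>: "\<forall>x \<xi>. \<sigma> x \<xi> = \<tau> \<xi>" for \<tau> :: "int^'n \<Rightarrow> 'h \<Rightarrow> 'h" and \<xi>
  proof -
    define b where "b = from_nat_into I"
    have b: "bij_betw b UNIV I"
      unfolding b_def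
      by (rule bij_betw_from_nat_into[OF orthonormal_on_countable[OF orthonormal_basis_orthonormal[OF basis]] inf])
    \<comment> \<open>The torus has measure 1, so a constant function has the norm of its value in
      every L^p; the hypothesis at frequency \<xi> becomes summability of the powers of the norms of
      \<tau>(\<xi>) \<open>e \<alpha>\<close>.\<close>
    have "Lp_seminorm p\<^sub>2 (\<lambda>x. \<sigma> x \<xi> v) = norm (\<tau> \<xi> v)" for v
      using \<tau> q by (simp add: Lp_seminorm_def powr_powr)
    then have "(\<lambda>\<alpha>. norm (\<tau> \<xi> (e \<alpha>)) powr s) summable_on I"
      using summable_on_SigmaD1[OF summ, of \<xi>] by simp
    then have "summable (\<lambda>k. norm (\<tau> \<xi> (e (b k))) powr s)"
      by (rule summable_on_imp_summable_reindex[OF b])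
    moreover have "bounded_clinear (\<tau> \<xi>)"
      using psdo \<tau> by (simp add: pseudo_differential_def operator_symbol_def)
    ultimately interpret M: summable_operator "\<lambda>k. e (b k)" "\<tau> \<xi>" s
      using orthonormal_basis_reindex[OF basis b] s by unfold_locales auto
    have diag: "diag \<xi> \<alpha> = cinner (\<tau> \<xi> (e \<alpha>)) (e \<alpha>)" for \<alpha>
      using \<tau> by (simp add: diag_def)
    \<comment> \<open>Along \<open>b\<close>, the inner sum of the trace formula and the trace
      series of \<open>\<tau> \<xi>\<close> on \<open>H\<close> are the same numerical
      series.\<close>
    have "((\<lambda>k. diag \<xi> (b k)) has_sum (\<Sum>\<^sub>\<infinity>\<alpha>\<in>I. diag \<xi> \<alpha>)) UNIV"
      using has_sum_infsum[OF diag_summable_on[of \<xi>]] by (simp add: has_sum_reindex_bij_betw[OF b])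
    from has_sum_imp_sums[OF this] have "(\<Sum>\<^sub>\<infinity>\<alpha>\<in>I. diag \<xi> \<alpha>) = nuclear_trace H_space (\<tau> \<xi>)"
      using M.nuclear_trace_H unfolding diag by (rule sums_unique2)
    with M.\<tau>_schatten show ?thesis by simp
  qed
  show ?thesis
  proof (intro conjI impI allI)
    show "\<exists>T. extends_psdo A T \<and> s_nuclear s (Lp_space p\<^sub>1) (Lp_space p\<^sub>2) T"
      by (rule extension_exists)
    show "(\<lambda>\<alpha>. LINT x|torus. cinner (\<sigma> x \<xi> (e \<alpha>)) (e \<alpha>)) summable_on I" for \<xi>
      using diag_summable_on[of \<xi>] by (simp add: diag_def[abs_def])
  next
    fix T assume "p\<^sub>1 = p\<^sub>2" "extends_psdo A T \<and> s_nuclear s (Lp_space p\<^sub>1) (Lp_space p\<^sub>1) T"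
    then show "((\<lambda>\<xi>. \<Sum>\<^sub>\<infinity>\<alpha>\<in>I. LINT x|torus. cinner (\<sigma> x \<xi> (e \<alpha>)) (e \<alpha>))
        has_sum nuclear_trace (Lp_space p\<^sub>1) T) UNIV"
      using trace_formula[of T] by (simp add: diag_def)
  next
    fix \<tau> :: "int^'n \<Rightarrow> 'h \<Rightarrow> 'h" and \<xi> assume "\<forall>x \<xi>. \<sigma> x \<xi> = \<tau> \<xi>"
    then show "\<tau> \<xi> \<in> schatten s" using mult by blast
  next
    fix \<tau> :: "int^'n \<Rightarrow> 'h \<Rightarrow> 'h" and T
    assume "\<forall>x \<xi>. \<sigma> x \<xi> = \<tau> \<xi>" "p\<^sub>1 = p\<^sub>2" "extends_psdo A T \<and> s_nuclear s (Lp_space p\<^sub>1) (Lp_space p\<^sub>1) T"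
    then show "((\<lambda>\<xi>. nuclear_trace H_space (\<tau> \<xi>)) has_sum nuclear_trace (Lp_space p\<^sub>1) T) UNIV"
      using trace_formula[of T] mult[of \<tau>] by simp
  qed
qed

end
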